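(* Let $A$ be a complex $n\times n$ matrix with $\|A\|_\infty\leq 1$ and minimal polynomial $m=\prod_{i=1}^{|m|}(z-\lambda_i)$, and suppose $\sigma(A)\subset\mathbb{D}$. Let $B$ be the Blaschke product associated with $m$ and $M_B$ the model operator on $K_B$. Then for any $\zeta\in\mathbb{C}\setminus\sigma(A)$ it holds that $$\|(\zeta-A)^{-1}\|_\infty\leq\|(\zeta-M_B)^{-1}\|_\infty$$ and, with respect to the Malmquist-Walsh basis $\{e_k\}_{k=1,\dots,|m|}$ of $K_B$, $$\left((\zeta-M_B)^{-1}\right)_{ij}=\begin{cases}0 & \text{if } i<j,\\[2pt] \dfrac{1}{\zeta-\lambda_i} & \text{if } i=j,\\[6pt] \dfrac{(1-|\lambda_i|^2)^{1/2}}{\zeta-\lambda_i}\,\dfrac{(1-|\lambda_j|^2)^{1/2}}{\zeta-\lambda_j}\,\displaystyle\prod_{\mu=j+1}^{i-1}\frac{1-\bar{\lambda}_\mu\zeta}{\zeta-\lambda_\mu} & \text{if } i>j,\end{cases}$$ for $1\le i,j\le |m|$, where the empty product is $1$.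
   Context: $\mathbb{D}$ is the open unit disk, $\sigma(A)$ the spectrum of $A$, and $\|\cdot\|_\infty$ the operator norm induced by the Hilbert space norm (for matrices: the Euclidean norm, so $\|A\|_\infty$ is the largest singular value). The degree of the minimal polynomial $m$ is denoted $|m|$, and $\lambda_1,\dots,\lambda_{|m|}$ are its zeros listed with multiplicity in $m$, in a fixed order. The Blaschke product associated with $m$ is $B(z)=\prod_{i=1}^{|m|}\frac{z-\lambda_i}{1-\bar\lambda_i z}$. $H_2$ is the Hardy space of analytic functions $f(z)=\sum_{k\ge0}\hat f(k)z^k$ on $\mathbb{D}$ with $\sum_{k\ge0}|\hat f(k)|^2<\infty$, a Hilbert space with inner product $\langle f|g\rangle=\int_{\partial\mathbb{D}}f(z)\overline{g(z)}\frac{|dz|}{2\pi}$ (boundary values). The model space is $K_B=H_2\cap(BH_2)^\perp$, which has dimension $|m|$; the model operator $M_B:K_B\to K_B$ is $M_B(f)=P_B(zf)$, where $P_B$ is the orthogonal projection onto $K_B$. The Malmquist-Walsh basis is the orthonormal basis of $K_B$ given by $e_k(z)=\frac{(1-|\lambda_k|^2)^{1/2}}{1-\bar\lambda_k z}\prod_{i=1}^{k-1}\frac{z-\lambda_i}{1-\bar\lambda_i z}$, $k=1,\dots,|m|$ (empty product equal to $1$). Matrix entries of an operator $X$ on $K_B$ are $X_{ij}=\langle Xe_j|e_i\rangle$. *)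

theory Defs
  imports "HOL-Complex_Analysis.Complex_Analysis" "HOL-Computational_Algebra.Polynomial"
begin

section \<open>Spectrum and minimal polynomial of a square matrix\<close>

definition mat_spectrum :: "complex^'n^'n \<Rightarrow> complex set" where
  "mat_spectrum A = {z. \<not> invertible (mat z - A)}"

text \<open>The library's power and product on \<open>complex^'n^'n\<close> are componentwise, so powers with
  respect to the matrix product \<open>**\<close> are defined separately.\<close>

primrec mat_pow :: "complex^'n^'n \<Rightarrow> nat \<Rightarrow> complex^'n^'n" where
  "mat_pow A 0 = mat 1"
| "mat_pow A (Suc k) = A ** mat_pow A k"

definition poly_mat :: "complex poly \<Rightarrow> complex^'n^'n \<Rightarrow> complex^'n^'n" where
  "poly_mat p A = (\<Sum>k\<le>degree p. mat (coeff p k) ** mat_pow A k)"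

definition is_min_poly :: "complex^'n^'n \<Rightarrow> complex poly \<Rightarrow> bool" where
  "is_min_poly A m \<longleftrightarrow> lead_coeff m = 1 \<and> poly_mat m A = 0 \<and>
     (\<forall>p. p \<noteq> 0 \<and> poly_mat p A = 0 \<longrightarrow> degree m \<le> degree p)"


section \<open>The Hardy space\<close>

text \<open>A function on the open unit disk is represented by its extension by \<open>0\<close> to the whole plane,
  so that equality in HOL is equality of functions on the disk.\<close>

definition taylor_coeff :: "(complex \<Rightarrow> complex) \<Rightarrow> nat \<Rightarrow> complex" where
  "taylor_coeff f k = (deriv ^^ k) f 0 / fact k"

definition hardy2 :: "(complex \<Rightarrow> complex) set" where
  "hardy2 = {f. f holomorphic_on ball 0 1 \<and> (\<forall>z. z \<notin> ball 0 1 \<longrightarrow> f z = 0) \<and>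
                summable (\<lambda>k. (cmod (taylor_coeff f k))\<^sup>2)}"

text \<open>Boundary values are radial limits; for functions in \<open>hardy2\<close> these exist almost everywhere
  on the unit circle.\<close>

definition boundary_value :: "(complex \<Rightarrow> complex) \<Rightarrow> complex \<Rightarrow> complex" where
  "boundary_value f w = Lim (at_left 1) (\<lambda>r::real. f (of_real r * w))"

definition hardy_inner :: "(complex \<Rightarrow> complex) \<Rightarrow> (complex \<Rightarrow> complex) \<Rightarrow> complex" where
  "hardy_inner f g =
     (LINT t:{0..2 * pi}|lebesgue. boundary_value f (cis t) * cnj (boundary_value g (cis t)))
       / (2 * of_real pi)"

definition hardy_norm :: "(complex \<Rightarrow> complex) \<Rightarrow> real" where
  "hardy_norm f = sqrt (Re (hardy_inner f f))"

definition orth_proj ::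
    "(complex \<Rightarrow> complex) set \<Rightarrow> (complex \<Rightarrow> complex) \<Rightarrow> (complex \<Rightarrow> complex)" where
  "orth_proj K g = (THE h. h \<in> K \<and> (\<forall>f\<in>K. hardy_inner (\<lambda>z. g z - h z) f = 0))"

definition hardy_opnorm ::
    "(complex \<Rightarrow> complex) set \<Rightarrow> ((complex \<Rightarrow> complex) \<Rightarrow> (complex \<Rightarrow> complex)) \<Rightarrow> real" where
  "hardy_opnorm K X = (SUP f\<in>{f\<in>K. hardy_norm f \<le> 1}. hardy_norm (X f))"


section \<open>Blaschke products, model space and model operator\<close>

definition blaschke :: "(nat \<Rightarrow> complex) \<Rightarrow> nat \<Rightarrow> complex \<Rightarrow> complex" where
  "blaschke lam N z = (\<Prod>i=1..N. (z - lam i) / (1 - cnj (lam i) * z))"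

definition model_space :: "(complex \<Rightarrow> complex) \<Rightarrow> (complex \<Rightarrow> complex) set" where
  "model_space B = {f\<in>hardy2. \<forall>g\<in>hardy2. hardy_inner f (\<lambda>z. B z * g z) = 0}"

definition model_op ::
    "(complex \<Rightarrow> complex) \<Rightarrow> (complex \<Rightarrow> complex) \<Rightarrow> (complex \<Rightarrow> complex)" where
  "model_op B f = orth_proj (model_space B) (\<lambda>z. z * f z)"

definition model_shifted ::
    "(complex \<Rightarrow> complex) \<Rightarrow> complex \<Rightarrow> (complex \<Rightarrow> complex) \<Rightarrow> (complex \<Rightarrow> complex)" where
  "model_shifted B \<zeta> f = (\<lambda>z. \<zeta> * f z - model_op B f z)"

definition model_resolvent ::
    "(complex \<Rightarrow> complex) \<Rightarrow> complex \<Rightarrow> (complex \<Rightarrow> complex) \<Rightarrow> (complex \<Rightarrow> complex)" where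
  "model_resolvent B \<zeta> = inv_into (model_space B) (model_shifted B \<zeta>)"

definition mw_basis :: "(nat \<Rightarrow> complex) \<Rightarrow> nat \<Rightarrow> complex \<Rightarrow> complex" where
  "mw_basis lam k z =
     (if z \<in> ball 0 1
      then of_real (sqrt (1 - (cmod (lam k))\<^sup>2)) / (1 - cnj (lam k) * z)
             * (\<Prod>i=1..k-1. (z - lam i) / (1 - cnj (lam i) * z))
      else 0)"

end

theory Submission
  imports Defs "HOL-Probability.Probability_Measure" "HOL-Real_Asymp.Real_Asymp"
begin

text \<open>
  Why the norm bound holds. Since \<open>A\<close> is a contraction with spectrum in the open disk, \<open>T = A\<^sup>*\<close>
  is a contraction whose powers tend to zero,
  so \<open>\<parallel>x\<parallel>\<^sup>2\<close> is the telescoping sum of the differences \<open>\<parallel>T\<^sup>k x\<parallel>\<^sup>2 - \<parallel>T\<^sup>k\<^sup>+\<^sup>1 x\<parallel>\<^sup>2\<close>. The form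
  \<open>\<parallel>x\<parallel>\<^sup>2 - \<parallel>T x\<parallel>\<^sup>2\<close> is positive semidefinite, hence a finite sum of \<open>\<bar>\<phi>\<^sub>l x\<bar>\<^sup>2\<close> with linear functionals
  \<open>\<phi>\<^sub>l\<close> (\<open>contraction_defect\<close>). So \<open>x \<mapsto> (\<Sum>\<^sub>k \<phi>\<^sub>l (T\<^sup>k x) z\<^sup>k)\<^sub>l\<close> is an isometry into finitely many copies
  of the Hardy space (\<open>W_isometric\<close>) and turns \<open>T\<close> into the backward shift (\<open>bshift_W\<close>). Because the
  minimal polynomial annihilates \<open>A\<close>, its values are orthogonal to all multiples of the Blaschke
  product, that is, they lie in the model space \<open>K\<close> (\<open>W_model_space\<close>). On \<open>K\<close> the backward shift is
  the adjoint of the model operator \<open>M\<close>, whence \<open>\<parallel>g\<parallel> \<le> \<parallel>(\<zeta> - M)\<^sup>-\<^sup>1\<parallel> \<parallel>(cnj \<zeta> - M\<^sup>*) g\<parallel>\<close> there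
  (\<open>adjoint_lower_bound\<close>). Pulling this back along the isometry (\<open>vector_lower_bound\<close>) bounds the
  inverse of \<open>cnj \<zeta> - A\<^sup>*\<close>, which has the same norm as its adjoint \<open>(\<zeta> - A)\<^sup>-\<^sup>1\<close>
  (\<open>resolvent_bound\<close>).

  Why the matrix is the stated one. With \<open>B\<^sub>k\<close> the product of the first \<open>k\<close> Blaschke factors,
  the basis satisfies \<open>z e\<^sub>j = \<lambda>\<^sub>j e\<^sub>j + s\<^sub>j B\<^sub>j\<close> and \<open>B\<^sub>j\<^sub>-\<^sub>1 = s\<^sub>j e\<^sub>j - cnj \<lambda>\<^sub>j B\<^sub>j\<close>, where
  \<open>s\<^sub>j\<^sup>2 = 1 - \<bar>\<lambda>\<^sub>j\<bar>\<^sup>2\<close>, and the last product projects to zero. Solving these two relations downwards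
  gives \<open>(\<zeta> - M)\<^sup>-\<^sup>1\<close> of the projected \<open>B\<^sub>j\<close> (\<open>model_shifted_tail_resolvent\<close>) and then the columns of the
  resolvent. That the \<open>e\<^sub>j\<close> span \<open>K\<close> follows by dividing a function orthogonal to all of them by one
  Blaschke factor after another (\<open>model_space_orthogonal_zero\<close>).

  The analytic input. The inner product is an integral of radial limits, and it must be shown to be
  the inner product of the Taylor coefficients (\<open>hardy_inner_hfun\<close>). This needs Fatou's theorem for
  square-summable power series. It is derived from the maximal inequality: the operator
  \<open>a \<mapsto> \<Sum>\<^sub>k a\<^sub>k (r(t) e\<^sup>i\<^sup>t)\<^sup>k\<close> is bounded from \<open>\<ell>\<^sup>2\<close> to \<open>L\<^sup>2\<close> of the circle, uniformly in the measurable
  choice of radii \<open>r(t) < 1\<close> (\<open>radial_maximal\<close>). If \<open>S\<close> is this operator, the kernel of \<open>S S\<^sup>*\<close> has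
  real part at most a constant times the sum of the real parts of the kernels belonging to \<open>r(s)\<close>
  and \<open>r(t)\<close> alone, and those are again expressed by \<open>S\<close>. This yields
  \<open>\<parallel>S\<parallel>\<^sup>2 \<le> C \<parallel>S\<parallel>\<close>, hence \<open>\<parallel>S\<parallel> \<le> C\<close>. Once all radii are controlled, the limits exist almost
  everywhere by approximation with polynomials, and dominated convergence gives the pairing.
\<close>

section \<open>Power series on the circle\<close>

text \<open>Normalised arc length, parametrised by the angle; a probability measure on all of \<open>\<real>\<close>, so
  that no domain restrictions arise in measurability goals.\<close>

definition circ :: "real measure" where
  "circ = uniform_measure lborel {0..2 * pi}"

lemma sets_circ [simp, measurable_cong]: "sets circ = sets borel"
  and space_circ [simp]: "space circ = UNIV"
  by (simp_all add: circ_def)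

lemma prob_space_circ: "prob_space circ"
  unfolding circ_def by (rule prob_space_uniform_measure) auto

interpretation circ: prob_space circ by (rule prob_space_circ)

interpretation circ2: pair_sigma_finite circ circ ..

lemma circ_integral:
  fixes f :: "real \<Rightarrow> complex"
  assumes [measurable]: "f \<in> borel_measurable borel"
  shows "(\<integral>t. f t \<partial>circ) = (LINT t:{0..2*pi}|lborel. f t) / (2 * of_real pi)"
proof -
  have c: "circ = density lborel (\<lambda>t. ennreal (indicator {0..2*pi} t / (2*pi)))"
    unfolding circ_def uniform_measure_def
    by (rule density_cong) (auto simp: divide_ennreal indicator_def ennreal_1[symmetric] simp del: ennreal_1)
  have "(\<integral>t. f t \<partial>circ) = (\<integral>t. (indicator {0..2*pi} t / (2*pi)) *\<^sub>R f t \<partial>lborel)"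
    unfolding c by (rule integral_density) auto
  also have "\<dots> = (\<integral>t. (1 / (2*pi)) *\<^sub>R (indicator {0..2*pi} t *\<^sub>R f t) \<partial>lborel)"
    by (intro Bochner_Integration.integral_cong) (auto simp: indicator_def)
  also have "\<dots> = (1 / (2*pi)) *\<^sub>R (LINT t:{0..2*pi}|lborel. f t)"
    unfolding set_lebesgue_integral_def by (rule integral_scaleR_right) 
  finally show ?thesis by (simp add: scaleR_conv_of_real field_simps)
qed

lemma cis_measurable [measurable]: "cis \<in> borel_measurable borel"
  by (intro borel_measurable_continuous_onI continuous_intros)

lemma cnj_measurable [measurable]: "cnj \<in> borel_measurable borel"
  by (intro borel_measurable_continuous_onI continuous_intros)

lemma circ_orthonormal: "(\<integral>t. cis (real j * t) * cnj (cis (real k * t)) \<partial>circ) = (if j = k then 1 else 0)"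
proof (cases "j = k")
  case True
  have "cis x * cnj (cis x) = 1" for x
    by (simp add: complex_mult_cnj cis.ctr flip: complex_norm_square)
  then show ?thesis using True circ.prob_space by (simp add: )
next
  case False
  define c where "c = real j - real k"
  have c: "c \<noteq> 0" using False by (simp add: c_def)
  have e: "cis (real j * t) * cnj (cis (real k * t)) = cis (c * t)" for t
    by (simp add: cis_cnj cis_mult c_def algebra_simps)
  have "((\<lambda>t. cis (c * t)) has_integral (cis (c * (2*pi)) / (\<i> * c) - cis (c * 0) / (\<i> * c))) {0..2*pi}"
    by (rule fundamental_theorem_of_calculus)
       (use c in \<open>auto intro!: derivative_eq_intros simp: cis_conv_exp has_vector_derivative_def[symmetric] has_real_derivative_iff_has_vector_derivative[symmetric] field_simps simp: exp_of_real[symmetric] intro: has_vector_derivative_real_field\<close>)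
  moreover have "cis (c * (2*pi)) = 1"
  proof -
    have "cis (2 * pi * of_int (int j - int k)) = 1" by (rule cis_multiple_2pi) simp
    then show ?thesis by (simp add: c_def mult.commute)
  qed
  ultimately have "((\<lambda>t. cis (c * t)) has_integral 0) {0..2*pi}" by simp
  moreover have "set_integrable lborel {0..2*pi} (\<lambda>t. cis (c * t))"
    by (rule borel_integrable_atLeastAtMost') (auto intro!: continuous_intros)
  ultimately have "(LINT t:{0..2*pi}|lborel. cis (c * t)) = 0"
    by (simp add: set_borel_integral_eq_integral integral_unique)
  then show ?thesis using False by (simp only: e) (subst circ_integral, auto)
qed


lemma summable_norm_bounded_power:
  fixes a :: "nat \<Rightarrow> complex"
  assumes a: "\<And>k. cmod (a k) \<le> M" and z: "cmod z < 1"
  shows "summable (\<lambda>k. cmod (a k * z ^ k))" and "summable (\<lambda>k. a k * z ^ k)"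
proof -
  show *: "summable (\<lambda>k. cmod (a k * z ^ k))"
  proof (rule summable_comparison_test')
    show "summable (\<lambda>k. M * cmod z ^ k)" using z by (intro summable_mult summable_geometric) auto
    show "norm (cmod (a k * z ^ k)) \<le> M * cmod z ^ k" for k
      using a by (auto simp: norm_mult norm_power intro!: mult_right_mono)
  qed
  show "summable (\<lambda>k. a k * z ^ k)" by (rule summable_norm_cancel[OF *])
qed

lemma circ_integrable_bounded:
  fixes f :: "real \<Rightarrow> 'a::{banach, second_countable_topology}"
  assumes "f \<in> borel_measurable borel" "\<And>t. norm (f t) \<le> M"
  shows "integrable circ f"
  using assms by (intro circ.integrable_const_bound[where B = M]) auto

text \<open>Termwise integration of a power series along a curve \<open>w\<close> that stays away from the unit
  circle. The weight \<open>h\<close> and the curve are arbitrary because the maximal inequality uses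
  circles of varying radius.\<close>

lemma circ_power_series:
  fixes a :: "nat \<Rightarrow> complex"
  assumes a: "\<And>k. cmod (a k) \<le> M" and w: "\<And>t. cmod (w t) \<le> R" and R: "R < 1"
    and h: "\<And>t. cmod (h t) \<le> H"
    and [measurable]: "w \<in> borel_measurable borel" "h \<in> borel_measurable borel"
  shows "(\<lambda>k. a k * (\<integral>t. h t * w t ^ k \<partial>circ)) sums (\<integral>t. h t * (\<Sum>k. a k * w t ^ k) \<partial>circ)"
proof -
  have R0: "0 \<le> R" using w[of 0] norm_ge_zero[of "w 0"] by linarith
  have M0: "0 \<le> M" using a[of 0] norm_ge_zero[of "a 0"] by linarith
  have H0: "0 \<le> H" using h[of 0] norm_ge_zero[of "h 0"] by linarith
  have w1: "cmod (w t) < 1" for t using w[of t] R by linarith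
  have bd: "cmod (a k * h t * w t ^ k) \<le> M * H * R ^ k" for k t
    unfolding norm_mult norm_power by (intro mult_mono power_mono a h w mult_nonneg_nonneg M0 H0) auto
  have hw: "integrable circ (\<lambda>t. a k * h t * w t ^ k)" for k
    by (rule circ_integrable_bounded[OF _ bd]) measurable
  have "(\<lambda>k. \<integral>t. a k * h t * w t ^ k \<partial>circ) sums (\<integral>t. (\<Sum>k. a k * h t * w t ^ k) \<partial>circ)"
  proof (rule sums_integral)
    show "AE t in circ. summable (\<lambda>k. cmod (a k * h t * w t ^ k))"
      proof (rule AE_I2)
      fix t
      show "summable (\<lambda>k. cmod (a k * h t * w t ^ k))"
      proof -
        have "summable (\<lambda>k. cmod (a k * w t ^ k))" by (rule summable_norm_bounded_power(1)[OF a w1])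
        from summable_mult[OF this, of "cmod (h t)"] show ?thesis by (simp only: norm_mult mult_ac)
      qed
    qed
    show "summable (\<lambda>k. \<integral>t. cmod (a k * h t * w t ^ k) \<partial>circ)"
    proof (rule summable_comparison_test')
      show "summable (\<lambda>k. M * H * R ^ k)" using R R0 by (intro summable_mult summable_geometric) auto
      show "norm (\<integral>t. cmod (a k * h t * w t ^ k) \<partial>circ) \<le> M * H * R ^ k" for k
      proof -
        have "(\<integral>t. cmod (a k * h t * w t ^ k) \<partial>circ) \<le> (\<integral>t. M * H * R ^ k \<partial>circ)"
          using bd hw by (intro integral_mono) auto
        then show ?thesis using circ.prob_space by simp
      qed
    qed
  qed (rule hw)
  moreover have "(\<integral>t. a k * h t * w t ^ k \<partial>circ) = a k * (\<integral>t. h t * w t ^ k \<partial>circ)" for k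
    by (simp add: mult.assoc)
  moreover have "(\<Sum>k. a k * h t * w t ^ k) = h t * (\<Sum>k. a k * w t ^ k)" for t
    proof -
    have "summable (\<lambda>k. a k * w t ^ k)" by (rule summable_norm_bounded_power(2)[OF a w1])
    from suminf_mult[OF this, of "h t"] show ?thesis by (simp add: mult_ac)
  qed
  ultimately show ?thesis by simp
qed

lemma power_series_measurable [measurable]:
  fixes a :: "nat \<Rightarrow> complex"
  assumes [measurable]: "w \<in> borel_measurable M"
  shows "(\<lambda>t. \<Sum>k. a k * w t ^ k) \<in> borel_measurable M"
  by measurable

lemma power_series_bound:
  fixes a :: "nat \<Rightarrow> complex"
  assumes a: "\<And>k. cmod (a k) \<le> M" and z: "cmod z \<le> R" and R: "R < 1"
  shows "cmod (\<Sum>k. a k * z ^ k) \<le> M / (1 - R)"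
proof -
  have R0: "0 \<le> R" using z norm_ge_zero[of z] by linarith
  have M0: "0 \<le> M" using a[of 0] norm_ge_zero[of "a 0"] by linarith
  have s: "summable (\<lambda>k. cmod (a k * z ^ k))"
    by (rule summable_norm_bounded_power(1)[OF a]) (use z R in auto)
  have "cmod (\<Sum>k. a k * z ^ k) \<le> (\<Sum>k. cmod (a k * z ^ k))"
    by (rule summable_norm[OF s])
  also have "\<dots> \<le> (\<Sum>k. M * R ^ k)"
    using R R0 by (intro suminf_le s summable_mult summable_geometric)
      (auto simp: norm_mult norm_power intro!: mult_mono power_mono a z M0)
  also have "\<dots> = M / (1 - R)"
    using R R0 by (subst suminf_mult) (auto simp: suminf_geometric summable_geometric)
  finally show ?thesis .
qed

lemma circ_fourier_coeff:
  fixes b :: "nat \<Rightarrow> complex"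
  assumes b: "\<And>k. cmod (b k) \<le> M" and r: "0 \<le> r" "r < 1"
  shows "(\<integral>t. (\<Sum>j. b j * (of_real r * cis t) ^ j) * cnj (cis (real k * t)) \<partial>circ) = b k * of_real r ^ k"
proof -
  have "(\<lambda>j. b j * (\<integral>t. cnj (cis (real k * t)) * (of_real r * cis t) ^ j \<partial>circ)) sums
     (\<integral>t. cnj (cis (real k * t)) * (\<Sum>j. b j * (of_real r * cis t) ^ j) \<partial>circ)"
    by (rule circ_power_series[where R = r and H = 1 and M = M])
       (use b r in \<open>auto simp: norm_mult\<close>)
  moreover have "(\<integral>t. cnj (cis (real k * t)) * (of_real r * cis t) ^ j \<partial>circ) = (if j = k then of_real r ^ k else 0)" for j
  proof -
    have "(\<integral>t. cnj (cis (real k * t)) * (of_real r * cis t) ^ j \<partial>circ)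
        = (\<integral>t. of_real r ^ j * (cis (real j * t) * cnj (cis (real k * t))) \<partial>circ)"
      by (intro Bochner_Integration.integral_cong) (auto simp: power_mult_distrib Complex.DeMoivre mult_ac)
    also have "\<dots> = of_real r ^ j * (if j = k then 1 else 0)"
      by (simp only: integral_mult_right_zero circ_orthonormal)
    finally show ?thesis by simp
  qed
  ultimately have "(\<lambda>j. if j = k then b k * of_real r ^ k else 0) sums
     (\<integral>t. cnj (cis (real k * t)) * (\<Sum>j. b j * (of_real r * cis t) ^ j) \<partial>circ)"
    by (simp add: if_distrib[where f = "\<lambda>x. _ * x"] cong: if_cong)
  from sums_unique2[OF this sums_single[of k "\<lambda>j. b k * of_real r ^ k"]] show ?thesis
    by (simp add: mult.commute)
qed

lemma circ_parseval:
  fixes a b :: "nat \<Rightarrow> complex"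
  assumes a: "\<And>k. cmod (a k) \<le> M" and b: "\<And>k. cmod (b k) \<le> M" and r: "0 \<le> r" "r < 1"
  shows "(\<lambda>k. a k * cnj (b k) * of_real (r ^ (2*k))) sums
     (\<integral>t. (\<Sum>k. a k * (of_real r * cis t) ^ k) * cnj (\<Sum>k. b k * (of_real r * cis t) ^ k) \<partial>circ)"
proof -
  define g where "g t = (\<Sum>k. b k * (of_real r * cis t) ^ k)" for t
  have [measurable]: "g \<in> borel_measurable borel" unfolding g_def by measurable
  have gb: "cmod (g t) \<le> M / (1 - r)" for t
    unfolding g_def by (rule power_series_bound) (use b r in \<open>auto simp: norm_mult\<close>)
  have "(\<lambda>k. a k * (\<integral>t. cnj (g t) * (of_real r * cis t) ^ k \<partial>circ)) sums
     (\<integral>t. cnj (g t) * (\<Sum>k. a k * (of_real r * cis t) ^ k) \<partial>circ)"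
    by (rule circ_power_series[where R = r and H = "M / (1 - r)" and M = M])
       (use a r gb in \<open>auto simp: norm_mult\<close>)
  moreover have "(\<integral>t. cnj (g t) * (of_real r * cis t) ^ k \<partial>circ) = cnj (b k) * of_real (r ^ (2 * k))" for k
  proof -
    have "(\<integral>t. cnj (g t) * (of_real r * cis t) ^ k \<partial>circ)
       = (\<integral>t. of_real r ^ k * cnj (g t * cnj (cis (real k * t))) \<partial>circ)"
      by (intro Bochner_Integration.integral_cong) (auto simp: power_mult_distrib Complex.DeMoivre mult_ac)
    also have "\<dots> = of_real r ^ k * cnj (\<integral>t. g t * cnj (cis (real k * t)) \<partial>circ)"
      by (simp only: integral_mult_right_zero Bochner_Integration.integral_cnj)
    also have "\<dots> = cnj (b k) * of_real (r ^ (2 * k))"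
      unfolding g_def circ_fourier_coeff[OF b r] by (simp add: mult_2_right power_add mult_ac)
    finally show ?thesis .
  qed
  ultimately show ?thesis by (simp add: g_def mult_ac)
qed

lemma Re_mult_cnj_self: "Re (x * cnj x) = (cmod x)\<^sup>2"
  unfolding cmod_power2 by (simp add: power2_eq_square)

lemma cmod_diff_square: "(cmod (x - y))\<^sup>2 = (cmod x)\<^sup>2 + (cmod y)\<^sup>2 - 2 * Re (x * cnj y)"
  unfolding cmod_power2 by (simp add: power2_eq_square algebra_simps)

lemma Re_mult_cnj_le: "2 * Re (x * cnj y) \<le> (cmod x)\<^sup>2 + (cmod y)\<^sup>2"
  using cmod_diff_square[of x y] zero_le_power2[of "cmod (x - y)"] by linarith

text \<open>The partial Fourier sum \<open>p\<close> has \<open>\<integral>\<bar>p\<bar>\<^sup>2 = \<Sum>\<bar>c\<^sub>k\<bar>\<^sup>2\<close>, which is also \<open>\<integral> h cnj p\<close>; the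
  arithmetic-geometric mean inequality for \<open>h cnj p\<close> leaves the claim.\<close>

lemma circ_bessel:
  fixes h :: "real \<Rightarrow> complex"
  assumes [measurable]: "h \<in> borel_measurable borel" and h: "\<And>t. cmod (h t) \<le> H"
  defines "c \<equiv> \<lambda>k::nat. \<integral>t. h t * cnj (cis (real k * t)) \<partial>circ"
  shows "summable (\<lambda>k. (cmod (c k))\<^sup>2)" and "(\<Sum>k. (cmod (c k))\<^sup>2) \<le> (\<integral>t. (cmod (h t))\<^sup>2 \<partial>circ)"
proof -
  have fin: "(\<Sum>k<n. (cmod (c k))\<^sup>2) \<le> (\<integral>t. (cmod (h t))\<^sup>2 \<partial>circ)" for n
  proof -
    define p where "p t = (\<Sum>k<n. c k * cis (real k * t))" for t
    have [measurable]: "p \<in> borel_measurable borel" unfolding p_def by measurable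
    have pb: "cmod (p t) \<le> (\<Sum>k<n. cmod (c k))" for t
      unfolding p_def by (rule order_trans[OF norm_sum]) (simp add: norm_mult)
    define P where "P = (\<Sum>k<n. cmod (c k))"
    have ip: "integrable circ (\<lambda>t. g t * cnj (p t))" if "g \<in> borel_measurable borel" "\<And>t. cmod (g t) \<le> G" for g G
      by (rule circ_integrable_bounded[where M = "G * P"])
         (use that pb order_trans[OF norm_ge_zero that(2)] in \<open>auto simp: norm_mult P_def intro!: mult_mono\<close>)
    have I: "(\<integral>t. g t * cnj (p t) \<partial>circ) = (\<Sum>k<n. cnj (c k) * (\<integral>t. g t * cnj (cis (real k * t)) \<partial>circ))"
      if g: "g \<in> borel_measurable borel" "\<And>t. cmod (g t) \<le> G" for g G
    proof -
      note [measurable] = g(1)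
      have "(\<integral>t. g t * cnj (p t) \<partial>circ) = (\<integral>t. (\<Sum>k<n. cnj (c k) * (g t * cnj (cis (real k * t)))) \<partial>circ)"
        by (simp add: p_def sum_distrib_left mult_ac)
      also have "\<dots> = (\<Sum>k<n. (\<integral>t. cnj (c k) * (g t * cnj (cis (real k * t))) \<partial>circ))"
        by (rule Bochner_Integration.integral_sum, rule circ_integrable_bounded[where M = "cmod (c k) * G" for k])
           (use g(2) in \<open>auto simp: norm_mult intro!: mult_left_mono\<close>)
      finally show ?thesis by simp
    qed
    have pc: "(\<integral>t. p t * cnj (cis (real k * t)) \<partial>circ) = c k" if "k < n" for k
    proof -
      have "(\<integral>t. p t * cnj (cis (real k * t)) \<partial>circ) =
        (\<integral>t. (\<Sum>j<n. c j * (cis (real j * t) * cnj (cis (real k * t)))) \<partial>circ)"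
        by (simp add: p_def sum_distrib_left sum_distrib_right mult_ac)
      also have "\<dots> = (\<Sum>j<n. \<integral>t. c j * (cis (real j * t) * cnj (cis (real k * t))) \<partial>circ)"
        by (rule Bochner_Integration.integral_sum, rule circ_integrable_bounded[where M = "cmod (c j)" for j])
           (auto simp: norm_mult)
      also have "\<dots> = (\<Sum>j<n. c j * (if j = k then 1 else 0))"
        by (simp only: integral_mult_right_zero circ_orthonormal)
      also have "\<dots> = c k" using that by (simp add: if_distrib cong: if_cong)
      finally show ?thesis .
    qed
    have cc: "cnj (c k) * c k = of_real ((cmod (c k))\<^sup>2)" for k
      by (simp only: complex_norm_square mult.commute)
    have hp: "(\<integral>t. h t * cnj (p t) \<partial>circ) = of_real (\<Sum>k<n. (cmod (c k))\<^sup>2)"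
    proof -
      have "(\<integral>t. h t * cnj (cis (real k * t)) \<partial>circ) = c k" for k by (simp only: c_def)
      then show ?thesis unfolding I[OF assms(1) h] by (simp add: cc)
    qed
    have pp: "(\<integral>t. p t * cnj (p t) \<partial>circ) = of_real (\<Sum>k<n. (cmod (c k))\<^sup>2)"
      unfolding I[OF \<open>p \<in> _\<close> pb] by (simp add: cc pc)
    have "(\<integral>t. Re (h t * cnj (p t)) \<partial>circ) = Re (\<integral>t. h t * cnj (p t) \<partial>circ)"
      by (rule integral_Re[OF ip[OF assms(1) h]])
    moreover have "(\<integral>t. Re (p t * cnj (p t)) \<partial>circ) = Re (\<integral>t. p t * cnj (p t) \<partial>circ)"
      by (rule integral_Re[OF ip[OF \<open>p \<in> _\<close> pb]])
    ultimately have e: "(\<integral>t. Re (h t * cnj (p t)) \<partial>circ) = (\<Sum>k<n. (cmod (c k))\<^sup>2)"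
      "(\<integral>t. (cmod (p t))\<^sup>2 \<partial>circ) = (\<Sum>k<n. (cmod (c k))\<^sup>2)"
      unfolding hp pp Re_complex_of_real Re_mult_cnj_self by auto
    have i1: "integrable circ (\<lambda>t. (cmod (h t))\<^sup>2)"
      by (rule circ_integrable_bounded[where M = "H\<^sup>2"]) (use h in \<open>auto intro!: power_mono\<close>)
    have i2: "integrable circ (\<lambda>t. (cmod (p t))\<^sup>2)"
      by (rule circ_integrable_bounded[where M = "P\<^sup>2"]) (use pb in \<open>auto simp: P_def intro!: power_mono\<close>)
    have "(\<integral>t. 2 * Re (h t * cnj (p t)) \<partial>circ) \<le> (\<integral>t. (cmod (h t))\<^sup>2 + (cmod (p t))\<^sup>2 \<partial>circ)"
      by (rule integral_mono[OF integrable_mult_right[OF integrable_Re[OF ip[OF assms(1) h]]] _ Re_mult_cnj_le])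
         (use i1 i2 in simp)
    then show ?thesis
      unfolding integral_mult_right_zero e(1) Bochner_Integration.integral_add[OF i1 i2] e(2) by simp
  qed
  show s: "summable (\<lambda>k. (cmod (c k))\<^sup>2)"
    by (rule bounded_imp_summable[OF _ fin[of "Suc _", unfolded lessThan_Suc_atMost]]) auto
  show "(\<Sum>k. (cmod (c k))\<^sup>2) \<le> (\<integral>t. (cmod (h t))\<^sup>2 \<partial>circ)"
    by (rule suminf_le_const[OF s fin])
qed

section \<open>The radial maximal inequality\<close>

lemma Re_inverse_one_minus: "Re (1 / (1 - z)) = (1 - Re z) / (cmod (1 - z))\<^sup>2"
  by (simp add: Re_divide cmod_power2)

lemma Re_inverse_one_minus_nonneg: "cmod z \<le> 1 \<Longrightarrow> 0 \<le> Re (1 / (1 - z))"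
  unfolding Re_inverse_one_minus using complex_Re_le_cmod[of z] by simp

lemma Re_inverse_one_minus_bound: "cmod z \<le> R \<Longrightarrow> R < 1 \<Longrightarrow> cmod (1 / (1 - z)) \<le> 1 / (1 - R)"
  using norm_triangle_ineq2[of 1 z] by (auto simp: norm_divide intro!: divide_left_mono mult_pos_pos)

text \<open>Moving from radius \<open>r r'\<close> out to \<open>r \<le> r'\<close> at most doubles the distance to \<open>1\<close>, since \<open>r - r
  r' \<le> 1 - r r'\<close>; and \<open>1 - r r' c \<le> 2 (1 - r c)\<close> because \<open>r (2 - r') \<le> r (2 - r) \<le> 1\<close>. The
  factors \<open>4\<close> and \<open>2\<close> make up the constant \<open>8\<close>.\<close>

lemma cauchy_kernel_le_smaller_radius:
  assumes u: "cmod u = 1" and r: "0 \<le> r" "r \<le> r'" "r' < 1"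
  shows "Re (1 / (1 - of_real (r * r') * u)) \<le> 8 * Re (1 / (1 - of_real r * u))"
proof -
  define c where "c = Re u"
  have c: "c \<le> 1" using complex_Re_le_cmod[of u] u by (simp add: c_def)
  define d where "d = cmod (1 - of_real (r * r') * u)"
  define e where "e = cmod (1 - of_real r * u)"
  have rr: "r * r' \<le> r" "0 \<le> r * r'" using r by (auto simp: mult_left_le)
  have n1: "cmod (of_real (r * r') * u) = r * r'" "cmod (of_real r * u) = r"
    using u r rr by (auto simp: norm_mult)
  have d1: "1 - r * r' \<le> d" using norm_triangle_ineq2[of 1 "of_real (r * r') * u"] n1 by (simp add: d_def)
  have d0: "0 < d" using d1 rr r by linarith
  have "1 - r \<le> e" using norm_triangle_ineq2[of 1 "of_real r * u"] n1 by (simp add: e_def)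
  then have e0: "0 < e" using r by linarith
  have "1 - of_real r * u = (1 - of_real (r * r') * u) - of_real (r - r * r') * u"
    by (simp add: algebra_simps)
  then have "e \<le> d + cmod (of_real (r - r * r') * u)"
    unfolding e_def d_def by (metis norm_triangle_ineq4)
  also have "cmod (of_real (r - r * r') * u) = r - r * r'" unfolding norm_mult u norm_of_real using rr by simp
  finally have e2: "e \<le> 2 * d" using d1 r by linarith
  have "r * (2 - r') * c \<le> r * (2 - r') * 1" using c r by (intro mult_left_mono) auto
  also have "\<dots> \<le> r * (2 - r)" using r by (simp add: mult_left_mono)
  also have "\<dots> \<le> 1" using zero_le_power2[of "1 - r"] by (simp add: power2_eq_square algebra_simps)
  finally have n2: "1 - r * r' * c \<le> 2 * (1 - r * c)" by (simp add: algebra_simps)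
  have p: "0 \<le> 1 - r * c" using c r mult_mono[of r 1 c 1] mult_nonneg_nonpos[of r c] by (cases "c \<ge> 0") auto
  have "(1 - r * r' * c) / d\<^sup>2 \<le> (2 * (1 - r * c)) / d\<^sup>2" using n2 by (intro divide_right_mono) auto
  also have "\<dots> \<le> (2 * (1 - r * c)) / (e / 2)\<^sup>2"
    using p e2 e0 d0 by (intro divide_left_mono power_mono mult_pos_pos) auto
  also have "\<dots> = 8 * ((1 - r * c) / e\<^sup>2)" by (simp add: power2_eq_square)
  finally show ?thesis unfolding Re_inverse_one_minus by (simp add: c_def d_def e_def)
qed

lemma cauchy_kernel_le:
  assumes u: "cmod u = 1" and r: "0 \<le> r" "r < 1" "0 \<le> r'" "r' < 1"
  shows "Re (1 / (1 - of_real (r * r') * u)) \<le> 8 * (Re (1 / (1 - of_real r * u)) + Re (1 / (1 - of_real r' * u)))"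
proof -
  have n: "0 \<le> Re (1 / (1 - of_real r * u))" "0 \<le> Re (1 / (1 - of_real r' * u))"
    using u r by (auto intro!: Re_inverse_one_minus_nonneg simp: norm_mult)
  show ?thesis
  proof (cases "r \<le> r'")
    case True then show ?thesis using cauchy_kernel_le_smaller_radius[OF u, of r r'] r n by (smt (verit))
  next
    case False
    then show ?thesis using cauchy_kernel_le_smaller_radius[OF u, of r' r] r n by (smt (verit) mult.commute)
  qed
qed

definition ell2 :: "(nat \<Rightarrow> complex) set" where
  "ell2 = {a. summable (\<lambda>k. (cmod (a k))\<^sup>2)}"

definition ell2_sq :: "(nat \<Rightarrow> complex) \<Rightarrow> real" where
  "ell2_sq a = (\<Sum>k. (cmod (a k))\<^sup>2)"

lemma ell2_sq_nonneg: "a \<in> ell2 \<Longrightarrow> 0 \<le> ell2_sq a"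
  unfolding ell2_sq_def ell2_def by (auto intro: suminf_nonneg)

lemma ell2_bound:
  assumes "a \<in> ell2"
  shows "cmod (a k) \<le> sqrt (ell2_sq a)"
proof -
  have "(\<Sum>k\<in>{k}. (cmod (a k))\<^sup>2) \<le> ell2_sq a"
    unfolding ell2_sq_def using assms by (intro sum_le_suminf) (auto simp: ell2_def)
  then show ?thesis by (intro real_le_rsqrt) simp
qed

text \<open>The weight \<open>e\<close> replaces the Cauchy-Schwarz inequality wherever the optimal choice is known
  in advance.\<close>

lemma weighted_am_gm: "x * y \<le> (e * x\<^sup>2 + y\<^sup>2 / e) / 2" if "0 < e" for x y e :: real
proof -
  have "0 \<le> (e * x - y)\<^sup>2 / e" using that by simp
  also have "(e * x - y)\<^sup>2 / e = e * x\<^sup>2 - 2 * (x * y) + y\<^sup>2 / e" using that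
    by (simp add: power2_eq_square field_simps)
  finally show ?thesis by simp
qed

lemma ell2_pairing:
  assumes a: "a \<in> ell2" and b: "b \<in> ell2"
  shows "summable (\<lambda>k. cmod (a k * cnj (b k)))"
    and "summable (\<lambda>k. a k * cnj (b k))"
    and "0 < e \<Longrightarrow> cmod (\<Sum>k. a k * cnj (b k)) \<le> (e * ell2_sq a + ell2_sq b / e) / 2"
proof -
  have le: "cmod (a k * cnj (b k)) \<le> (e * (cmod (a k))\<^sup>2 + (cmod (b k))\<^sup>2 / e) / 2" if "0 < e" for k e
    using weighted_am_gm[OF that] by (simp add: norm_mult)
  have s: "summable (\<lambda>k. (e * (cmod (a k))\<^sup>2 + (cmod (b k))\<^sup>2 / e) / 2)" for e
    using a b unfolding ell2_def by (intro summable_divide summable_add summable_mult) auto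
  show n: "summable (\<lambda>k. cmod (a k * cnj (b k)))"
    by (rule summable_comparison_test'[OF s[of 1]]) (use le[of 1] in auto)
  show "summable (\<lambda>k. a k * cnj (b k))" by (rule summable_norm_cancel[OF n])
  assume e: "0 < e"
  have "cmod (\<Sum>k. a k * cnj (b k)) \<le> (\<Sum>k. cmod (a k * cnj (b k)))" by (rule summable_norm[OF n])
  also have "\<dots> \<le> (\<Sum>k. (e * (cmod (a k))\<^sup>2 + (cmod (b k))\<^sup>2 / e) / 2)"
    by (rule suminf_le[OF le[OF e] n s])
  also have "\<dots> = (e * ell2_sq a + ell2_sq b / e) / 2"
  proof (rule sums_unique[symmetric])
    show "(\<lambda>k. (e * (cmod (a k))\<^sup>2 + (cmod (b k))\<^sup>2 / e) / 2) sums ((e * ell2_sq a + ell2_sq b / e) / 2)"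
      using a b unfolding ell2_def ell2_sq_def
      by (intro sums_divide sums_add sums_mult) (auto intro: summable_sums)
  qed
  finally show "cmod (\<Sum>k. a k * cnj (b k)) \<le> (e * ell2_sq a + ell2_sq b / e) / 2" .
qed

lemma norm_mult_le_mult:
  fixes x y :: "'a::real_normed_algebra"
  shows "norm x \<le> a \<Longrightarrow> norm y \<le> b \<Longrightarrow> norm (x * y) \<le> a * b"
  by (rule order_trans[OF norm_mult_ineq], rule mult_mono') auto

text \<open>A measurable choice \<open>r t\<close> of a radius on each ray. The bound \<open>R < 1\<close> makes all series
  converge uniformly; the final constant is independent of it.\<close>

locale radial_selection =
  fixes r :: "real \<Rightarrow> real" and R :: real
  assumes r_measurable [measurable]: "r \<in> borel_measurable borel"
    and r_nonneg: "\<And>t. 0 \<le> r t" and r_le: "\<And>t. r t \<le> R" and R: "R < 1"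
begin

definition w :: "real \<Rightarrow> complex" where "w t = of_real (r t) * cis t"

lemma w_measurable [measurable]: "w \<in> borel_measurable borel"
  unfolding w_def by measurable

lemma norm_w: "cmod (w t) = r t" using r_nonneg by (simp add: w_def norm_mult)

lemma R_nonneg: "0 \<le> R" using r_nonneg[of 0] r_le[of 0] by linarith

text \<open>The numbers \<open>K\<close> that bound the square of the norm of \<open>S : a \<mapsto> \<Sum>\<^sub>k a\<^sub>k w\<^sup>k\<close>.\<close>

definition bounds :: "real \<Rightarrow> bool" where
  "bounds K \<longleftrightarrow> (\<forall>a\<in>ell2. (\<integral>t. (cmod (\<Sum>k. a k * w t ^ k))\<^sup>2 \<partial>circ) \<le> K * ell2_sq a)"

lemma kernel_integral:
  assumes [measurable]: "h \<in> borel_measurable borel" "v \<in> borel_measurable borel"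
    and h: "\<And>t. cmod (h t) \<le> H" and v: "\<And>t. cmod (v t) \<le> 1"
  shows "(\<integral>t. h t * (1 / (1 - w s * cnj (v t))) \<partial>circ) = (\<Sum>k. (\<integral>t. h t * cnj (v t) ^ k \<partial>circ) * w s ^ k)"
proof -
  have le: "cmod (w s * cnj (v t)) \<le> R" for t
    using mult_mono[OF r_le[of s] v[of t]] R_nonneg by (simp add: norm_mult norm_w)
  have "(\<lambda>k. 1 * (\<integral>t. h t * (w s * cnj (v t)) ^ k \<partial>circ)) sums (\<integral>t. h t * (\<Sum>k. 1 * (w s * cnj (v t)) ^ k) \<partial>circ)"
    by (rule circ_power_series[OF _ le R h, where M = 1]) auto
  moreover have "(\<Sum>k. 1 * (w s * cnj (v t)) ^ k) = 1 / (1 - w s * cnj (v t))" for t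
    using le[of t] R by (simp add: suminf_geometric)
  moreover have "1 * (\<integral>t. h t * (w s * cnj (v t)) ^ k \<partial>circ) = (\<integral>t. h t * cnj (v t) ^ k \<partial>circ) * w s ^ k" for k
    by (simp add: power_mult_distrib mult_ac flip: integral_mult_right_zero)
  ultimately show ?thesis by (simp add: sums_iff)
qed

text \<open>Here \<open>b = S\<^sup>* h\<close>. Its norm is the double integral of \<open>h(s) h(t) Re (1 / (1 - w(s) cnj
  w(t)))\<close>, the imaginary part cancelling since \<open>h\<close> is real. The kernel estimate splits the
  integrand into two parts that Fubini makes equal, and each of them is \<open>8\<close> times the pairing
  of \<open>\<bar>h\<bar>\<close> with the real part of \<open>S c\<close>, where \<open>c\<close> are the Fourier coefficients of \<open>\<bar>h\<bar>\<close>.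
  Bessel's inequality and the bound \<open>K\<close> for \<open>S\<close> itself close the circle.\<close>

lemma adjoint_bound:
  fixes h :: "real \<Rightarrow> real"
  assumes K: "bounds K" "0 < K"
    and [measurable]: "h \<in> borel_measurable borel" and h: "\<And>t. \<bar>h t\<bar> \<le> H"
  defines "b \<equiv> \<lambda>k. \<integral>t. of_real (h t) * cnj (w t) ^ k \<partial>circ"
  shows "b \<in> ell2" and "ell2_sq b \<le> 16 * sqrt K * (\<integral>t. (h t)\<^sup>2 \<partial>circ)"
proof -
  define N where "N = 1 / (1 - R)"
  have H0: "0 \<le> H" using h[of 0] by linarith
  have N0: "0 \<le> N" using R by (simp add: N_def)
  define G where "G s t = Re (1 / (1 - w s * cnj (w t)))" for s t
  define P where "P s t = Re (1 / (1 - w s * cnj (cis t)))" for s t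
  have wR: "cmod (w t) \<le> R" for t using r_le norm_w by simp
  have wwR: "cmod (w s * cnj (w t)) \<le> R" for s t
    using mult_mono[OF r_le[of s] order_trans[OF r_le[of t], of 1]] R_nonneg R r_nonneg by (simp add: norm_mult norm_w)
  have wcR: "cmod (w s * cnj (cis t)) \<le> R" for s t using r_le[of s] by (simp add: norm_mult norm_w)
  have [measurable]: "(\<lambda>x. G (fst x) (snd x)) \<in> borel_measurable (borel \<Otimes>\<^sub>M borel)"
    "(\<lambda>x. P (fst x) (snd x)) \<in> borel_measurable (borel \<Otimes>\<^sub>M borel)"
    unfolding G_def P_def by measurable
  have [measurable]: "G s \<in> borel_measurable borel" "P s \<in> borel_measurable borel" for s
    unfolding G_def P_def by measurable
  have Gb: "\<bar>G s t\<bar> \<le> N" and Pb: "\<bar>P s t\<bar> \<le> N" for s t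
    unfolding G_def P_def N_def
    using order_trans[OF abs_Re_le_cmod Re_inverse_one_minus_bound[OF wwR R]]
      order_trans[OF abs_Re_le_cmod Re_inverse_one_minus_bound[OF wcR R]] by auto
  have G0: "0 \<le> G s t" and P0: "0 \<le> P s t" for s t
    unfolding G_def P_def using wwR[of s t] wcR[of s t] R by (auto intro!: Re_inverse_one_minus_nonneg)
  have GP: "G s t \<le> 8 * (P s t + P t s)" for s t
  proof -
    define u where "u = cis (s - t)"
    have e1: "w s * cnj (w t) = of_real (r s * r t) * u"
      by (simp add: w_def u_def cis_cnj mult_ac flip: cis_mult[of s "- t", simplified])
    have e2: "w s * cnj (cis t) = of_real (r s) * u"
      by (simp add: w_def u_def cis_cnj mult.assoc cis_mult)
    have e3: "w t * cnj (cis s) = cnj (of_real (r t) * u)"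
      by (simp add: w_def u_def cis_cnj mult.assoc cis_mult)
    have conj: "Re (1 / (1 - cnj z)) = Re (1 / (1 - z))" for z :: complex
    proof -
      have "cmod (1 - cnj z) = cmod (1 - z)" by (metis complex_cnj_diff complex_cnj_one complex_mod_cnj)
      then show ?thesis unfolding Re_inverse_one_minus by simp
    qed
    then show ?thesis unfolding G_def P_def e1 e2 e3 conj
      using cauchy_kernel_le[of u "r s" "r t"] r_nonneg r_le[of s] r_le[of t] R by (simp add: u_def)
  qed
  have hk: "cmod (of_real (h t) * z) \<le> H * N" and hk': "cmod (of_real \<bar>h t\<bar> * z) \<le> H * N" if "cmod z \<le> N" for t z
    using mult_mono[OF h[of t] that H0 norm_ge_zero] by (simp_all add: norm_mult)
  have bb: "cmod (b k) \<le> H * R ^ k" for k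
  proof -
    have "cmod (b k) \<le> (\<integral>t. cmod (of_real (h t) * cnj (w t) ^ k) \<partial>circ)"
      unfolding b_def by (rule integral_norm_bound)
    also have "\<dots> \<le> (\<integral>t. H * R ^ k \<partial>circ)"
    proof (rule integral_mono)
      have *: "cmod (of_real (h t) * cnj (w t) ^ k) \<le> H * R ^ k" for t
        using h wR H0 by (auto simp: norm_mult norm_power intro!: mult_mono power_mono)
      then show "cmod (of_real (h t) * cnj (w t) ^ k) \<le> H * R ^ k" for t .
      show "integrable circ (\<lambda>t. cmod (of_real (h t) * cnj (w t) ^ k))"
        by (rule circ_integrable_bounded[where M = "H * R ^ k"]) (use * in auto)
    qed auto
    also have "\<dots> = H * R ^ k" using circ.prob_space by simp
    finally show ?thesis .
  qed
  have bH: "cmod (b k) \<le> H" for k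
    using bb[of k] mult_left_mono[OF power_le_one[of R k], of H] R R_nonneg H0 by linarith
  have cb: "cnj (b k) = (\<integral>t. of_real (h t) * w t ^ k \<partial>circ)" for k
    unfolding b_def by (simp flip: Bochner_Integration.integral_cnj)
  have S: "(\<lambda>k. b k * cnj (b k)) sums (\<integral>s. of_real (h s) * (\<Sum>k. b k * w s ^ k) \<partial>circ)"
    unfolding cb by (rule circ_power_series[OF bH wR R, where H = H]) (use h in auto)
  then have S': "(\<lambda>k. (cmod (b k))\<^sup>2) sums Re (\<integral>s. of_real (h s) * (\<Sum>k. b k * w s ^ k) \<partial>circ)"
    using sums_Re[OF S] by (simp add: complex_norm_square[symmetric] flip: of_real_power)
  then show "b \<in> ell2" by (auto simp: ell2_def sums_iff)
  have rm: "Re (of_real x * z) = x * Re z" for x z by simp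
  have bs: "Re (\<Sum>k. b k * w s ^ k) = (\<integral>t. h t * G s t \<partial>circ)" for s
  proof -
    have "(\<Sum>k. b k * w s ^ k) = (\<integral>t. of_real (h t) * (1 / (1 - w s * cnj (w t))) \<partial>circ)"
      unfolding b_def by (rule kernel_integral[symmetric, where H = H])
        (use h order_trans[OF wR less_imp_le[OF R]] in auto)
    also have "Re \<dots> = (\<integral>t. Re (of_real (h t) * (1 / (1 - w s * cnj (w t)))) \<partial>circ)"
    proof (rule integral_Re[symmetric])
    show "integrable circ (\<lambda>t. of_real (h t) * (1 / (1 - w s * cnj (w t))))"
    proof (rule circ_integrable_bounded)
      show "cmod (of_real (h t) * (1 / (1 - w s * cnj (w t)))) \<le> H * N" for t
        unfolding N_def by (rule hk[unfolded N_def]) (rule Re_inverse_one_minus_bound[OF wwR R])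
    qed measurable
    qed
    also have "\<dots> = (\<integral>t. h t * G s t \<partial>circ)" unfolding G_def rm ..
    finally show ?thesis .
  qed
  have bsb: "cmod (\<Sum>k. b k * w s ^ k) \<le> H / (1 - R)" for s
    by (rule power_series_bound[OF bH wR R])
  have E: "ell2_sq b = (\<integral>s. h s * (\<integral>t. h t * G s t \<partial>circ) \<partial>circ)"
  proof -
    have "integrable circ (\<lambda>s. of_real (h s) * (\<Sum>k. b k * w s ^ k))"
    proof (rule circ_integrable_bounded)
      show "cmod (of_real (h s) * (\<Sum>k. b k * w s ^ k)) \<le> H * (H / (1 - R))" for s
        by (rule norm_mult_le_mult[OF _ bsb]) (use h in simp)
    qed measurable
    then have "Re (\<integral>s. of_real (h s) * (\<Sum>k. b k * w s ^ k) \<partial>circ) = (\<integral>s. h s * (\<integral>t. h t * G s t \<partial>circ) \<partial>circ)"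
      by (simp add: integral_Re[symmetric] bs)
    then show ?thesis using S' by (simp add: ell2_sq_def sums_iff)
  qed
  \<comment> \<open>the part of the majorant that involves the radius \<open>r s\<close> only\<close>
  define J where "J s t = \<bar>h s\<bar> * \<bar>h t\<bar> * P s t" for s t
  have Jb: "\<bar>J s t\<bar> \<le> H * H * N" for s t
    unfolding J_def abs_mult by (intro mult_mono) (use h Pb H0 N0 in auto)
  have [measurable]: "(\<lambda>x. J (fst x) (snd x)) \<in> borel_measurable (borel \<Otimes>\<^sub>M borel)"
    "J s \<in> borel_measurable borel" "(\<lambda>s. J s t) \<in> borel_measurable borel" for s t
    unfolding J_def P_def by measurable
  have Jm: "case_prod J \<in> borel_measurable (circ \<Otimes>\<^sub>M circ)"
    unfolding J_def P_def by measurable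
  have Ji: "integrable circ (J s)" "integrable circ (\<lambda>s. J s t)" for s t
    by (rule circ_integrable_bounded[where M = "H*H*N"]; use Jb in auto)+
  have Jii: "integrable (circ \<Otimes>\<^sub>M circ) (case_prod J)"
  proof -
    interpret pp: pair_prob_space circ circ ..
    show ?thesis by (rule pp.integrable_const_bound[where B = "H*H*N"]) (use Jb Jm in auto)
  qed
  have Jint: "integrable circ (\<lambda>s. \<integral>t. J s t \<partial>circ)"
    using circ2.integrable_fst'[OF Jii] by simp
  have Jint': "integrable circ (\<lambda>t. \<integral>s. J s t \<partial>circ)"
    using circ2.integrable_snd[OF Jii] by simp
  have Fub: "(\<integral>s. (\<integral>t. J t s \<partial>circ) \<partial>circ) = (\<integral>s. (\<integral>t. J s t \<partial>circ) \<partial>circ)"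
    by (rule circ2.Fubini_integral[OF Jii])
  have "ell2_sq b \<le> (\<integral>s. 8 * (\<integral>t. J s t \<partial>circ) + 8 * (\<integral>t. J t s \<partial>circ) \<partial>circ)"
    unfolding E
  proof (rule integral_mono)
    have Gi: "integrable circ (\<lambda>t. h t * G s t)" for s
    proof (rule circ_integrable_bounded)
      show "norm (h t * G s t) \<le> H * N" for t
        by (rule norm_mult_le_mult) (use h Gb in simp_all)
    qed measurable
    have Gbd: "\<bar>\<integral>t. h t * G s t \<partial>circ\<bar> \<le> H / (1 - R)" for s
      using order_trans[OF abs_Re_le_cmod bsb] bs by metis
    have bsm: "(\<lambda>s. \<integral>t. h t * G s t \<partial>circ) \<in> borel_measurable borel"
      unfolding bs[symmetric] by measurable
    show "integrable circ (\<lambda>s. h s * (\<integral>t. h t * G s t \<partial>circ))"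
    proof (rule circ_integrable_bounded)
      show "norm (h s * (\<integral>t. h t * G s t \<partial>circ)) \<le> H * (H / (1 - R))" for s
        by (rule norm_mult_le_mult) (use h Gbd in simp_all)
      show "(\<lambda>s. h s * (\<integral>t. h t * G s t \<partial>circ)) \<in> borel_measurable borel"
        using bsm by measurable
    qed
    show "integrable circ (\<lambda>s. 8 * (\<integral>t. J s t \<partial>circ) + 8 * (\<integral>t. J t s \<partial>circ))"
      using Jint Jint' by simp
    show "h s * (\<integral>t. h t * G s t \<partial>circ) \<le> 8 * (\<integral>t. J s t \<partial>circ) + 8 * (\<integral>t. J t s \<partial>circ)" for s
    proof -
      have "h s * (\<integral>t. h t * G s t \<partial>circ) = (\<integral>t. h s * (h t * G s t) \<partial>circ)" by simp
      also have "\<dots> \<le> (\<integral>t. 8 * J s t + 8 * J t s \<partial>circ)"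
      proof (rule integral_mono)
        show "integrable circ (\<lambda>t. h s * (h t * G s t))" using Gi by simp
        show "integrable circ (\<lambda>t. 8 * J s t + 8 * J t s)" using Ji by simp
        show "h s * (h t * G s t) \<le> 8 * J s t + 8 * J t s" for t
        proof -
          have "h s * (h t * G s t) \<le> \<bar>h s\<bar> * \<bar>h t\<bar> * G s t"
            using abs_ge_self[of "h s * (h t * G s t)"] G0[of s t] by (simp add: abs_mult mult.assoc)
          also have "\<dots> \<le> \<bar>h s\<bar> * \<bar>h t\<bar> * (8 * (P s t + P t s))" by (intro mult_left_mono GP) auto
          finally show ?thesis by (simp add: J_def algebra_simps)
        qed
      qed
      also have "\<dots> = 8 * (\<integral>t. J s t \<partial>circ) + 8 * (\<integral>t. J t s \<partial>circ)" using Ji by simp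
      finally show ?thesis .
    qed
  qed
  also have "\<dots> = 16 * (\<integral>s. (\<integral>t. J s t \<partial>circ) \<partial>circ)"
    using Jint Jint' Fub by simp
  finally have L: "ell2_sq b \<le> 16 * (\<integral>s. (\<integral>t. J s t \<partial>circ) \<partial>circ)" .
  \<comment> \<open>the inner integral of \<open>J\<close> is the real part of a power series at \<open>w s\<close>\<close>
  define c where "c k = (\<integral>t. of_real \<bar>h t\<bar> * cnj (cis (real k * t)) \<partial>circ)" for k
  define F where "F s = (\<Sum>k. c k * w s ^ k)" for s
  have [measurable]: "F \<in> borel_measurable borel" unfolding F_def by measurable
  have cl: "c \<in> ell2" "ell2_sq c \<le> (\<integral>t. (h t)\<^sup>2 \<partial>circ)"
    using circ_bessel[of "\<lambda>t. of_real \<bar>h t\<bar>" H] h unfolding ell2_def ell2_sq_def c_def by auto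
  have FJ: "(\<integral>t. J s t \<partial>circ) = \<bar>h s\<bar> * Re (F s)" for s
  proof -
    have "F s = (\<integral>t. of_real \<bar>h t\<bar> * (1 / (1 - w s * cnj (cis t))) \<partial>circ)"
      using kernel_integral[of "\<lambda>t. of_real \<bar>h t\<bar>" cis H s] h
      unfolding F_def c_def by (simp add: complex_cnj_power[symmetric] Complex.DeMoivre del: complex_cnj_power)
    also have "Re \<dots> = (\<integral>t. Re (of_real \<bar>h t\<bar> * (1 / (1 - w s * cnj (cis t)))) \<partial>circ)"
    proof (rule integral_Re[symmetric])
    show "integrable circ (\<lambda>t. of_real \<bar>h t\<bar> * (1 / (1 - w s * cnj (cis t))))"
    proof (rule circ_integrable_bounded)
      show "cmod (of_real \<bar>h t\<bar> * (1 / (1 - w s * cnj (cis t)))) \<le> H * N" for t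
        unfolding N_def by (rule hk'[unfolded N_def]) (rule Re_inverse_one_minus_bound[OF wcR R])
    qed measurable
    qed
    also have "\<dots> = (\<integral>t. \<bar>h t\<bar> * P s t \<partial>circ)" unfolding P_def rm ..
    finally show ?thesis by (simp add: J_def mult.assoc)
  qed
  have Fb: "cmod (F s) \<le> sqrt (ell2_sq c) / (1 - R)" for s
    unfolding F_def by (rule power_series_bound[OF ell2_bound[OF cl(1)] wR R])
  have i1: "integrable circ (\<lambda>s. (h s)\<^sup>2)"
    by (rule circ_integrable_bounded[where M = "H\<^sup>2"]) (use power_mono[OF h abs_ge_zero, where n = 2] in auto)
  have i2: "integrable circ (\<lambda>s. (cmod (F s))\<^sup>2)"
    by (rule circ_integrable_bounded[where M = "(sqrt (ell2_sq c) / (1 - R))\<^sup>2"]) (use power_mono[OF Fb norm_ge_zero, where n = 2] in auto)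
  have "(\<integral>s. (\<integral>t. J s t \<partial>circ) \<partial>circ) \<le> (\<integral>s. (sqrt K * (h s)\<^sup>2 + (cmod (F s))\<^sup>2 / sqrt K) / 2 \<partial>circ)"
  proof (rule integral_mono[OF Jint])
    show "integrable circ (\<lambda>s. (sqrt K * (h s)\<^sup>2 + (cmod (F s))\<^sup>2 / sqrt K) / 2)" using i1 i2 by simp
    show "(\<integral>t. J s t \<partial>circ) \<le> (sqrt K * (h s)\<^sup>2 + (cmod (F s))\<^sup>2 / sqrt K) / 2" for s
    proof -
      have "\<bar>h s\<bar> * Re (F s) \<le> \<bar>h s\<bar> * cmod (F s)" by (intro mult_left_mono complex_Re_le_cmod) auto
      also have "\<dots> \<le> (sqrt K * (\<bar>h s\<bar>)\<^sup>2 + (cmod (F s))\<^sup>2 / sqrt K) / 2"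
        by (rule weighted_am_gm) (use K in auto)
      finally show ?thesis by (simp add: FJ)
    qed
  qed
  also have "\<dots> = (sqrt K * (\<integral>s. (h s)\<^sup>2 \<partial>circ) + (\<integral>s. (cmod (F s))\<^sup>2 \<partial>circ) / sqrt K) / 2"
    using i1 i2 by simp
  also have "\<dots> \<le> (sqrt K * (\<integral>s. (h s)\<^sup>2 \<partial>circ) + (K * (\<integral>s. (h s)\<^sup>2 \<partial>circ)) / sqrt K) / 2"
  proof -
    have "(\<integral>s. (cmod (F s))\<^sup>2 \<partial>circ) \<le> K * ell2_sq c" using K(1) cl(1) unfolding bounds_def F_def by blast
    also have "\<dots> \<le> K * (\<integral>s. (h s)\<^sup>2 \<partial>circ)" using cl(2) K by (intro mult_left_mono) auto
    finally show ?thesis using K by (intro divide_right_mono add_left_mono) auto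
  qed
  also have "\<dots> = sqrt K * (\<integral>s. (h s)\<^sup>2 \<partial>circ)"
    using K(2) real_sqrt_mult_self[of K] by (simp add: field_simps)
  finally show "ell2_sq b \<le> 16 * sqrt K * (\<integral>t. (h t)\<^sup>2 \<partial>circ)" using L by simp
qed

text \<open>Duality: \<open>\<integral> (Re F)\<^sup>2 = Re \<langle>S a, Re F\<rangle> = Re \<langle>a, S\<^sup>* (Re F)\<rangle>\<close>, and \<open>adjoint_bound\<close> applies
  because \<open>Re F\<close> is real. The term with \<open>\<integral> (Re F)\<^sup>2\<close> on the right is absorbed.\<close>

lemma bounds_Re:
  assumes K: "bounds K" "0 < K" and a: "a \<in> ell2"
  shows "(\<integral>t. (Re (\<Sum>k. a k * w t ^ k))\<^sup>2 \<partial>circ) \<le> 16 * sqrt K * ell2_sq a"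
proof -
  define F where "F t = (\<Sum>k. a k * w t ^ k)" for t
  have [measurable]: "F \<in> borel_measurable borel" unfolding F_def by measurable
  define H where "H = sqrt (ell2_sq a) / (1 - R)"
  have wR: "cmod (w t) \<le> R" for t using r_le norm_w by simp
  have Fb: "cmod (F t) \<le> H" for t
    unfolding F_def H_def by (rule power_series_bound[OF ell2_bound[OF a] wR R])
  have hb: "\<bar>Re (F t)\<bar> \<le> H" for t using order_trans[OF abs_Re_le_cmod Fb] .
  define b where "b k = (\<integral>t. of_real (Re (F t)) * cnj (w t) ^ k \<partial>circ)" for k
  have b: "b \<in> ell2" "ell2_sq b \<le> 16 * sqrt K * (\<integral>t. (Re (F t))\<^sup>2 \<partial>circ)"
    using adjoint_bound[OF K, of "\<lambda>t. Re (F t)" H] hb unfolding b_def by auto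
  have cb: "cnj (b k) = (\<integral>t. of_real (Re (F t)) * w t ^ k \<partial>circ)" for k
    unfolding b_def by (simp flip: Bochner_Integration.integral_cnj)
  have "(\<lambda>k. a k * cnj (b k)) sums (\<integral>t. of_real (Re (F t)) * F t \<partial>circ)"
    unfolding cb F_def[of t for t] 
    by (rule circ_power_series[OF ell2_bound[OF a] wR R, where H = H]) (use hb in \<open>auto simp: F_def\<close>)
  then have e: "(\<integral>t. of_real (Re (F t)) * F t \<partial>circ) = (\<Sum>k. a k * cnj (b k))" by (simp add: sums_iff)
  have "integrable circ (\<lambda>t. of_real (Re (F t)) * F t)"
    by (rule circ_integrable_bounded[where M = "H * H"])
       (use hb Fb order_trans[OF abs_ge_zero hb] in \<open>auto simp: norm_mult intro!: mult_mono\<close>)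
  then have "(\<integral>t. (Re (F t))\<^sup>2 \<partial>circ) = Re (\<integral>t. of_real (Re (F t)) * F t \<partial>circ)"
    by (subst integral_Re[symmetric]) (auto simp: power2_eq_square)
  also have "\<dots> \<le> cmod (\<Sum>k. a k * cnj (b k))" unfolding e by (rule complex_Re_le_cmod)
  also have "\<dots> \<le> (16 * sqrt K * ell2_sq a + ell2_sq b / (16 * sqrt K)) / 2"
    by (rule ell2_pairing(3)[OF a b(1)]) (use K in auto)
  also have "\<dots> \<le> (16 * sqrt K * ell2_sq a + (\<integral>t. (Re (F t))\<^sup>2 \<partial>circ)) / 2"
    using b(2) K by (simp add: field_simps)
  finally show ?thesis by (simp add: F_def)
qed

text \<open>The imaginary part of \<open>S a\<close> is the real part of \<open>S (-\<i> a)\<close>.\<close>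

lemma bounds_improve:
  assumes K: "bounds K" "0 < K"
  shows "bounds (32 * sqrt K)"
  unfolding bounds_def
proof
  fix a assume a: "a \<in> ell2"
  define F where "F t = (\<Sum>k. a k * w t ^ k)" for t
  have [measurable]: "F \<in> borel_measurable borel" unfolding F_def by measurable
  have wR: "cmod (w t) \<le> R" for t using r_le norm_w by simp
  have w1: "cmod (w t) < 1" for t using wR[of t] R by linarith
  define H where "H = sqrt (ell2_sq a) / (1 - R)"
  have Fb: "cmod (F t) \<le> H" for t
    unfolding F_def H_def by (rule power_series_bound[OF ell2_bound[OF a] wR R])
  define a' where "a' k = - \<i> * a k" for k
  have a': "a' \<in> ell2" "ell2_sq a' = ell2_sq a"
    using a by (auto simp: ell2_def ell2_sq_def a'_def norm_mult)
  have "(\<Sum>k. a' k * w t ^ k) = - \<i> * F t" for t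
  proof -
    have "summable (\<lambda>k. a k * w t ^ k)" by (rule summable_norm_bounded_power(2)[OF ell2_bound[OF a] w1])
    from suminf_mult[OF this, of "- \<i>"] show ?thesis by (simp add: a'_def F_def mult.assoc)
  qed
  then have I: "(\<integral>t. (Im (F t))\<^sup>2 \<partial>circ) \<le> 16 * sqrt K * ell2_sq a"
    using bounds_Re[OF K a'(1)] a'(2) by simp
  have i: "integrable circ (\<lambda>t. (Re (F t))\<^sup>2)" "integrable circ (\<lambda>t. (Im (F t))\<^sup>2)"
    by (rule circ_integrable_bounded[where M = "H\<^sup>2"];
        use power_mono[OF order_trans[OF abs_Re_le_cmod Fb], of _ 2] power_mono[OF order_trans[OF abs_Im_le_cmod Fb], of _ 2] in auto)+
  have "(\<integral>t. (cmod (F t))\<^sup>2 \<partial>circ) = (\<integral>t. (Re (F t))\<^sup>2 \<partial>circ) + (\<integral>t. (Im (F t))\<^sup>2 \<partial>circ)"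
    unfolding cmod_power2 using i by simp
  then show "(\<integral>t. (cmod (\<Sum>k. a k * w t ^ k))\<^sup>2 \<partial>circ) \<le> 32 * sqrt K * ell2_sq a"
    using I bounds_Re[OF K a] by (simp add: F_def)
qed

lemma bounds_exists: "\<exists>K>0. bounds K"
proof (intro exI conjI)
  show "0 < (1 / (1 - R))\<^sup>2" using R by simp
  show "bounds ((1 / (1 - R))\<^sup>2)"
    unfolding bounds_def
  proof
    fix a assume a: "a \<in> ell2"
    have wR: "cmod (w t) \<le> R" for t using r_le norm_w by simp
    have "cmod (\<Sum>k. a k * w t ^ k) \<le> sqrt (ell2_sq a) / (1 - R)" for t
      by (rule power_series_bound[OF ell2_bound[OF a] wR R])
    from power_mono[OF this norm_ge_zero, where n = 2] have *: "(cmod (\<Sum>k. a k * w t ^ k))\<^sup>2 \<le> (1 / (1 - R))\<^sup>2 * ell2_sq a" for t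
      using ell2_sq_nonneg[OF a] by (simp add: power_divide)
    have "(\<integral>t. (cmod (\<Sum>k. a k * w t ^ k))\<^sup>2 \<partial>circ) \<le> (\<integral>t. (1 / (1 - R))\<^sup>2 * ell2_sq a \<partial>circ)"
      by (rule integral_mono[OF circ_integrable_bounded[where M = "(1 / (1 - R))\<^sup>2 * ell2_sq a"] _ *]) (use * in auto)
    then show "(\<integral>t. (cmod (\<Sum>k. a k * w t ^ k))\<^sup>2 \<partial>circ) \<le> (1 / (1 - R))\<^sup>2 * ell2_sq a"
      using circ.prob_space by simp
  qed
qed

text \<open>The infimum \<open>I\<close> of all bounds satisfies \<open>I \<le> 32 \<surd>I\<close>, and \<open>32\<^sup>2 = 1024\<close>.\<close>

lemma radial_maximal:
  assumes a: "a \<in> ell2"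
  shows "(\<integral>t. (cmod (\<Sum>k. a k * w t ^ k))\<^sup>2 \<partial>circ) \<le> 1024 * ell2_sq a"
proof -
  define V where "V = {K. 0 < K \<and> bounds K}"
  have ne: "V \<noteq> {}" using bounds_exists by (auto simp: V_def)
  have bd: "bdd_below V" by (rule bdd_belowI[of _ 0]) (auto simp: V_def)
  have "Inf V \<le> 1024"
  proof (rule ccontr)
    assume "\<not> Inf V \<le> 1024"
    then have I: "1024 < Inf V" by simp
    then have "Inf V * 1024 < Inf V * Inf V" by simp
    then have "Inf V < (Inf V / 32)\<^sup>2" by (simp add: power2_eq_square)
    then obtain K where K: "K \<in> V" "K < (Inf V / 32)\<^sup>2" using cInf_lessD[OF ne] by blast
    then have "32 * sqrt K \<in> V" using bounds_improve by (auto simp: V_def)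
    then have "Inf V \<le> 32 * sqrt K" by (rule cInf_lower[OF _ bd])
    moreover have "sqrt K < Inf V / 32" using K(2) I by (intro real_less_lsqrt) auto
    ultimately show False by simp
  qed
  have nn: "0 \<le> ell2_sq a" by (rule ell2_sq_nonneg[OF a])
  show ?thesis
  proof (rule field_le_epsilon)
    fix e :: real assume e: "0 < e"
    define d where "d = e / (ell2_sq a + 1)"
    have d: "0 < d" "d * ell2_sq a \<le> e" using e nn by (auto simp: d_def field_simps)
    have "Inf V < 1024 + d" using \<open>Inf V \<le> 1024\<close> d by linarith
    then obtain K where K: "K \<in> V" "K < 1024 + d" using cInf_lessD[OF ne] by blast
    then have "(\<integral>t. (cmod (\<Sum>k. a k * w t ^ k))\<^sup>2 \<partial>circ) \<le> K * ell2_sq a"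
      using a by (auto simp: V_def bounds_def)
    also have "\<dots> \<le> (1024 + d) * ell2_sq a" using K nn by (intro mult_right_mono) auto
    finally show "(\<integral>t. (cmod (\<Sum>k. a k * w t ^ k))\<^sup>2 \<partial>circ) \<le> 1024 * ell2_sq a + e"
      using d by (simp add: algebra_simps)
  qed
qed

end

section \<open>Radial limits\<close>

definition psum :: "(nat \<Rightarrow> complex) \<Rightarrow> complex \<Rightarrow> complex" where
  "psum a z = (\<Sum>k. a k * z ^ k)"

lemma psum_sums: "a \<in> ell2 \<Longrightarrow> cmod z < 1 \<Longrightarrow> (\<lambda>k. a k * z ^ k) sums psum a z"
  unfolding psum_def by (intro summable_sums summable_norm_bounded_power(2)[OF ell2_bound])

lemma psum_measurable [measurable]: "w \<in> borel_measurable M \<Longrightarrow> (\<lambda>t. psum a (w t)) \<in> borel_measurable M"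
  unfolding psum_def by measurable

lemma psum_holomorphic: "a \<in> ell2 \<Longrightarrow> psum a holomorphic_on ball 0 1"
  by (rule power_series_holomorphic[of 0 1 a]) (use psum_sums in auto)

lemma psum_radial_continuous:
  assumes "a \<in> ell2"
  shows "continuous_on {0..<1} (\<lambda>\<rho>. psum a (of_real \<rho> * cis t))"
  by (intro continuous_on_compose2[OF holomorphic_on_imp_continuous_on[OF psum_holomorphic[OF assms]]] continuous_intros)
     (auto simp: norm_mult)

text \<open>The running maximiser \<open>s n t\<close> among the first radii is a measurable selection, so the
  maximal inequality applies to it; monotone convergence removes the restriction to finitely
  many radii.\<close>

lemma radial_selection_sequence:
  fixes q :: "nat \<Rightarrow> real"
  assumes a: "a \<in> ell2" and q: "\<And>n. q n \<in> {0..<1}"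
  obtains M where "M \<in> borel_measurable borel"
    "\<And>n t. ennreal ((cmod (psum a (of_real (q n) * cis t)))\<^sup>2) \<le> M t"
    "(\<integral>\<^sup>+t. M t \<partial>circ) \<le> ennreal (1024 * ell2_sq a)"
proof -
  define F where "F \<rho> t = cmod (psum a (of_real \<rho> * cis t))" for \<rho> t
  define s where "s = rec_nat (\<lambda>t. q 0) (\<lambda>n f t. if F (q (Suc n)) t > F (f t) t then q (Suc n) else f t)"
  have s0: "s 0 = (\<lambda>t. q 0)" by (simp add: s_def)
  have sS: "s (Suc n) = (\<lambda>t. if F (q (Suc n)) t > F (s n t) t then q (Suc n) else s n t)" for n
    unfolding s_def by simp
  have [measurable]: "s n \<in> borel_measurable borel" for n
    by (induction n) (simp_all add: s0 sS F_def)
  have mono: "F (s n t) t \<le> F (s (Suc n) t) t" for n t by (simp add: sS)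
  have qs: "F (q n) t \<le> F (s n t) t" for n t by (cases n) (auto simp: s0 sS)
  have rng: "\<exists>R<1. \<forall>t. s n t \<le> R" and nn: "\<forall>t. 0 \<le> s n t" for n
  proof (induction n)
    case 0
    { case 1 show ?case using q[of 0] by (auto simp: s0) next case 2 show ?case using q[of 0] by (auto simp: s0) }
  next
    case (Suc n)
    { case 1
      from Suc(1) obtain R where R: "R < 1" "\<forall>t. s n t \<le> R" by blast
      then have "\<forall>t. s (Suc n) t \<le> max R (q (Suc n))" by (auto simp: sS le_max_iff_disj)
      then show ?case using R q[of "Suc n"] by (intro exI[of _ "max R (q (Suc n))"]) auto
    next
      case 2 show ?case using Suc(2) q[of "Suc n"] by (auto simp: sS)
    }
  qed
  have int: "(\<integral>\<^sup>+t. ennreal ((F (s n t) t)\<^sup>2) \<partial>circ) \<le> ennreal (1024 * ell2_sq a)" for n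
  proof -
    obtain R where R: "R < 1" "\<forall>t. s n t \<le> R" using rng by blast
    interpret rs: radial_selection "s n" R by unfold_locales (use R nn in auto)
    have b: "F (s n t) t \<le> sqrt (ell2_sq a) / (1 - R)" for t
      unfolding F_def psum_def
      by (rule power_series_bound[OF ell2_bound[OF a] _ R(1)]) (use R nn in \<open>auto simp: norm_mult\<close>)
    have F0: "0 \<le> F \<rho> t" for \<rho> t by (simp add: F_def)
    have "integrable circ (\<lambda>t. (F (s n t) t)\<^sup>2)"
      by (rule circ_integrable_bounded[where M = "(sqrt (ell2_sq a) / (1 - R))\<^sup>2"])
         (use power_mono[OF b F0, where n = 2] in \<open>auto simp: F_def\<close>)
    then have "(\<integral>\<^sup>+t. ennreal ((F (s n t) t)\<^sup>2) \<partial>circ) = ennreal (\<integral>t. (F (s n t) t)\<^sup>2 \<partial>circ)"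
      by (rule nn_integral_eq_integral) auto
    also have "\<dots> \<le> ennreal (1024 * ell2_sq a)"
      using rs.radial_maximal[OF a] by (intro ennreal_leI) (simp add: F_def psum_def rs.w_def)
    finally show ?thesis .
  qed
  define M where "M t = (SUP n. ennreal ((F (s n t) t)\<^sup>2))" for t
  show thesis
  proof
    show "M \<in> borel_measurable borel" unfolding M_def F_def by measurable
    have F0: "0 \<le> F \<rho> t" for \<rho> t by (simp add: F_def)
    show "ennreal ((cmod (psum a (of_real (q n) * cis t)))\<^sup>2) \<le> M t" for n t
      unfolding M_def F_def[symmetric]
      by (rule SUP_upper2[of n]) (use qs F0 in \<open>auto intro!: ennreal_leI power_mono\<close>)
    have "incseq (\<lambda>n t. ennreal ((F (s n t) t)\<^sup>2))"
      by (rule incseq_SucI) (auto simp: le_fun_def intro!: ennreal_leI power_mono mono F0)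
    then have "(\<integral>\<^sup>+t. M t \<partial>circ) = (SUP n. \<integral>\<^sup>+t. ennreal ((F (s n t) t)\<^sup>2) \<partial>circ)"
      unfolding M_def by (rule nn_integral_monotone_convergence_SUP) (unfold F_def, measurable)
    also have "\<dots> \<le> ennreal (1024 * ell2_sq a)" by (rule SUP_least) (rule int)
    finally show "(\<integral>\<^sup>+t. M t \<partial>circ) \<le> ennreal (1024 * ell2_sq a)" .
  qed
qed

lemma radial_maximal_function:
  assumes a: "a \<in> ell2"
  obtains M where "M \<in> borel_measurable borel"
    "\<And>\<rho> t. 0 \<le> \<rho> \<Longrightarrow> \<rho> < 1 \<Longrightarrow> ennreal ((cmod (psum a (of_real \<rho> * cis t)))\<^sup>2) \<le> M t"
    "(\<integral>\<^sup>+t. M t \<partial>circ) \<le> ennreal (1024 * ell2_sq a)"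
proof -
  define Q where "Q = \<rat> \<inter> {0..<1::real}"
  have Q: "countable Q" "Q \<noteq> {}" using countable_rat by (auto simp: Q_def intro: exI[of _ 0])
  define q where "q = from_nat_into Q"
  have q: "q n \<in> {0..<1}" for n using from_nat_into[OF Q(2), of n] by (simp add: q_def Q_def)
  have rq: "range q = Q" unfolding q_def by (rule range_from_nat_into[OF Q(2,1)])
  obtain M where M: "M \<in> borel_measurable borel"
    "\<And>n t. ennreal ((cmod (psum a (of_real (q n) * cis t)))\<^sup>2) \<le> M t"
    "(\<integral>\<^sup>+t. M t \<partial>circ) \<le> ennreal (1024 * ell2_sq a)"
    using radial_selection_sequence[where q = q, OF a q] by blast
  have "ennreal ((cmod (psum a (of_real \<rho> * cis t)))\<^sup>2) \<le> M t" if \<rho>: "0 \<le> \<rho>" "\<rho> < 1" for \<rho> t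
  proof (rule ccontr)
    define g where "g \<rho> = (cmod (psum a (of_real \<rho> * cis t)))\<^sup>2" for \<rho>
    assume "\<not> ?thesis"
    then have lt: "M t < ennreal (g \<rho>)" by (simp add: g_def)
    have g0: "0 \<le> g x" for x by (simp add: g_def)
    have "M t \<noteq> \<infinity>" using lt by (auto simp: top_unique)
    then obtain m where m: "0 \<le> m" "M t = ennreal m" by (cases "M t") auto
    have mg: "m < g \<rho>" using lt m by (simp add: ennreal_less_iff)
    have "continuous_on {0..<1} g" unfolding g_def
      by (intro continuous_intros psum_radial_continuous[OF a])
    then have "(g \<longlongrightarrow> g \<rho>) (at \<rho> within {0..<1})" using \<rho> by (auto simp: continuous_on_def)
    then have "eventually (\<lambda>x. m < g x) (at \<rho> within {0..<1})" by (rule order_tendstoD(1)[OF _ mg])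
    then obtain d where d: "0 < d" "\<And>x. x \<in> {0..<1} \<Longrightarrow> x \<noteq> \<rho> \<Longrightarrow> dist x \<rho> < d \<Longrightarrow> m < g x"
      by (auto simp: eventually_at)
    obtain x where x: "x \<in> \<rat>" "\<rho> < x" "x < min 1 (\<rho> + d)"
      using Rats_dense_in_real[of \<rho> "min 1 (\<rho> + d)"] \<rho> d by auto
    then have "x \<in> Q" using \<rho> by (auto simp: Q_def)
    then obtain n where n: "x = q n" using rq by auto
    have "m < g x" using d(2)[of x] x \<rho> by (auto simp: dist_real_def)
    moreover have "ennreal (g x) \<le> ennreal m" using M(2)[of n t] m n by (simp add: g_def)
    ultimately show False using m g0 by (simp add: ennreal_le_iff)
  qed
  with M show thesis using that by blast
qed

definition ell2_tail :: "nat \<Rightarrow> (nat \<Rightarrow> complex) \<Rightarrow> nat \<Rightarrow> complex" where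
  "ell2_tail n a k = (if k < n then 0 else a k)"

lemma ell2_tail:
  assumes a: "a \<in> ell2"
  shows "ell2_tail n a \<in> ell2" and "ell2_sq (ell2_tail n a) = ell2_sq a - (\<Sum>k<n. (cmod (a k))\<^sup>2)"
proof -
  have "(\<lambda>k. (cmod (a k))\<^sup>2 - (if k \<in> {..<n} then (cmod (a k))\<^sup>2 else 0)) sums (ell2_sq a - (\<Sum>k<n. (cmod (a k))\<^sup>2))"
    by (intro sums_diff sums_If_finite_set) (use a in \<open>auto simp: ell2_def ell2_sq_def\<close>)
  moreover have "(\<lambda>k. (cmod (a k))\<^sup>2 - (if k \<in> {..<n} then (cmod (a k))\<^sup>2 else 0)) = (\<lambda>k. (cmod (ell2_tail n a k))\<^sup>2)"
    by (auto simp: ell2_tail_def fun_eq_iff)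
  ultimately have *: "(\<lambda>k. (cmod (ell2_tail n a k))\<^sup>2) sums (ell2_sq a - (\<Sum>k<n. (cmod (a k))\<^sup>2))" by simp
  from * show "ell2_tail n a \<in> ell2" by (auto simp: ell2_def sums_iff)
  from * show "ell2_sq (ell2_tail n a) = ell2_sq a - (\<Sum>k<n. (cmod (a k))\<^sup>2)" by (simp add: ell2_sq_def sums_iff)
qed

lemma psum_split:
  assumes a: "a \<in> ell2" and z: "cmod z < 1"
  shows "psum a z = (\<Sum>k<n. a k * z ^ k) + psum (ell2_tail n a) z"
proof -
  have "(\<lambda>k. (if k \<in> {..<n} then a k * z ^ k else 0) + ell2_tail n a k * z ^ k) sums
      ((\<Sum>k<n. a k * z ^ k) + psum (ell2_tail n a) z)"
    by (intro sums_add sums_If_finite_set psum_sums ell2_tail a z) auto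
  moreover have "(\<lambda>k. (if k \<in> {..<n} then a k * z ^ k else 0) + ell2_tail n a k * z ^ k) = (\<lambda>k. a k * z ^ k)"
    by (auto simp: ell2_tail_def fun_eq_iff)
  ultimately show ?thesis using psum_sums[OF a z] sums_unique2 by metis
qed

lemma eventually_at_left_1: "eventually (\<lambda>\<rho>. 0 < \<rho> \<and> \<rho> < 1) (at_left (1::real))"
  using order_tendstoD(1)[OF tendsto_ident_at[of "1::real" "{..<1}"], of 0]
  by (auto simp: eventually_at_filter elim: eventually_mono)

text \<open>After removal of a polynomial, which causes no oscillation at the boundary, the remaining
  oscillation is at most twice the maximal function of the tail of the series. The infimum of
  these maximal functions has integral zero.\<close>

lemma radial_limit_AE:
  assumes a: "a \<in> ell2"
  shows "AE t in circ. \<exists>l. ((\<lambda>\<rho>. psum a (of_real \<rho> * cis t)) \<longlongrightarrow> l) (at_left 1)"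
proof -
  have "\<forall>n. \<exists>M. M \<in> borel_measurable borel \<and>
    (\<forall>\<rho> t. 0 \<le> \<rho> \<longrightarrow> \<rho> < 1 \<longrightarrow> ennreal ((cmod (psum (ell2_tail n a) (of_real \<rho> * cis t)))\<^sup>2) \<le> M t) \<and>
    (\<integral>\<^sup>+t. M t \<partial>circ) \<le> ennreal (1024 * ell2_sq (ell2_tail n a))"
    using radial_maximal_function[OF ell2_tail(1)[OF a]] by metis
  then obtain M where Mm: "\<And>n. M n \<in> borel_measurable borel"
    and Mb: "\<And>n \<rho> t. 0 \<le> \<rho> \<Longrightarrow> \<rho> < 1 \<Longrightarrow> ennreal ((cmod (psum (ell2_tail n a) (of_real \<rho> * cis t)))\<^sup>2) \<le> M n t"
    and Mi: "\<And>n. (\<integral>\<^sup>+t. M n t \<partial>circ) \<le> ennreal (1024 * ell2_sq (ell2_tail n a))"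
    by metis
  note [measurable] = Mm
  define I where "I t = (INF n. M n t)" for t
  have [measurable]: "I \<in> borel_measurable borel" unfolding I_def by measurable
  have "(\<lambda>n. \<Sum>k<n. (cmod (a k))\<^sup>2) \<longlonglongrightarrow> ell2_sq a"
    using a unfolding ell2_def ell2_sq_def by (auto intro: summable_LIMSEQ)
  then have "(\<lambda>n. 1024 * ell2_sq (ell2_tail n a)) \<longlonglongrightarrow> 1024 * (ell2_sq a - ell2_sq a)"
    unfolding ell2_tail(2)[OF a] by (intro tendsto_intros)
  then have lim: "(\<lambda>n. ennreal (1024 * ell2_sq (ell2_tail n a))) \<longlonglongrightarrow> ennreal 0"
    by (intro tendsto_ennrealI) simp
  have "(\<integral>\<^sup>+t. I t \<partial>circ) \<le> ennreal (1024 * ell2_sq (ell2_tail n a))" for n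
    by (rule order_trans[OF nn_integral_mono Mi[of n]]) (auto simp: I_def intro: INF_lower)
  then have "(\<integral>\<^sup>+t. I t \<partial>circ) \<le> ennreal 0"
    by (intro LIMSEQ_le_const[OF lim]) auto
  then have "(\<integral>\<^sup>+t. I t \<partial>circ) = 0" by simp
  then have "AE t in circ. I t = 0" by (subst (asm) nn_integral_0_iff_AE) auto
  then show ?thesis
  proof eventually_elim
    fix t assume I0: "I t = 0"
    define f where "f \<rho> = psum a (of_real \<rho> * cis t)" for \<rho>
    have "cauchy_filter (filtermap f (at_left 1))"
      unfolding cauchy_filter_metric_filtermap
    proof (intro allI impI)
      fix e :: real assume e: "0 < e"
      \<comment> \<open>two tails and two deviations of the polynomial\<close>
      define d where "d = e / 4"
      have d: "0 < d" using e by (simp add: d_def)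
      have "I t < ennreal (d\<^sup>2)" using I0 d by simp
      then obtain n where n: "M n t < ennreal (d\<^sup>2)" unfolding I_def INF_less_iff by auto
      define p where "p \<rho> = (\<Sum>k<n. a k * (of_real \<rho> * cis t) ^ k)" for \<rho> :: real
      have tail: "cmod (f \<rho> - p \<rho>) < d" if \<rho>: "0 \<le> \<rho>" "\<rho> < 1" for \<rho>
      proof -
        have "f \<rho> - p \<rho> = psum (ell2_tail n a) (of_real \<rho> * cis t)"
          unfolding f_def p_def using psum_split[OF a, of "of_real \<rho> * cis t" n] \<rho> by (simp add: norm_mult)
        then have "ennreal ((cmod (f \<rho> - p \<rho>))\<^sup>2) < ennreal (d\<^sup>2)"
          using Mb[OF \<rho>, of n t] n by simp
        then have "(cmod (f \<rho> - p \<rho>))\<^sup>2 < d\<^sup>2" by (simp add: ennreal_less_iff)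
        then show ?thesis using d by (intro power2_less_imp_less[of _ d]) auto
      qed
      have "(p \<longlongrightarrow> p 1) (at_left 1)" unfolding p_def by (intro tendsto_intros)
      then have ev: "eventually (\<lambda>\<rho>. dist (p \<rho>) (p 1) < d) (at_left 1)" by (rule tendstoD[OF _ d])
      show "\<exists>P. eventually P (at_left 1) \<and> (\<forall>x y. P x \<and> P y \<longrightarrow> dist (f x) (f y) < e)"
      proof (intro exI conjI allI impI)
        show "eventually (\<lambda>\<rho>. 0 \<le> \<rho> \<and> \<rho> < 1 \<and> dist (p \<rho>) (p 1) < d) (at_left 1)"
          using ev eventually_at_left_1 by eventually_elim auto
        fix x y assume xy: "(0 \<le> x \<and> x < 1 \<and> dist (p x) (p 1) < d) \<and> (0 \<le> y \<and> y < 1 \<and> dist (p y) (p 1) < d)"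
        have "dist (f x) (p x) < d" "dist (f y) (p y) < d" using tail xy by (auto simp: dist_norm)
        moreover have "dist (f x) (f y) \<le> dist (f x) (p x) + dist (p x) (p 1) + dist (p y) (p 1) + dist (f y) (p y)"
          by metric
        ultimately show "dist (f x) (f y) < e" using xy by (simp add: d_def)
      qed
    qed
    moreover have "filtermap f (at_left 1) \<noteq> bot" by (simp add: filtermap_bot_iff)
    ultimately have "\<exists>c. filtermap f (at_left 1) \<le> nhds c"
      by (intro cauchy_filter_complete_converges[where A = UNIV]) (auto simp: complete_UNIV)
    then show "\<exists>l. ((\<lambda>\<rho>. psum a (of_real \<rho> * cis t)) \<longlongrightarrow> l) (at_left 1)"
      by (simp add: filterlim_def f_def[abs_def])
  qed
qed

definition inner_radius :: "nat \<Rightarrow> real" where "inner_radius n = 1 - 1 / (real n + 2)"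

lemma inner_radius: "0 \<le> inner_radius n" "inner_radius n < 1"
  by (auto simp: inner_radius_def field_simps)

lemma inner_radius_tendsto: "filterlim inner_radius (at_left 1) sequentially" "inner_radius \<longlonglongrightarrow> 1"
proof -
  show l: "inner_radius \<longlonglongrightarrow> 1" unfolding inner_radius_def by real_asymp
  show "filterlim inner_radius (at_left 1) sequentially"
    unfolding filterlim_at using l inner_radius inner_radius(2)[THEN less_imp_neq] by (auto intro!: always_eventually)
qed

text \<open>A limit along a fixed sequence of radii, in contrast to \<open>boundary_value\<close>, is a measurable
  function of the angle without further argument.\<close>

definition bdry :: "(nat \<Rightarrow> complex) \<Rightarrow> real \<Rightarrow> complex" where
  "bdry a t = lim (\<lambda>n. psum a (of_real (inner_radius n) * cis t))"

lemma bdry_measurable [measurable]: "bdry a \<in> borel_measurable borel"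
  unfolding bdry_def by measurable

lemma bdry_radial_limit:
  assumes a: "a \<in> ell2"
  shows "AE t in circ. ((\<lambda>\<rho>. psum a (of_real \<rho> * cis t)) \<longlongrightarrow> bdry a t) (at_left 1)"
  using radial_limit_AE[OF a]
proof eventually_elim
  fix t assume "\<exists>l. ((\<lambda>\<rho>. psum a (of_real \<rho> * cis t)) \<longlongrightarrow> l) (at_left 1)"
  then obtain l where l: "((\<lambda>\<rho>. psum a (of_real \<rho> * cis t)) \<longlongrightarrow> l) (at_left 1)" by blast
  then have "(\<lambda>n. psum a (of_real (inner_radius n) * cis t)) \<longlonglongrightarrow> l"
    by (rule filterlim_compose[OF _ inner_radius_tendsto(1)])
  then have "bdry a t = l" unfolding bdry_def by (rule limI)
  then show "((\<lambda>\<rho>. psum a (of_real \<rho> * cis t)) \<longlongrightarrow> bdry a t) (at_left 1)" using l by simp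
qed

lemma le_add_of_le_half_sum:
  fixes x y a b z :: real
  assumes "0 \<le> x" "0 \<le> y" "x \<le> a" "y \<le> b" "z \<le> (x + y) / 2"
  shows "z \<le> a + b"
proof -
  have "(x + y) / 2 \<le> x + y" using assms by simp
  also have "\<dots> \<le> a + b" using assms by (intro add_mono)
  finally show ?thesis using assms(5) by (rule order_trans[rotated])
qed

text \<open>Dominated convergence from Parseval's identity on the circles of radius \<open>inner_radius n\<close>;
  the maximal functions of the two series dominate the integrands.\<close>

lemma bdry_pairing:
  assumes a: "a \<in> ell2" and b: "b \<in> ell2"
  shows "(\<integral>t. bdry a t * cnj (bdry b t) \<partial>circ) = (\<Sum>k. a k * cnj (b k))"
proof -
  obtain Ma where Ma [measurable]: "Ma \<in> borel_measurable borel"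
    and Mab: "\<And>\<rho> t. 0 \<le> \<rho> \<Longrightarrow> \<rho> < 1 \<Longrightarrow> ennreal ((cmod (psum a (of_real \<rho> * cis t)))\<^sup>2) \<le> Ma t"
    and Mai: "(\<integral>\<^sup>+t. Ma t \<partial>circ) \<le> ennreal (1024 * ell2_sq a)"
    using radial_maximal_function[OF a] by metis
  obtain Mb where Mb [measurable]: "Mb \<in> borel_measurable borel"
    and Mbb: "\<And>\<rho> t. 0 \<le> \<rho> \<Longrightarrow> \<rho> < 1 \<Longrightarrow> ennreal ((cmod (psum b (of_real \<rho> * cis t)))\<^sup>2) \<le> Mb t"
    and Mbi: "(\<integral>\<^sup>+t. Mb t \<partial>circ) \<le> ennreal (1024 * ell2_sq b)"
    using radial_maximal_function[OF b] by metis
  have int: "integrable circ (\<lambda>t. enn2real (M t))" and fin: "AE t in circ. M t \<noteq> \<infinity>"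
    if [measurable]: "M \<in> borel_measurable borel" and i: "(\<integral>\<^sup>+t. M t \<partial>circ) \<le> ennreal c" for M :: "real \<Rightarrow> ennreal" and c
  proof -
    have "(\<integral>\<^sup>+t. ennreal (norm (enn2real (M t))) \<partial>circ) \<le> (\<integral>\<^sup>+t. M t \<partial>circ)"
      by (intro nn_integral_mono) (auto simp: ennreal_enn2real_if)
    also have "\<dots> < \<infinity>" using i by (rule order_le_less_trans) simp
    finally show "integrable circ (\<lambda>t. enn2real (M t))" by (intro integrableI_bounded) auto
    show "AE t in circ. M t \<noteq> \<infinity>"
      by (rule nn_integral_PInf_AE) (use i in \<open>auto simp: top_unique\<close>)
  qed
  define A where "A n t = psum a (of_real (inner_radius n) * cis t)" for n t
  define C where "C n t = psum b (of_real (inner_radius n) * cis t)" for n t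
  have [measurable]: "A n \<in> borel_measurable borel" "C n \<in> borel_measurable borel" for n
    unfolding A_def C_def by measurable
  have "(\<lambda>n. \<integral>t. A n t * cnj (C n t) \<partial>circ) \<longlonglongrightarrow> (\<integral>t. bdry a t * cnj (bdry b t) \<partial>circ)"
  proof (rule integral_dominated_convergence)
    show "integrable circ (\<lambda>t. enn2real (Ma t) + enn2real (Mb t))"
      using int[OF Ma Mai] int[OF Mb Mbi] by simp
    show "AE t in circ. (\<lambda>n. A n t * cnj (C n t)) \<longlonglongrightarrow> bdry a t * cnj (bdry b t)"
      using bdry_radial_limit[OF a] bdry_radial_limit[OF b]
    proof eventually_elim
      fix t assume "((\<lambda>\<rho>. psum a (of_real \<rho> * cis t)) \<longlongrightarrow> bdry a t) (at_left 1)"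
        "((\<lambda>\<rho>. psum b (of_real \<rho> * cis t)) \<longlongrightarrow> bdry b t) (at_left 1)"
      then have "(\<lambda>n. A n t) \<longlonglongrightarrow> bdry a t" "(\<lambda>n. C n t) \<longlonglongrightarrow> bdry b t"
        unfolding A_def C_def by (auto intro: filterlim_compose[OF _ inner_radius_tendsto(1)])
      then show "(\<lambda>n. A n t * cnj (C n t)) \<longlonglongrightarrow> bdry a t * cnj (bdry b t)" by (intro tendsto_intros)
    qed
    show "AE t in circ. norm (A n t * cnj (C n t)) \<le> enn2real (Ma t) + enn2real (Mb t)" for n
      using fin[OF Ma Mai] fin[OF Mb Mbi]
    proof eventually_elim
      fix t assume f: "Ma t \<noteq> \<infinity>" "Mb t \<noteq> \<infinity>"
      have "(cmod (A n t))\<^sup>2 \<le> enn2real (Ma t)"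
        using enn2real_mono[OF Mab[OF inner_radius, of n t]] f by (simp add: A_def less_top[symmetric])
      moreover have "(cmod (C n t))\<^sup>2 \<le> enn2real (Mb t)"
        using enn2real_mono[OF Mbb[OF inner_radius, of n t]] f by (simp add: C_def less_top[symmetric])
      moreover have "norm (A n t * cnj (C n t)) \<le> ((cmod (A n t))\<^sup>2 + (cmod (C n t))\<^sup>2) / 2"
        using weighted_am_gm[of 1 "cmod (A n t)" "cmod (C n t)"] by (simp add: norm_mult)
      ultimately show "norm (A n t * cnj (C n t)) \<le> enn2real (Ma t) + enn2real (Mb t)"
        by (rule le_add_of_le_half_sum[OF zero_le_power2 zero_le_power2])
    qed
  qed auto
  moreover have "(\<integral>t. A n t * cnj (C n t) \<partial>circ) = (\<Sum>k. a k * cnj (b k) * of_real (inner_radius n ^ (2 * k)))" for n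
  proof -
    define m where "m = max (sqrt (ell2_sq a)) (sqrt (ell2_sq b))"
    have "cmod (a k) \<le> m" "cmod (b k) \<le> m" for k
      using ell2_bound[OF a, of k] ell2_bound[OF b, of k] by (auto simp: m_def)
    from circ_parseval[OF this inner_radius] show ?thesis
      unfolding A_def C_def psum_def by (auto simp: sums_iff)
  qed
  moreover have "(\<lambda>n. \<Sum>k. a k * cnj (b k) * of_real (inner_radius n ^ (2 * k))) \<longlonglongrightarrow> (\<Sum>k. a k * cnj (b k))"
  proof -
    have "(\<lambda>n. a k * cnj (b k) * of_real (inner_radius n ^ (2 * k))) \<longlonglongrightarrow> a k * cnj (b k)" for k
      using tendsto_mult[OF tendsto_const[of "a k * cnj (b k)"] tendsto_of_real[OF tendsto_power[OF inner_radius_tendsto(2)]], of "2 * k"]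
      by simp
    moreover have "eventually (\<lambda>(k, n). norm (a k * cnj (b k) * of_real (inner_radius n ^ (2 * k))) \<le> cmod (a k * cnj (b k))) (at_top \<times>\<^sub>F sequentially)"
    proof (rule always_eventually, safe)
      fix k n
      have "\<bar>inner_radius n\<bar> ^ (2 * k) \<le> 1" using inner_radius[of n] by (intro power_le_one) auto
      then show "norm (a k * cnj (b k) * of_real (inner_radius n ^ (2 * k))) \<le> cmod (a k * cnj (b k))"
        using mult_left_mono[of "\<bar>inner_radius n\<bar> ^ (2 * k)" 1 "cmod (a k * cnj (b k))"]
        by (simp add: norm_mult norm_power)
    qed
    ultimately show ?thesis
      using tannerys_theorem[of "\<lambda>k n. a k * cnj (b k) * of_real (inner_radius n ^ (2 * k))" "\<lambda>k. a k * cnj (b k)" sequentially "\<lambda>k. cmod (a k * cnj (b k))"] ell2_pairing(1)[OF a b]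
      by auto
  qed
  ultimately show ?thesis using LIMSEQ_unique by simp
qed

section \<open>The Hardy space as a space of square-summable sequences\<close>

text \<open>The function of the Hardy space with given Taylor coefficients; together with \<open>taylor_coeff\<close>
  it identifies \<open>hardy2\<close> with \<open>ell2\<close>.\<close>

definition hfun :: "(nat \<Rightarrow> complex) \<Rightarrow> complex \<Rightarrow> complex" where
  "hfun a z = (if z \<in> ball 0 1 then psum a z else 0)"

lemma taylor_coeff_hfun:
  assumes a: "a \<in> ell2"
  shows "taylor_coeff (hfun a) = a"
proof
  fix n
  have "ereal 1 \<le> fps_conv_radius (Abs_fps a)"
    unfolding fps_conv_radius_def
  proof (rule conv_radius_geI_ex)
    fix r :: real assume r: "0 < r" "ereal r < ereal 1"
    then show "\<exists>z. norm z = r \<and> summable (\<lambda>n. fps_nth (Abs_fps a) n * z ^ n)"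
      using summable_norm_bounded_power(2)[OF ell2_bound[OF a], of "of_real r"]
      by (intro exI[of _ "of_real r"]) auto
  qed
  then have "fps_conv_radius (Abs_fps a) > 0" by (rule order_less_le_trans[rotated]) simp
  moreover have "eventually (\<lambda>z. eval_fps (Abs_fps a) z = hfun a z) (nhds 0)"
  proof -
    have "eventually (\<lambda>z. z \<in> ball (0::complex) 1) (nhds 0)" by (rule eventually_nhds_in_open) auto
    then show ?thesis by eventually_elim (auto simp: eval_fps_def hfun_def psum_def)
  qed
  ultimately have "hfun a has_fps_expansion Abs_fps a" by (simp add: has_fps_expansion_def)
  from fps_nth_fps_expansion[OF this, of n] show "taylor_coeff (hfun a) n = a n"
    by (simp add: taylor_coeff_def)
qed

lemma hfun_hardy2:
  assumes a: "a \<in> ell2"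
  shows "hfun a \<in> hardy2"
proof -
  have "hfun a holomorphic_on ball 0 1"
    by (rule holomorphic_transform[OF psum_holomorphic[OF a]]) (auto simp: hfun_def)
  then show ?thesis using taylor_coeff_hfun[OF a] a by (auto simp: hardy2_def ell2_def hfun_def)
qed

lemma taylor_coeff_ell2: "f \<in> hardy2 \<Longrightarrow> taylor_coeff f \<in> ell2"
  by (simp add: hardy2_def ell2_def)

lemma hfun_taylor_coeff:
  assumes f: "f \<in> hardy2"
  shows "hfun (taylor_coeff f) = f"
proof
  fix z
  show "hfun (taylor_coeff f) z = f z"
  proof (cases "z \<in> ball 0 1")
    case True
    then have "(\<lambda>n. taylor_coeff f n * (z - 0) ^ n) sums f z"
      unfolding taylor_coeff_def using f by (intro holomorphic_power_series[where r = 1]) (auto simp: hardy2_def)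
    then show ?thesis using True by (simp add: hfun_def psum_def sums_iff)
  qed (use f in \<open>auto simp: hardy2_def hfun_def\<close>)
qed

lemma boundary_value_hfun:
  assumes a: "a \<in> ell2"
  shows "AE t in lborel. t \<in> {0..2*pi} \<longrightarrow> boundary_value (hfun a) (cis t) = bdry a t"
proof -
  have "AE t in circ. boundary_value (hfun a) (cis t) = bdry a t"
    using bdry_radial_limit[OF a]
  proof eventually_elim
    fix t assume l: "((\<lambda>\<rho>. psum a (of_real \<rho> * cis t)) \<longlongrightarrow> bdry a t) (at_left 1)"
    have "eventually (\<lambda>\<rho>. hfun a (of_real \<rho> * cis t) = psum a (of_real \<rho> * cis t)) (at_left 1)"
      using eventually_at_left_1 by eventually_elim (auto simp: hfun_def norm_mult)
    then have "((\<lambda>\<rho>. hfun a (of_real \<rho> * cis t)) \<longlongrightarrow> bdry a t) (at_left 1)"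
      using l by (subst tendsto_cong)
    then show "boundary_value (hfun a) (cis t) = bdry a t"
      unfolding boundary_value_def by (intro tendsto_Lim) auto
  qed
  then show ?thesis unfolding circ_def by (subst (asm) AE_uniform_measure) auto
qed

text \<open>Completeness of the measure; this is needed because \<open>boundary_value\<close> takes an unspecified
  value on the null set without radial limits.\<close>

lemma lebesgue_measurable_AE_eq:
  assumes g: "g \<in> borel_measurable lborel" and ae: "AE x in lborel. f x = g x"
  shows "f \<in> borel_measurable lebesgue"
proof (rule measurableI)
  fix S :: "'b set" assume S: "S \<in> sets borel"
  have "g -` S \<inter> space lborel \<in> sets lborel" using measurable_sets[OF g] S by simp
  then have "g -` S \<in> sets lebesgue" by (auto intro: sets_completionI_sets)
  moreover have "AE x in lebesgue. x \<in> g -` S \<longleftrightarrow> x \<in> f -` S"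
    using AE_completion[OF ae] by eventually_elim auto
  ultimately show "f -` S \<inter> space lebesgue \<in> sets lebesgue"
    using completion.in_sets_AE[of "g -` S" "f -` S" lborel] by auto
qed auto

text \<open>Everything about the inner product below uses only this formula; boundary values do not
  occur again.\<close>

lemma hardy_inner_hfun:
  assumes a: "a \<in> ell2" and b: "b \<in> ell2"
  shows "hardy_inner (hfun a) (hfun b) = (\<Sum>k. a k * cnj (b k))"
proof -
  define F where "F t = indicator {0..2*pi} t *\<^sub>R (boundary_value (hfun a) (cis t) * cnj (boundary_value (hfun b) (cis t)))" for t
  define G where "G t = indicator {0..2*pi} t *\<^sub>R (bdry a t * cnj (bdry b t))" for t
  have G: "G \<in> borel_measurable lborel" unfolding G_def by measurable
  have ae: "AE t in lborel. F t = G t"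
    using boundary_value_hfun[OF a] boundary_value_hfun[OF b]
    by eventually_elim (auto simp: F_def G_def indicator_def)
  have "integral\<^sup>L lebesgue F = integral\<^sup>L lebesgue G"
    by (rule integral_cong_AE[OF lebesgue_measurable_AE_eq[OF G ae] measurable_completion[OF G] AE_completion[OF ae]])
  also have "\<dots> = integral\<^sup>L lborel G" by (rule integral_completion[OF G])
  finally have "hardy_inner (hfun a) (hfun b) = (LINT t:{0..2*pi}|lborel. bdry a t * cnj (bdry b t)) / (2 * of_real pi)"
    by (simp only: hardy_inner_def set_lebesgue_integral_def F_def[abs_def] G_def[abs_def])
  also have "\<dots> = (\<integral>t. bdry a t * cnj (bdry b t) \<partial>circ)" by (rule circ_integral[symmetric]) measurable
  finally show ?thesis by (simp add: bdry_pairing[OF a b])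
qed

section \<open>Linear structure and shift of the Hardy space\<close>

lemma hardy_inner_eq:
  "f \<in> hardy2 \<Longrightarrow> g \<in> hardy2 \<Longrightarrow> hardy_inner f g = (\<Sum>k. taylor_coeff f k * cnj (taylor_coeff g k))"
  using hardy_inner_hfun[of "taylor_coeff f" "taylor_coeff g"] by (simp add: taylor_coeff_ell2 hfun_taylor_coeff)

lemma hardy_inner_summable:
  "f \<in> hardy2 \<Longrightarrow> g \<in> hardy2 \<Longrightarrow> summable (\<lambda>k. taylor_coeff f k * cnj (taylor_coeff g k))"
  by (intro ell2_pairing(2) taylor_coeff_ell2)

lemma hardy2_outside: "f \<in> hardy2 \<Longrightarrow> z \<notin> ball 0 1 \<Longrightarrow> f z = 0"
  by (auto simp: hardy2_def)

lemma hardy2_cong_taylor: "f \<in> hardy2 \<Longrightarrow> g \<in> hardy2 \<Longrightarrow> taylor_coeff f = taylor_coeff g \<Longrightarrow> f = g"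
  by (metis hfun_taylor_coeff)

lemma ell2_add: "a \<in> ell2 \<Longrightarrow> b \<in> ell2 \<Longrightarrow> (\<lambda>k. a k + b k) \<in> ell2"
proof -
  assume a: "a \<in> ell2" and b: "b \<in> ell2"
  have le: "(cmod (a k + b k))\<^sup>2 \<le> 2 * (cmod (a k))\<^sup>2 + 2 * (cmod (b k))\<^sup>2" for k
    using Re_mult_cnj_le[of "a k" "b k"] cmod_diff_square[of "a k" "- b k"] by simp
  show ?thesis
    unfolding ell2_def mem_Collect_eq
    by (rule summable_comparison_test'[where g = "\<lambda>k. 2 * (cmod (a k))\<^sup>2 + 2 * (cmod (b k))\<^sup>2"])
       (use a b le in \<open>auto simp: ell2_def intro!: summable_add summable_mult\<close>)
qed

lemma ell2_scale: "a \<in> ell2 \<Longrightarrow> (\<lambda>k. c * a k) \<in> ell2"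
  by (auto simp: ell2_def norm_mult power_mult_distrib intro: summable_mult)

lemma hfun_add: "a \<in> ell2 \<Longrightarrow> b \<in> ell2 \<Longrightarrow> hfun (\<lambda>k. a k + b k) z = hfun a z + hfun b z"
  using sums_add[OF psum_sums[of a z] psum_sums[of b z]] psum_sums[OF ell2_add, of a b z]
  by (auto simp: hfun_def algebra_simps dest: sums_unique2)

lemma hfun_scale: "a \<in> ell2 \<Longrightarrow> hfun (\<lambda>k. c * a k) z = c * hfun a z"
  using sums_mult[OF psum_sums[of a z], of c] psum_sums[OF ell2_scale, of a z c]
  by (auto simp: hfun_def algebra_simps dest: sums_unique2)

lemma hardy2_add:
  assumes "f \<in> hardy2" "g \<in> hardy2"
  shows "(\<lambda>z. f z + g z) \<in> hardy2"
    and "taylor_coeff (\<lambda>z. f z + g z) = (\<lambda>k. taylor_coeff f k + taylor_coeff g k)"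
proof -
  have e: "hfun (\<lambda>k. taylor_coeff f k + taylor_coeff g k) = (\<lambda>z. f z + g z)"
    using assms by (simp add: fun_eq_iff hfun_add taylor_coeff_ell2 hfun_taylor_coeff)
  have l: "(\<lambda>k. taylor_coeff f k + taylor_coeff g k) \<in> ell2" using assms by (intro ell2_add taylor_coeff_ell2)
  show "(\<lambda>z. f z + g z) \<in> hardy2" using hfun_hardy2[OF l] by (simp add: e)
  show "taylor_coeff (\<lambda>z. f z + g z) = (\<lambda>k. taylor_coeff f k + taylor_coeff g k)"
    using taylor_coeff_hfun[OF l] by (simp add: e)
qed

lemma hardy2_scale:
  assumes "f \<in> hardy2"
  shows "(\<lambda>z. c * f z) \<in> hardy2" and "taylor_coeff (\<lambda>z. c * f z) = (\<lambda>k. c * taylor_coeff f k)"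
proof -
  have e: "hfun (\<lambda>k. c * taylor_coeff f k) = (\<lambda>z. c * f z)"
    using assms by (simp add: fun_eq_iff hfun_scale taylor_coeff_ell2 hfun_taylor_coeff)
  have l: "(\<lambda>k. c * taylor_coeff f k) \<in> ell2" using assms by (intro ell2_scale taylor_coeff_ell2)
  show "(\<lambda>z. c * f z) \<in> hardy2" using hfun_hardy2[OF l] by (simp add: e)
  show "taylor_coeff (\<lambda>z. c * f z) = (\<lambda>k. c * taylor_coeff f k)"
    using taylor_coeff_hfun[OF l] by (simp add: e)
qed

lemma hardy2_zero: "(\<lambda>z. 0) \<in> hardy2" and taylor_coeff_zero: "taylor_coeff (\<lambda>z. 0) = (\<lambda>k. 0)"
proof -
  have l: "(\<lambda>k. 0) \<in> ell2" by (simp add: ell2_def)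
  have e: "hfun (\<lambda>k. 0) = (\<lambda>z. 0)" by (simp add: fun_eq_iff hfun_def psum_def)
  show "(\<lambda>z. 0) \<in> hardy2" using hfun_hardy2[OF l] by (simp add: e)
  show "taylor_coeff (\<lambda>z. 0) = (\<lambda>k. 0)" using taylor_coeff_hfun[OF l] by (simp add: e)
qed

lemma hardy2_diff:
  assumes "f \<in> hardy2" "g \<in> hardy2"
  shows "(\<lambda>z. f z - g z) \<in> hardy2"
  using hardy2_add(1)[OF assms(1) hardy2_scale(1)[OF assms(2), of "-1"]] by simp

lemma hardy2_sum:
  assumes "finite I" "\<And>i. i \<in> I \<Longrightarrow> f i \<in> hardy2"
  shows "(\<lambda>z. \<Sum>i\<in>I. c i * f i z) \<in> hardy2"
  using assms by (induction I) (auto intro!: hardy2_zero hardy2_add hardy2_scale)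

lemma hardy_inner_commute: "f \<in> hardy2 \<Longrightarrow> g \<in> hardy2 \<Longrightarrow> hardy_inner g f = cnj (hardy_inner f g)"
  using bounded_linear.suminf[OF bounded_linear_cnj hardy_inner_summable[of f g]]
  by (simp add: hardy_inner_eq mult.commute)

lemma hardy_inner_add_left:
  "f \<in> hardy2 \<Longrightarrow> g \<in> hardy2 \<Longrightarrow> h \<in> hardy2 \<Longrightarrow> hardy_inner (\<lambda>z. f z + g z) h = hardy_inner f h + hardy_inner g h"
  by (simp add: hardy_inner_eq hardy2_add suminf_add[OF hardy_inner_summable hardy_inner_summable] algebra_simps)

lemma hardy_inner_scale_left:
  "f \<in> hardy2 \<Longrightarrow> h \<in> hardy2 \<Longrightarrow> hardy_inner (\<lambda>z. c * f z) h = c * hardy_inner f h"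
  by (simp add: hardy_inner_eq hardy2_scale suminf_mult[OF hardy_inner_summable] mult.assoc)

lemma hardy_inner_add_right:
  "f \<in> hardy2 \<Longrightarrow> g \<in> hardy2 \<Longrightarrow> h \<in> hardy2 \<Longrightarrow> hardy_inner h (\<lambda>z. f z + g z) = hardy_inner h f + hardy_inner h g"
  by (simp add: hardy_inner_commute[of _ h] hardy_inner_add_left hardy2_add)

lemma hardy_inner_scale_right:
  "f \<in> hardy2 \<Longrightarrow> h \<in> hardy2 \<Longrightarrow> hardy_inner h (\<lambda>z. c * f z) = cnj c * hardy_inner h f"
  by (simp add: hardy_inner_commute[of _ h] hardy_inner_scale_left hardy2_scale)

lemma hardy_inner_diff_left:
  "f \<in> hardy2 \<Longrightarrow> g \<in> hardy2 \<Longrightarrow> h \<in> hardy2 \<Longrightarrow> hardy_inner (\<lambda>z. f z - g z) h = hardy_inner f h - hardy_inner g h"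
  using hardy_inner_add_left[OF _ hardy2_scale(1)[of g "-1"], of f h] hardy_inner_scale_left[of g h "-1"] by simp

lemma hardy_inner_diff_right:
  "f \<in> hardy2 \<Longrightarrow> g \<in> hardy2 \<Longrightarrow> h \<in> hardy2 \<Longrightarrow> hardy_inner h (\<lambda>z. f z - g z) = hardy_inner h f - hardy_inner h g"
  by (simp add: hardy_inner_commute[of _ h] hardy_inner_diff_left hardy2_diff)

lemma hardy_inner_zero_left: "h \<in> hardy2 \<Longrightarrow> hardy_inner (\<lambda>z. 0) h = 0"
  by (simp add: hardy_inner_eq hardy2_zero taylor_coeff_zero)

lemma hardy_inner_sum_left:
  assumes "finite I" "\<And>i. i \<in> I \<Longrightarrow> f i \<in> hardy2" "h \<in> hardy2"
  shows "hardy_inner (\<lambda>z. \<Sum>i\<in>I. c i * f i z) h = (\<Sum>i\<in>I. c i * hardy_inner (f i) h)"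
  using assms
  by (induction I)
     (auto simp: hardy_inner_zero_left hardy_inner_add_left hardy_inner_scale_left hardy2_scale hardy2_sum)

lemma hardy_inner_self:
  assumes f: "f \<in> hardy2"
  shows "hardy_inner f f = of_real (ell2_sq (taylor_coeff f))"
proof -
  have "(\<lambda>k. of_real ((cmod (taylor_coeff f k))\<^sup>2) :: complex) sums of_real (ell2_sq (taylor_coeff f))"
    using taylor_coeff_ell2[OF f] unfolding sums_of_real_iff ell2_sq_def ell2_def by (auto intro: summable_sums)
  then show ?thesis unfolding hardy_inner_eq[OF f f] by (simp add: sums_iff flip: complex_norm_square)
qed

lemma hardy_norm_eq: "f \<in> hardy2 \<Longrightarrow> hardy_norm f = sqrt (ell2_sq (taylor_coeff f))"
  by (simp add: hardy_norm_def hardy_inner_self)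

lemma hardy_norm_nonneg: "f \<in> hardy2 \<Longrightarrow> 0 \<le> hardy_norm f"
  by (simp add: hardy_norm_eq ell2_sq_nonneg taylor_coeff_ell2)

lemma hardy_norm_square: "f \<in> hardy2 \<Longrightarrow> (hardy_norm f)\<^sup>2 = Re (hardy_inner f f)"
  by (simp add: hardy_norm_eq hardy_inner_self ell2_sq_nonneg taylor_coeff_ell2)

lemma hardy_inner_self_norm: "f \<in> hardy2 \<Longrightarrow> hardy_inner f f = of_real ((hardy_norm f)\<^sup>2)"
  by (simp add: hardy_norm_eq hardy_inner_self ell2_sq_nonneg taylor_coeff_ell2)

lemma hardy_norm_eq_0:
  assumes f: "f \<in> hardy2" and 0: "hardy_norm f = 0"
  shows "f = (\<lambda>z. 0)"
proof (rule hardy2_cong_taylor[OF f hardy2_zero], rule ext)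
  fix k show "taylor_coeff f k = taylor_coeff (\<lambda>z. 0) k"
    using ell2_bound[OF taylor_coeff_ell2[OF f], of k] 0 by (simp add: hardy_norm_eq[OF f] taylor_coeff_zero)
qed

lemma hardy_inner_self_eq_0: "f \<in> hardy2 \<Longrightarrow> hardy_inner f f = 0 \<Longrightarrow> f = (\<lambda>z. 0)"
  by (rule hardy_norm_eq_0) (auto simp: hardy_norm_def)

lemma hardy_norm_scale: "f \<in> hardy2 \<Longrightarrow> hardy_norm (\<lambda>z. c * f z) = cmod c * hardy_norm f"
proof -
  assume f: "f \<in> hardy2"
  have "ell2_sq (\<lambda>k. c * taylor_coeff f k) = (cmod c)\<^sup>2 * ell2_sq (taylor_coeff f)"
    using taylor_coeff_ell2[OF f] unfolding ell2_sq_def ell2_def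
    by (simp add: norm_mult power_mult_distrib suminf_mult)
  then show ?thesis using f by (simp add: hardy_norm_eq hardy2_scale real_sqrt_mult)
qed

lemma hardy_cauchy_schwarz:
  assumes f: "f \<in> hardy2" and g: "g \<in> hardy2"
  shows "cmod (hardy_inner f g) \<le> hardy_norm f * hardy_norm g"
proof (cases "hardy_norm f = 0 \<or> hardy_norm g = 0")
  case True
  then have "hardy_inner f g = 0"
    using hardy_norm_eq_0 f g hardy_inner_zero_left hardy_inner_commute by (metis complex_cnj_zero)
  then show ?thesis using hardy_norm_nonneg f g by simp
next
  case False
  define x y where "x = hardy_norm f" and "y = hardy_norm g"
  have xy: "0 < x" "0 < y" using False hardy_norm_nonneg f g by (auto simp: x_def y_def less_le)
  have sq: "ell2_sq (taylor_coeff f) = x\<^sup>2" "ell2_sq (taylor_coeff g) = y\<^sup>2"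
    using f g by (simp_all add: x_def y_def hardy_norm_eq ell2_sq_nonneg taylor_coeff_ell2)
  have "cmod (hardy_inner f g) \<le> (y / x * x\<^sup>2 + y\<^sup>2 / (y / x)) / 2"
    unfolding hardy_inner_eq[OF f g] sq[symmetric]
    by (rule ell2_pairing(3)[OF taylor_coeff_ell2[OF f] taylor_coeff_ell2[OF g]]) (use xy in simp)
  also have "\<dots> = x * y" using xy by (simp add: power2_eq_square field_simps)
  finally show ?thesis by (simp add: x_def y_def)
qed

lemma hardy_norm_triangle:
  assumes f: "f \<in> hardy2" and g: "g \<in> hardy2"
  shows "hardy_norm (\<lambda>z. f z + g z) \<le> hardy_norm f + hardy_norm g"
proof (rule power2_le_imp_le)
  have "Re (hardy_inner f g) \<le> hardy_norm f * hardy_norm g"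
    using hardy_cauchy_schwarz[OF f g] complex_Re_le_cmod order_trans by blast
  then show "(hardy_norm (\<lambda>z. f z + g z))\<^sup>2 \<le> (hardy_norm f + hardy_norm g)\<^sup>2"
    using f g hardy_inner_commute[OF f g]
    by (simp add: hardy_norm_square hardy2_add hardy_inner_add_left hardy_inner_add_right power2_sum)
qed (use hardy_norm_nonneg f g in auto)

lemma hardy_norm_sum:
  assumes "finite I" "\<And>i. i \<in> I \<Longrightarrow> f i \<in> hardy2"
  shows "hardy_norm (\<lambda>z. \<Sum>i\<in>I. c i * f i z) \<le> (\<Sum>i\<in>I. cmod (c i) * hardy_norm (f i))"
  using assms
proof (induction I)
  case empty
  then show ?case by (simp add: hardy_norm_def hardy_inner_zero_left hardy2_zero)
next
  case (insert i I)
  have "hardy_norm (\<lambda>z. c i * f i z + (\<Sum>i\<in>I. c i * f i z)) \<le>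
      hardy_norm (\<lambda>z. c i * f i z) + hardy_norm (\<lambda>z. \<Sum>i\<in>I. c i * f i z)"
    by (intro hardy_norm_triangle hardy2_scale hardy2_sum) (use insert in auto)
  then show ?case using insert by (simp add: hardy_norm_scale)
qed

definition shift :: "(nat \<Rightarrow> complex) \<Rightarrow> nat \<Rightarrow> complex" where
  "shift a k = (case k of 0 \<Rightarrow> 0 | Suc j \<Rightarrow> a j)"

lemma shift_ell2: "a \<in> ell2 \<Longrightarrow> shift a \<in> ell2"
  unfolding ell2_def mem_Collect_eq by (subst summable_Suc_iff[symmetric]) (simp add: shift_def)

lemma hfun_shift:
  assumes a: "a \<in> ell2"
  shows "hfun (shift a) z = z * hfun a z"
proof (cases "z \<in> ball 0 1")
  case True
  then have z: "cmod z < 1" by simp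
  have "(\<lambda>k. shift a (Suc k) * z ^ Suc k) sums (z * psum a z)"
    using sums_mult[OF psum_sums[OF a z], of z] by (simp add: shift_def mult_ac)
  then have "(\<lambda>k. shift a k * z ^ k) sums (z * psum a z + shift a 0 * z ^ 0)" by (subst (asm) sums_Suc_iff) simp
  then show ?thesis using True by (simp add: hfun_def psum_def sums_iff shift_def)
qed (simp add: hfun_def)

lemma hardy2_times_z:
  assumes f: "f \<in> hardy2"
  shows "(\<lambda>z. z * f z) \<in> hardy2" and "taylor_coeff (\<lambda>z. z * f z) = shift (taylor_coeff f)"
proof -
  have l: "shift (taylor_coeff f) \<in> ell2" using f by (intro shift_ell2 taylor_coeff_ell2)
  have e: "hfun (shift (taylor_coeff f)) = (\<lambda>z. z * f z)"
    using f by (simp add: fun_eq_iff hfun_shift taylor_coeff_ell2 hfun_taylor_coeff)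
  show "(\<lambda>z. z * f z) \<in> hardy2" using hfun_hardy2[OF l] by (simp add: e)
  show "taylor_coeff (\<lambda>z. z * f z) = shift (taylor_coeff f)" using taylor_coeff_hfun[OF l] by (simp add: e)
qed

text \<open>The backward shift \<open>f \<mapsto> (f - f 0) / z\<close>.\<close>

definition bshift :: "(complex \<Rightarrow> complex) \<Rightarrow> complex \<Rightarrow> complex" where
  "bshift f = hfun (\<lambda>k. taylor_coeff f (Suc k))"

lemma bshift:
  assumes f: "f \<in> hardy2"
  shows "bshift f \<in> hardy2" and "taylor_coeff (bshift f) = (\<lambda>k. taylor_coeff f (Suc k))"
proof -
  have l: "(\<lambda>k. taylor_coeff f (Suc k)) \<in> ell2"
    using taylor_coeff_ell2[OF f] unfolding ell2_def mem_Collect_eq by (subst summable_Suc_iff)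
  show "bshift f \<in> hardy2" "taylor_coeff (bshift f) = (\<lambda>k. taylor_coeff f (Suc k))"
    unfolding bshift_def using hfun_hardy2[OF l] taylor_coeff_hfun[OF l] by auto
qed

lemma hardy_inner_times_z:
  assumes f: "f \<in> hardy2" and g: "g \<in> hardy2"
  shows "hardy_inner (\<lambda>z. z * f z) g = hardy_inner f (bshift g)"
proof -
  have "(\<Sum>k. taylor_coeff (\<lambda>z. z * f z) (Suc k) * cnj (taylor_coeff g (Suc k))) = hardy_inner (\<lambda>z. z * f z) g"
    using suminf_split_head[OF hardy_inner_summable[OF hardy2_times_z(1)[OF f] g]] hardy_inner_eq[OF hardy2_times_z(1)[OF f] g]
    by (simp add: hardy2_times_z[OF f] shift_def)
  then show ?thesis using f g by (simp add: hardy_inner_eq bshift hardy2_times_z shift_def)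
qed

lemma hardy_inner_shift_isometric:
  assumes f: "f \<in> hardy2" and g: "g \<in> hardy2"
  shows "hardy_inner (\<lambda>z. z * f z) (\<lambda>z. z * g z) = hardy_inner f g"
proof -
  have "bshift (\<lambda>z. z * g z) = g"
    by (rule hardy2_cong_taylor) (use g in \<open>auto simp: bshift hardy2_times_z shift_def\<close>)
  then show ?thesis using hardy_inner_times_z[OF f hardy2_times_z(1)[OF g]] by simp
qed

section \<open>Reproducing kernels, division and Blaschke factors\<close>

definition szego :: "complex \<Rightarrow> complex \<Rightarrow> complex" where
  "szego \<mu> z = (if z \<in> ball 0 1 then 1 / (1 - cnj \<mu> * z) else 0)"

lemma one_minus_nonzero: "cmod \<mu> < 1 \<Longrightarrow> z \<in> ball 0 1 \<Longrightarrow> 1 - cnj \<mu> * z \<noteq> 0"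
proof
  assume "cmod \<mu> < 1" "z \<in> ball 0 1" "1 - cnj \<mu> * z = 0"
  then have "cmod (cnj \<mu> * z) < 1 * 1" unfolding norm_mult by (intro mult_strict_mono') auto
  moreover have "cnj \<mu> * z = 1" using \<open>1 - cnj \<mu> * z = 0\<close> by simp
  ultimately show False by simp
qed

lemma szego:
  assumes \<mu>: "cmod \<mu> < 1"
  shows "szego \<mu> \<in> hardy2" and "taylor_coeff (szego \<mu>) = (\<lambda>k. cnj \<mu> ^ k)"
proof -
  have "summable (\<lambda>k. ((cmod \<mu>)\<^sup>2) ^ k)" using \<mu> by (intro summable_geometric) (simp add: power_less_one_iff abs_square_less_1)
  then have l: "(\<lambda>k. cnj \<mu> ^ k) \<in> ell2" by (simp add: ell2_def norm_power flip: power_mult) (simp add: mult.commute)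
  have "hfun (\<lambda>k. cnj \<mu> ^ k) = szego \<mu>"
  proof
    fix z
    have "cmod (cnj \<mu> * z) < 1" if "z \<in> ball 0 1"
      using mult_strict_mono'[OF \<mu>, of "cmod z" 1] that by (simp add: norm_mult)
    then show "hfun (\<lambda>k. cnj \<mu> ^ k) z = szego \<mu> z"
      using suminf_geometric[of "cnj \<mu> * z"] by (auto simp: hfun_def psum_def szego_def simp flip: power_mult_distrib)
  qed
  then show "szego \<mu> \<in> hardy2" "taylor_coeff (szego \<mu>) = (\<lambda>k. cnj \<mu> ^ k)"
    using hfun_hardy2[OF l] taylor_coeff_hfun[OF l] by auto
qed

lemma hardy_inner_szego:
  assumes f: "f \<in> hardy2" and \<mu>: "cmod \<mu> < 1"
  shows "hardy_inner f (szego \<mu>) = f \<mu>"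
proof -
  have "f \<mu> = hfun (taylor_coeff f) \<mu>" using f by (simp add: hfun_taylor_coeff)
  then show ?thesis using \<mu> by (simp add: hardy_inner_eq[OF f szego(1)[OF \<mu>]] szego(2)[OF \<mu>] hfun_def psum_def)
qed

text \<open>Convexity of the square at \<open>t x + (1 - t) (y / (1 - t))\<close>. It turns a recursion \<open>c\<^sub>k\<^sub>+\<^sub>1 = \<nu>
  c\<^sub>k + a\<^sub>k\<^sub>+\<^sub>1\<close> with \<open>\<bar>\<nu>\<bar> < 1\<close> into an estimate of partial sums that can be solved.\<close>

lemma convex_square_le: "(t * x + y)\<^sup>2 \<le> t * x\<^sup>2 + y\<^sup>2 / (1 - t)" if "0 \<le> t" "t < 1" for t x y :: real
proof -
  have "t * x\<^sup>2 + y\<^sup>2 / (1 - t) - (t * x + y)\<^sup>2 = t / (1 - t) * ((1 - t) * x - y)\<^sup>2"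
    using that by (simp add: power2_eq_square divide_simps) (simp add: algebra_simps)
  moreover have "0 \<le> t / (1 - t) * ((1 - t) * x - y)\<^sup>2" using that by simp
  ultimately show ?thesis by linarith
qed

lemma cmod_square_recursion_le:
  assumes t: "cmod \<nu> < 1"
  shows "(cmod (\<nu> * x + y))\<^sup>2 \<le> cmod \<nu> * (cmod x)\<^sup>2 + (cmod y)\<^sup>2 / (1 - cmod \<nu>)"
proof -
  have "cmod (\<nu> * x + y) \<le> cmod \<nu> * cmod x + cmod y" by (metis norm_mult norm_triangle_ineq)
  then have "(cmod (\<nu> * x + y))\<^sup>2 \<le> (cmod \<nu> * cmod x + cmod y)\<^sup>2" by (rule power_mono) simp
  also have "\<dots> \<le> cmod \<nu> * (cmod x)\<^sup>2 + (cmod y)\<^sup>2 / (1 - cmod \<nu>)" by (rule convex_square_le) (use t in auto)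
  finally show ?thesis .
qed

lemma ell2_partial_sum_le: "a \<in> ell2 \<Longrightarrow> (\<Sum>k<n. (cmod (a k))\<^sup>2) \<le> ell2_sq a"
  unfolding ell2_sq_def by (rule sum_le_suminf) (auto simp: ell2_def)

lemma ell2I: "(\<And>n. (\<Sum>k<Suc n. (cmod (a k))\<^sup>2) \<le> M) \<Longrightarrow> a \<in> ell2"
  unfolding ell2_def mem_Collect_eq
  by (rule bounded_imp_summable[of _ M]) (auto simp flip: lessThan_Suc_atMost)

text \<open>The coefficients \<open>c\<close> of the quotient satisfy \<open>c\<^sub>n\<^sub>+\<^sub>1 = cnj \<mu> c\<^sub>n + a\<^sub>n\<^sub>+\<^sub>1\<close>, so their
  partial sums of squares are bounded by a multiple of themselves with factor \<open>\<bar>\<mu>\<bar> < 1\<close> plus a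
  constant.\<close>

lemma hardy2_divide_kernel:
  assumes f: "f \<in> hardy2" and \<mu>: "cmod \<mu> < 1"
  shows "(\<lambda>z. f z / (1 - cnj \<mu> * z)) \<in> hardy2"
proof -
  define a where "a = taylor_coeff f"
  have a: "a \<in> ell2" using f by (simp add: a_def taylor_coeff_ell2)
  define \<nu> where "\<nu> = cnj \<mu>"
  have \<nu>: "cmod \<nu> < 1" using \<mu> by (simp add: \<nu>_def)
  define t where "t = cmod \<nu>"
  have t: "0 \<le> t" "t < 1" using \<nu> by (auto simp: t_def)
  define c where "c = rec_nat (a 0) (\<lambda>n x. \<nu> * x + a (Suc n))"
  have c: "c 0 = a 0" "c (Suc n) = \<nu> * c n + a (Suc n)" for n by (simp_all add: c_def)
  have "c \<in> ell2"
  proof (rule ell2I)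
    fix n
    have "(\<Sum>k<Suc n. (cmod (c k))\<^sup>2) \<le> t * (\<Sum>k<n. (cmod (c k))\<^sup>2) + (\<Sum>k<Suc n. (cmod (a k))\<^sup>2) / (1 - t)"
    proof (induction n)
      case 0
      show ?case using t mult_right_mono[of "1 - t" 1 "(cmod (a 0))\<^sup>2"] by (simp add: c field_simps)
    next
      case (Suc n)
      have "(cmod (c (Suc n)))\<^sup>2 \<le> t * (cmod (c n))\<^sup>2 + (cmod (a (Suc n)))\<^sup>2 / (1 - t)"
        unfolding c t_def by (rule cmod_square_recursion_le[OF \<nu>])
      then show ?case using Suc by (simp add: algebra_simps add_divide_distrib)
    qed
    also have "\<dots> \<le> t * (\<Sum>k<Suc n. (cmod (c k))\<^sup>2) + ell2_sq a / (1 - t)"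
      using t ell2_partial_sum_le[OF a, of "Suc n"] by (intro add_mono mult_left_mono divide_right_mono) auto
    finally show "(\<Sum>k<Suc n. (cmod (c k))\<^sup>2) \<le> ell2_sq a / (1 - t) / (1 - t)"
      using t by (subst pos_le_divide_eq) (auto simp: algebra_simps)
  qed
  have sc: "(\<lambda>k. - \<nu> * shift c k) \<in> ell2" using \<open>c \<in> ell2\<close> by (intro ell2_scale shift_ell2)
  have "(\<lambda>k. c k + - \<nu> * shift c k) = a" by (auto simp: fun_eq_iff shift_def c split: nat.split)
  then have "hfun a z = hfun c z + - \<nu> * (z * hfun c z)" for z
    using hfun_add[OF \<open>c \<in> ell2\<close> sc, of z] hfun_scale[OF shift_ell2[OF \<open>c \<in> ell2\<close>], of "- \<nu>" z] hfun_shift[OF \<open>c \<in> ell2\<close>, of z]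
    by simp
  then have "f z = (1 - cnj \<mu> * z) * hfun c z" for z
    using hfun_taylor_coeff[OF f] by (simp add: a_def \<nu>_def algebra_simps)
  then have "f z / (1 - cnj \<mu> * z) = hfun c z" for z
    using one_minus_nonzero[OF \<mu>, of z] hardy2_outside[OF hfun_hardy2[OF \<open>c \<in> ell2\<close>], of z] by (cases "z \<in> ball 0 1") auto
  then show ?thesis using hfun_hardy2[OF \<open>c \<in> ell2\<close>] by simp
qed

text \<open>The coefficients \<open>q\<close> of the quotient satisfy the backward recursion \<open>q\<^sub>n = \<mu> q\<^sub>n\<^sub>+\<^sub>1 +
  a\<^sub>n\<^sub>+\<^sub>1\<close>; the root condition is what makes the constant term \<open>- \<mu> q\<^sub>0\<close> equal to \<open>a\<^sub>0\<close>.\<close>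

lemma hardy2_divide_root:
  assumes f: "f \<in> hardy2" and \<mu>: "cmod \<mu> < 1" and root: "f \<mu> = 0"
  obtains q where "q \<in> hardy2" "f = (\<lambda>z. (z - \<mu>) * q z)"
proof -
  define a where "a = taylor_coeff f"
  have a: "a \<in> ell2" using f by (simp add: a_def taylor_coeff_ell2)
  define t where "t = cmod \<mu>"
  have t: "0 \<le> t" "t < 1" using \<mu> by (auto simp: t_def)
  define q where "q n = (\<Sum>j. a (Suc n + j) * \<mu> ^ j)" for n
  have s: "summable (\<lambda>j. a (n + j) * \<mu> ^ j)" for n
    by (rule summable_norm_bounded_power(2)[where a = "\<lambda>j. a (n + j)", OF ell2_bound[OF a] \<mu>])
  have split: "(\<Sum>j. a (n + j) * \<mu> ^ j) = a n + \<mu> * q n" for n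
  proof -
    have "(\<Sum>j. a (n + j) * \<mu> ^ j) = a n + (\<Sum>j. a (n + Suc j) * \<mu> ^ Suc j)"
      using suminf_split_head[OF s[of n]] by simp
    also have "(\<Sum>j. a (n + Suc j) * \<mu> ^ Suc j) = \<mu> * q n"
      unfolding q_def using suminf_mult[OF s[of "Suc n"], of \<mu>] by (simp add: mult_ac)
    finally show ?thesis .
  qed
  have q: "q n = \<mu> * q (Suc n) + a (Suc n)" for n
    using split[of "Suc n"] by (simp add: q_def)
  have root': "a 0 + \<mu> * q 0 = 0"
  proof -
    have "f \<mu> = (\<Sum>j. a j * \<mu> ^ j)"
      using arg_cong[OF hfun_taylor_coeff[OF f], of "\<lambda>g. g \<mu>"] \<mu> by (simp add: a_def hfun_def psum_def)
    then show ?thesis using split[of 0] root by simp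
  qed
  define C where "C = (sqrt (ell2_sq a) / (1 - t))\<^sup>2"
  have qb: "(cmod (q n))\<^sup>2 \<le> C" for n
    unfolding C_def q_def
    by (intro power_mono power_series_bound[where a = "\<lambda>j. a (Suc n + j)"] ell2_bound[OF a]) (use \<mu> in \<open>auto simp: t_def\<close>)
  have "q \<in> ell2"
  proof (rule ell2I)
    fix n
    have "(\<Sum>k<Suc n. (cmod (q k))\<^sup>2) \<le> (\<Sum>k<Suc n. t * (cmod (q (Suc k)))\<^sup>2 + (cmod (a (Suc k)))\<^sup>2 / (1 - t))"
      by (rule sum_mono, subst q) (unfold t_def, rule cmod_square_recursion_le[OF \<mu>])
    also have "\<dots> = t * (\<Sum>k<Suc n. (cmod (q (Suc k)))\<^sup>2) + (\<Sum>k<Suc n. (cmod (a (Suc k)))\<^sup>2) / (1 - t)"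
      by (simp only: sum.distrib sum_distrib_left sum_divide_distrib)
    also have "\<dots> \<le> t * ((\<Sum>k<Suc n. (cmod (q k))\<^sup>2) + C) + ell2_sq a / (1 - t)"
    proof (intro add_mono mult_left_mono divide_right_mono)
      have "(\<Sum>k<Suc n. (cmod (q (Suc k)))\<^sup>2) \<le> (\<Sum>k<Suc (Suc n). (cmod (q k))\<^sup>2)"
        by (subst (2) sum.lessThan_Suc_shift) simp
      also have "\<dots> \<le> (\<Sum>k<Suc n. (cmod (q k))\<^sup>2) + C"
        using qb[of "Suc n"] by simp
      finally show "(\<Sum>k<Suc n. (cmod (q (Suc k)))\<^sup>2) \<le> (\<Sum>k<Suc n. (cmod (q k))\<^sup>2) + C" .
      have "(\<Sum>k<Suc n. (cmod (a (Suc k)))\<^sup>2) \<le> (\<Sum>k<Suc (Suc n). (cmod (a k))\<^sup>2)"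
        by (subst (2) sum.lessThan_Suc_shift) simp
      also have "\<dots> \<le> ell2_sq a" by (rule ell2_partial_sum_le[OF a])
      finally show "(\<Sum>k<Suc n. (cmod (a (Suc k)))\<^sup>2) \<le> ell2_sq a" .
    qed (use t in auto)
    finally show "(\<Sum>k<Suc n. (cmod (q k))\<^sup>2) \<le> (t * C + ell2_sq a / (1 - t)) / (1 - t)"
      using t by (subst pos_le_divide_eq) (auto simp: algebra_simps)
  qed
  have "(\<lambda>k. shift q k + - \<mu> * q k) = a"
  proof
    fix k show "shift q k + - \<mu> * q k = a k"
      using root' q[of "k - 1"] by (cases k) (auto simp: shift_def algebra_simps add_eq_0_iff2)
  qed
  then have "hfun a z = z * hfun q z + - \<mu> * hfun q z" for z
    using hfun_add[OF shift_ell2[OF \<open>q \<in> ell2\<close>] ell2_scale[OF \<open>q \<in> ell2\<close>], of "- \<mu>" z]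
      hfun_scale[OF \<open>q \<in> ell2\<close>, of "- \<mu>" z] hfun_shift[OF \<open>q \<in> ell2\<close>, of z]
    by simp
  then have "f = (\<lambda>z. (z - \<mu>) * hfun q z)"
    using hfun_taylor_coeff[OF f] by (auto simp: a_def fun_eq_iff algebra_simps)
  then show thesis using that hfun_hardy2[OF \<open>q \<in> ell2\<close>] by blast
qed

definition blaschke_factor :: "complex \<Rightarrow> complex \<Rightarrow> complex" where
  "blaschke_factor \<mu> z = (z - \<mu>) / (1 - cnj \<mu> * z)"

lemma hardy2_linear_factor: "f \<in> hardy2 \<Longrightarrow> (\<lambda>z. (z - \<mu>) * f z) \<in> hardy2"
  using hardy2_diff[OF hardy2_times_z(1) hardy2_scale(1)] by (simp add: algebra_simps)

lemma hardy2_kernel_factor: "f \<in> hardy2 \<Longrightarrow> (\<lambda>z. (1 - \<mu> * z) * f z) \<in> hardy2"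
  using hardy2_diff[OF _ hardy2_scale(1)[OF hardy2_times_z(1)], of f f \<mu>] by (simp add: left_diff_distrib mult.assoc)

lemma blaschke_factor_alt:
  "blaschke_factor \<mu> z * f z = (z - \<mu>) * (f z / (1 - cnj \<mu> * z))"
  by (simp add: blaschke_factor_def)

lemma hardy2_blaschke_factor:
  "f \<in> hardy2 \<Longrightarrow> cmod \<mu> < 1 \<Longrightarrow> (\<lambda>z. blaschke_factor \<mu> z * f z) \<in> hardy2"
  unfolding blaschke_factor_alt by (intro hardy2_linear_factor hardy2_divide_kernel)

text \<open>With \<open>f = (1 - cnj \<mu> z) F\<close> and \<open>g = (1 - cnj \<mu> z) G\<close> both sides expand to the same
  combination of \<open>\<langle>F, G\<rangle>\<close>, \<open>\<langle>z F, G\<rangle>\<close> and \<open>\<langle>F, z G\<rangle>\<close>, because the shift is isometric.\<close>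

lemma blaschke_factor_isometric:
  assumes f: "f \<in> hardy2" and g: "g \<in> hardy2" and \<mu>: "cmod \<mu> < 1"
  shows "hardy_inner (\<lambda>z. blaschke_factor \<mu> z * f z) (\<lambda>z. blaschke_factor \<mu> z * g z) = hardy_inner f g"
proof -
  define F G where "F z = f z / (1 - cnj \<mu> * z)" and "G z = g z / (1 - cnj \<mu> * z)" for z
  have FG: "F \<in> hardy2" "G \<in> hardy2" unfolding F_def G_def using hardy2_divide_kernel f g \<mu> by auto
  have fF: "f = (\<lambda>z. F z - cnj \<mu> * (z * F z))" "g = (\<lambda>z. G z - cnj \<mu> * (z * G z))"
    using one_minus_nonzero[OF \<mu>] hardy2_outside[OF f] hardy2_outside[OF g]
    by (auto simp: F_def G_def fun_eq_iff divide_simps) (auto simp: algebra_simps)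
  have bF: "(\<lambda>z. blaschke_factor \<mu> z * f z) = (\<lambda>z. z * F z - \<mu> * F z)" "(\<lambda>z. blaschke_factor \<mu> z * g z) = (\<lambda>z. z * G z - \<mu> * G z)"
    unfolding blaschke_factor_alt by (auto simp: F_def G_def left_diff_distrib diff_divide_distrib)
  have h: "(\<lambda>z. z * F z) \<in> hardy2" "(\<lambda>z. z * G z) \<in> hardy2" using FG by (auto intro: hardy2_times_z)
  have h2: "(\<lambda>z. cnj \<mu> * (z * F z)) \<in> hardy2" "(\<lambda>z. cnj \<mu> * (z * G z)) \<in> hardy2" "(\<lambda>z. \<mu> * F z) \<in> hardy2" "(\<lambda>z. \<mu> * G z) \<in> hardy2"
    using FG h by (auto intro: hardy2_scale)
  have h3: "(\<lambda>z. F z - cnj \<mu> * (z * F z)) \<in> hardy2" "(\<lambda>z. G z - cnj \<mu> * (z * G z)) \<in> hardy2"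
    "(\<lambda>z. z * F z - \<mu> * F z) \<in> hardy2" "(\<lambda>z. z * G z - \<mu> * G z) \<in> hardy2"
    using FG h h2 by (auto intro: hardy2_diff)
  show ?thesis unfolding bF unfolding fF
    using FG h h2 h3
    by (simp add: hardy_inner_diff_left hardy_inner_diff_right hardy_inner_scale_left hardy_inner_scale_right
        hardy_inner_shift_isometric)
qed

lemma hardy2_divide_blaschke_factor:
  assumes f: "f \<in> hardy2" and \<mu>: "cmod \<mu> < 1" and root: "f \<mu> = 0"
  obtains g where "g \<in> hardy2" "f = (\<lambda>z. blaschke_factor \<mu> z * g z)"
proof -
  obtain q where q: "q \<in> hardy2" "f = (\<lambda>z. (z - \<mu>) * q z)" using hardy2_divide_root[OF assms] .
  show thesis
  proof (rule that[OF hardy2_kernel_factor[OF q(1), of "cnj \<mu>"]])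
    show "f = (\<lambda>z. blaschke_factor \<mu> z * ((1 - cnj \<mu> * z) * q z))"
      using one_minus_nonzero[OF \<mu>] hardy2_outside[OF q(1)] by (auto simp: q(2) fun_eq_iff blaschke_factor_def)
  qed
qed

section \<open>The model space and the Malmquist-Walsh basis\<close>

lemma blaschke_eq: "blaschke lam n z = (\<Prod>i\<in>{1..n}. blaschke_factor (lam i) z)"
  by (simp add: blaschke_def blaschke_factor_def)

locale blaschke_zeros =
  fixes lam :: "nat \<Rightarrow> complex" and N :: nat
  assumes zeros: "\<And>i. i \<in> {1..N} \<Longrightarrow> cmod (lam i) < 1"
begin

abbreviation K :: "(complex \<Rightarrow> complex) set" where "K \<equiv> model_space (blaschke lam N)"

abbreviation shifted where "shifted \<equiv> model_shifted (blaschke lam N)"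

abbreviation resolvent where "resolvent \<equiv> model_resolvent (blaschke lam N)"

definition s :: "nat \<Rightarrow> complex" where "s i = of_real (sqrt (1 - (cmod (lam i))\<^sup>2))"

abbreviation e :: "nat \<Rightarrow> complex \<Rightarrow> complex" where "e \<equiv> mw_basis lam"

lemma s_square: "i \<in> {1..N} \<Longrightarrow> s i * s i = 1 - lam i * cnj (lam i)"
proof -
  assume "i \<in> {1..N}"
  then have "(cmod (lam i))\<^sup>2 \<le> 1" using zeros[of i] by (simp add: abs_square_le_1)
  then have "s i * s i = of_real (1 - (cmod (lam i))\<^sup>2)" unfolding s_def of_real_mult[symmetric] by simp
  then show ?thesis by (simp flip: complex_norm_square)
qed

lemma s_nonzero: "i \<in> {1..N} \<Longrightarrow> s i \<noteq> 0"
  using zeros[of i] by (simp add: s_def abs_square_eq_1 less_le flip: power2_eq_1_iff)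

lemma cnj_s: "cnj (s i) = s i" by (simp add: s_def)

lemma hardy2_prod_blaschke:
  assumes "finite I" "I \<subseteq> {1..N}" "f \<in> hardy2"
  shows "(\<lambda>z. (\<Prod>i\<in>I. blaschke_factor (lam i) z) * f z) \<in> hardy2"
  using assms
proof (induction I)
  case (insert i I)
  have "(\<lambda>z. blaschke_factor (lam i) z * ((\<Prod>i\<in>I. blaschke_factor (lam i) z) * f z)) \<in> hardy2"
    by (rule hardy2_blaschke_factor) (use insert zeros in auto)
  then show ?case using insert by (simp add: mult.assoc)
qed simp

lemma hardy2_blaschke: "n \<le> N \<Longrightarrow> f \<in> hardy2 \<Longrightarrow> (\<lambda>z. blaschke lam n z * f z) \<in> hardy2"
  unfolding blaschke_eq by (rule hardy2_prod_blaschke) auto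

lemma blaschke_Suc: "blaschke lam (Suc n) z = blaschke lam n z * blaschke_factor (lam (Suc n)) z"
  by (simp add: blaschke_eq)

lemma blaschke_0: "blaschke lam 0 z = 1" by (simp add: blaschke_eq)

lemma blaschke_isometric:
  assumes "n \<le> N" "f \<in> hardy2" "g \<in> hardy2"
  shows "hardy_inner (\<lambda>z. blaschke lam n z * f z) (\<lambda>z. blaschke lam n z * g z) = hardy_inner f g"
  using assms
proof (induction n arbitrary: f g)
  case (Suc n)
  have l: "cmod (lam (Suc n)) < 1" using Suc zeros by auto
  have "hardy_inner (\<lambda>z. blaschke lam n z * (blaschke_factor (lam (Suc n)) z * f z))
      (\<lambda>z. blaschke lam n z * (blaschke_factor (lam (Suc n)) z * g z)) =
     hardy_inner (\<lambda>z. blaschke_factor (lam (Suc n)) z * f z) (\<lambda>z. blaschke_factor (lam (Suc n)) z * g z)"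
    using Suc l by (intro Suc.IH hardy2_blaschke_factor) auto
  then show ?case using Suc l by (simp add: blaschke_Suc mult.assoc blaschke_factor_isometric)
qed (simp add: blaschke_0)

lemma mw_basis_Suc: "e (Suc n) = (\<lambda>z. blaschke lam n z * (s (Suc n) * szego (lam (Suc n)) z))"
  by (auto simp: fun_eq_iff mw_basis_def blaschke_def s_def szego_def)

lemma mw_basis_hardy2: "i \<in> {1..N} \<Longrightarrow> e i \<in> hardy2"
  using hardy2_blaschke[OF _ hardy2_scale(1)[OF szego(1)]] zeros[of i]
  by (cases i) (auto simp: mw_basis_Suc)

text \<open>The Blaschke product is common to both arguments and drops out; what remains is a multiple
  of the reproducing kernel at \<open>lam (Suc n)\<close>. Orthogonality of distinct basis functions and
  their membership in the model space are the cases in which \<open>F\<close> vanishes there.\<close>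

lemma hardy_inner_mw_basis:
  assumes n: "n < N" and F: "F \<in> hardy2"
  shows "hardy_inner (\<lambda>z. blaschke lam n z * F z) (e (Suc n)) = s (Suc n) * F (lam (Suc n))"
proof -
  have l: "cmod (lam (Suc n)) < 1" using n zeros by auto
  have "hardy_inner (\<lambda>z. blaschke lam n z * F z) (e (Suc n)) = hardy_inner F (\<lambda>z. s (Suc n) * szego (lam (Suc n)) z)"
    unfolding mw_basis_Suc using n l F by (intro blaschke_isometric hardy2_scale szego) auto
  also have "\<dots> = s (Suc n) * F (lam (Suc n))"
    using F l by (simp add: hardy_inner_scale_right szego hardy_inner_szego cnj_s)
  finally show ?thesis .
qed

lemma hardy_inner_blaschke_mw_basis:
  assumes "j \<in> {1..m}" "m \<le> N" and F: "F \<in> hardy2"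
  shows "hardy_inner (\<lambda>z. blaschke lam m z * F z) (e j) = 0"
proof -
  obtain n where n: "j = Suc n" "n < m" "n < N" using assms by (cases j) auto
  define G where "G z = (\<Prod>i\<in>{Suc n..m}. blaschke_factor (lam i) z) * F z" for z
  have "G \<in> hardy2" unfolding G_def by (rule hardy2_prod_blaschke) (use assms n in auto)
  have "{1..m} = {1..n} \<union> {Suc n..m}" "{1..n} \<inter> {Suc n..m} = {}" using n by auto
  then have "blaschke lam m z = blaschke lam n z * (\<Prod>i\<in>{Suc n..m}. blaschke_factor (lam i) z)" for z
    unfolding blaschke_eq by (simp add: prod.union_disjoint)
  then have e: "(\<lambda>z. blaschke lam m z * F z) = (\<lambda>z. blaschke lam n z * G z)"
    by (simp add: G_def mult.assoc)
  have "(\<Prod>i\<in>{Suc n..m}. blaschke_factor (lam i) (lam (Suc n))) = 0"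
    by (rule prod_zero) (use n in \<open>auto simp: blaschke_factor_def intro!: bexI[of _ "Suc n"]\<close>)
  then have "G (lam (Suc n)) = 0" by (simp add: G_def)
  then show ?thesis using hardy_inner_mw_basis[OF n(3) \<open>G \<in> hardy2\<close>] by (simp add: e n(1))
qed

lemma mw_basis_orthonormal:
  assumes i: "i \<in> {1..N}" and j: "j \<in> {1..N}"
  shows "hardy_inner (e i) (e j) = (if i = j then 1 else 0)"
proof -
  have l: "(\<lambda>z. s i * szego (lam i) z) \<in> hardy2" if "i \<in> {1..N}" for i
    using that zeros by (intro hardy2_scale szego) auto
  have lt: "hardy_inner (e i) (e j) = 0" if ij: "i \<in> {1..N}" "j \<in> {1..N}" "j < i" for i j
  proof -
    obtain n where n: "i = Suc n" using ij by (cases i) auto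
    show ?thesis unfolding n mw_basis_Suc
      by (rule hardy_inner_blaschke_mw_basis) (use ij n l[of i] in auto)
  qed
  consider "j < i" | "i < j" | "i = j" by linarith
  then show ?thesis
  proof cases
    case 1 then show ?thesis using lt[OF i j] by simp
  next
    case 2 then show ?thesis using lt[OF j i] hardy_inner_commute[OF mw_basis_hardy2[OF j] mw_basis_hardy2[OF i]] by simp
  next
    case 3
    obtain n where n: "i = Suc n" using i by (cases i) auto
    have "hardy_inner (e (Suc n)) (e (Suc n)) = s (Suc n) * (s (Suc n) * szego (lam (Suc n)) (lam (Suc n)))"
      by (subst (1) mw_basis_Suc, rule hardy_inner_mw_basis) (use i n l[of i] in auto)
    also have "\<dots> = 1"
    proof -
      have "lam (Suc n) \<in> ball 0 1" using zeros[of "Suc n"] i n by auto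
      then show ?thesis
        using one_minus_nonzero[of "lam (Suc n)" "lam (Suc n)"] s_square[of "Suc n"] i n
        by (simp add: szego_def mult.commute flip: mult.assoc)
    qed
    finally show ?thesis using 3 n by simp
  qed
qed

lemma model_space_hardy2: "f \<in> K \<Longrightarrow> f \<in> hardy2"
  by (simp add: model_space_def)

lemma hardy_inner_model_space: "f \<in> K \<Longrightarrow> g \<in> hardy2 \<Longrightarrow> hardy_inner f (\<lambda>z. blaschke lam N z * g z) = 0"
  by (simp add: model_space_def)

lemma mw_basis_model_space:
  assumes i: "i \<in> {1..N}"
  shows "e i \<in> K"
  unfolding model_space_def mem_Collect_eq
proof (intro conjI ballI)
  show h: "e i \<in> hardy2" by (rule mw_basis_hardy2[OF i])
  fix g assume g: "g \<in> hardy2"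
  show "hardy_inner (e i) (\<lambda>z. blaschke lam N z * g z) = 0"
    using hardy_inner_commute[OF hardy2_blaschke[OF order_refl g] h] hardy_inner_blaschke_mw_basis[OF i order_refl g] by simp
qed

lemma model_space_add: "f \<in> K \<Longrightarrow> g \<in> K \<Longrightarrow> (\<lambda>z. f z + g z) \<in> K"
  unfolding model_space_def by (simp add: hardy2_add hardy_inner_add_left hardy2_blaschke)

lemma model_space_scale: "f \<in> K \<Longrightarrow> (\<lambda>z. c * f z) \<in> K"
  unfolding model_space_def by (simp add: hardy2_scale hardy_inner_scale_left hardy2_blaschke)

lemma model_space_diff: "f \<in> K \<Longrightarrow> g \<in> K \<Longrightarrow> (\<lambda>z. f z - g z) \<in> K"
  unfolding model_space_def by (simp add: hardy2_diff hardy_inner_diff_left hardy2_blaschke)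

lemma model_space_zero: "(\<lambda>z. 0) \<in> K"
  unfolding model_space_def by (simp add: hardy2_zero hardy_inner_zero_left hardy2_blaschke)

lemma model_space_sum: "I \<subseteq> {1..N} \<Longrightarrow> (\<lambda>z. \<Sum>i\<in>I. c i * e i z) \<in> K"
proof -
  assume I: "I \<subseteq> {1..N}"
  then have "finite I" by (rule finite_subset) simp
  then show ?thesis using I
    by (induction I) (auto intro!: model_space_zero model_space_add model_space_scale mw_basis_model_space)
qed

text \<open>The expansion along the basis, which is the orthogonal projection onto the model space.\<close>

definition coord :: "(complex \<Rightarrow> complex) \<Rightarrow> complex \<Rightarrow> complex" where
  "coord g z = (\<Sum>i\<in>{1..N}. hardy_inner g (e i) * e i z)"

lemma hardy_inner_combination:
  "j \<in> {1..N} \<Longrightarrow> hardy_inner (\<lambda>z. \<Sum>i\<in>{1..N}. c i * e i z) (e j) = c j"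
  by (subst hardy_inner_sum_left) (auto simp: mw_basis_hardy2 mw_basis_orthonormal if_distrib cong: if_cong)

lemma coord_model_space: "coord g \<in> K"
  unfolding coord_def[abs_def] by (rule model_space_sum) simp

lemma hardy_inner_coord: "j \<in> {1..N} \<Longrightarrow> hardy_inner (coord g) (e j) = hardy_inner g (e j)"
  unfolding coord_def[abs_def] by (rule hardy_inner_combination)

text \<open>Orthogonality to \<open>e (Suc n)\<close> says that the quotient of \<open>w\<close> by the first \<open>n\<close> factors vanishes
  at \<open>lam (Suc n)\<close>, so that one more factor can be divided out, multiplicities included. In
  the end \<open>w\<close> is a multiple of the whole product and therefore orthogonal to itself.\<close>

lemma model_space_orthogonal_zero:
  assumes w: "w \<in> K" and orth: "\<And>i. i \<in> {1..N} \<Longrightarrow> hardy_inner w (e i) = 0"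
  shows "w = (\<lambda>z. 0)"
proof -
  have "n \<le> N \<Longrightarrow> \<exists>g\<in>hardy2. w = (\<lambda>z. blaschke lam n z * g z)" for n
  proof (induction n)
    case 0
    then show ?case using model_space_hardy2[OF w] by (auto simp: blaschke_0)
  next
    case (Suc n)
    then obtain g where g: "g \<in> hardy2" "w = (\<lambda>z. blaschke lam n z * g z)" by auto
    have l: "cmod (lam (Suc n)) < 1" using Suc zeros by auto
    have "s (Suc n) * g (lam (Suc n)) = 0"
      using hardy_inner_mw_basis[of n g] orth[of "Suc n"] Suc g by simp
    then have "g (lam (Suc n)) = 0" using s_nonzero[of "Suc n"] Suc by simp
    then obtain h where h: "h \<in> hardy2" "g = (\<lambda>z. blaschke_factor (lam (Suc n)) z * h z)"
      using hardy2_divide_blaschke_factor[OF g(1) l] by blast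
    then show ?case using g by (intro bexI[of _ h]) (auto simp: blaschke_Suc mult.assoc)
  qed
  from this[of N] obtain g where g: "g \<in> hardy2" "w = (\<lambda>z. blaschke lam N z * g z)" by auto
  have "hardy_inner w w = 0" using hardy_inner_model_space[OF w g(1)] g(2) by simp
  then show ?thesis by (rule hardy_inner_self_eq_0[OF model_space_hardy2[OF w]])
qed

lemma coord_id: "f \<in> K \<Longrightarrow> coord f = f"
proof -
  assume f: "f \<in> K"
  have "(\<lambda>z. f z - coord f z) = (\<lambda>z. 0)"
  proof (rule model_space_orthogonal_zero)
    show "(\<lambda>z. f z - coord f z) \<in> K" by (intro model_space_diff f coord_model_space)
    show "hardy_inner (\<lambda>z. f z - coord f z) (e i) = 0" if "i \<in> {1..N}" for i
      using that f by (simp add: hardy_inner_diff_left model_space_hardy2 coord_model_space mw_basis_hardy2 hardy_inner_coord)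
  qed
  then show ?thesis by (auto simp: fun_eq_iff)
qed

lemma coord_orthogonal:
  assumes g: "g \<in> hardy2" and f: "f \<in> K"
  shows "hardy_inner (coord g) f = hardy_inner g f"
proof -
  have h: "hardy_inner f (coord g) = cnj (hardy_inner (coord g) f)" "hardy_inner f g = cnj (hardy_inner g f)"
    using g f by (auto intro: hardy_inner_commute model_space_hardy2 coord_model_space)
  have *: "hardy_inner u f = (\<Sum>i\<in>{1..N}. cnj (hardy_inner f (e i)) * hardy_inner u (e i))" if u: "u \<in> hardy2" for u
  proof -
    have "hardy_inner f u = hardy_inner (\<lambda>z. \<Sum>i\<in>{1..N}. hardy_inner f (e i) * e i z) u"
      using coord_id[OF f] unfolding coord_def[abs_def] by simp
    also have "\<dots> = (\<Sum>i\<in>{1..N}. hardy_inner f (e i) * hardy_inner (e i) u)"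
      by (rule hardy_inner_sum_left) (use u mw_basis_hardy2 in auto)
    finally have "cnj (hardy_inner f u) = (\<Sum>i\<in>{1..N}. cnj (hardy_inner f (e i)) * cnj (hardy_inner (e i) u))" by simp
    moreover have "cnj (hardy_inner (e i) u) = hardy_inner u (e i)" if "i \<in> {1..N}" for i
      using hardy_inner_commute[OF u mw_basis_hardy2[OF that]] by simp
    ultimately show ?thesis using hardy_inner_commute[OF model_space_hardy2[OF f] u] by simp
  qed
  show ?thesis using *[OF g] *[OF model_space_hardy2[OF coord_model_space]] by (simp add: hardy_inner_coord)
qed

lemma orth_proj_eq:
  assumes g: "g \<in> hardy2"
  shows "orth_proj K g = coord g"
  unfolding orth_proj_def
proof (rule the_equality)
  show "coord g \<in> K \<and> (\<forall>f\<in>K. hardy_inner (\<lambda>z. g z - coord g z) f = 0)"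
    using g by (simp add: coord_model_space hardy_inner_diff_left model_space_hardy2 coord_orthogonal)
  fix h assume h: "h \<in> K \<and> (\<forall>f\<in>K. hardy_inner (\<lambda>z. g z - h z) f = 0)"
  have "hardy_inner h (e i) = hardy_inner g (e i)" if i: "i \<in> {1..N}" for i
    using h mw_basis_model_space[OF i] g by (auto simp: hardy_inner_diff_left model_space_hardy2)
  then have "coord h = coord g" by (simp add: coord_def fun_eq_iff)
  then show "h = coord g" using h coord_id by simp
qed

lemma coord_add: "f \<in> hardy2 \<Longrightarrow> g \<in> hardy2 \<Longrightarrow> coord (\<lambda>z. f z + g z) z = coord f z + coord g z"
  by (simp add: coord_def hardy_inner_add_left mw_basis_hardy2 sum.distrib algebra_simps)

lemma coord_scale: "f \<in> hardy2 \<Longrightarrow> coord (\<lambda>z. c * f z) z = c * coord f z"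
  by (simp add: coord_def hardy_inner_scale_left mw_basis_hardy2 sum_distrib_left mult.assoc)

lemma coefficient_le_norm:
  assumes f: "f \<in> K" and i: "i \<in> {1..N}"
  shows "cmod (hardy_inner f (e i)) \<le> hardy_norm f"
proof -
  have "hardy_norm (e i) = 1" using mw_basis_orthonormal[OF i i] by (simp add: hardy_norm_def)
  then show ?thesis using hardy_cauchy_schwarz[OF model_space_hardy2[OF f] mw_basis_hardy2[OF i]] by simp
qed

section \<open>The model operator and its resolvent\<close>

lemma model_op_eq: "f \<in> K \<Longrightarrow> model_op (blaschke lam N) f = coord (\<lambda>z. z * f z)"
  unfolding model_op_def by (intro orth_proj_eq hardy2_times_z model_space_hardy2)

lemma model_shifted_eq: "f \<in> K \<Longrightarrow> shifted \<zeta> f = (\<lambda>z. \<zeta> * f z - coord (\<lambda>z. z * f z) z)"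
  by (simp add: model_shifted_def model_op_eq)

lemma model_shifted_in: "f \<in> K \<Longrightarrow> shifted \<zeta> f \<in> K"
  unfolding model_shifted_eq by (intro model_space_diff model_space_scale coord_model_space)

lemma model_shifted_add:
  assumes "f \<in> K" "g \<in> K"
  shows "shifted \<zeta> (\<lambda>z. f z + g z) =
    (\<lambda>z. shifted \<zeta> f z + shifted \<zeta> g z)"
proof -
  have "coord (\<lambda>z. z * (f z + g z)) z = coord (\<lambda>z. z * f z) z + coord (\<lambda>z. z * g z) z" for z
    using coord_add[of "\<lambda>z. z * f z" "\<lambda>z. z * g z" z] assms by (simp add: hardy2_times_z model_space_hardy2 algebra_simps)
  then show ?thesis using assms by (simp add: model_shifted_eq model_space_add algebra_simps)
qed

lemma model_shifted_scale:
  assumes "f \<in> K"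
  shows "shifted \<zeta> (\<lambda>z. c * f z) = (\<lambda>z. c * shifted \<zeta> f z)"
proof -
  have "coord (\<lambda>z. z * (c * f z)) z = c * coord (\<lambda>z. z * f z) z" for z
    using coord_scale[of "\<lambda>z. z * f z" c z] assms by (simp add: hardy2_times_z model_space_hardy2 mult.left_commute)
  then show ?thesis using assms by (simp add: model_shifted_eq model_space_scale algebra_simps)
qed

lemma model_shifted_sum:
  assumes "finite I" "\<And>i. i \<in> I \<Longrightarrow> f i \<in> K"
  shows "(\<lambda>z. \<Sum>i\<in>I. c i * f i z) \<in> K \<and> shifted \<zeta> (\<lambda>z. \<Sum>i\<in>I. c i * f i z) =
    (\<lambda>z. \<Sum>i\<in>I. c i * shifted \<zeta> (f i) z)"
  using assms
proof (induction I)
  case empty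
  show ?case using model_shifted_scale[OF model_space_zero, of \<zeta> 0] by (simp add: model_space_zero)
next
  case (insert i I)
  then show ?case by (simp add: model_space_add model_space_scale model_shifted_add model_shifted_scale)
qed

text \<open>The product of the first \<open>n\<close> Blaschke factors as an element of the Hardy space; \<open>szego 0\<close> is
  the constant \<open>1\<close> on the disk and \<open>0\<close> outside.\<close>

definition phi :: "nat \<Rightarrow> complex \<Rightarrow> complex" where
  "phi n z = blaschke lam n z * szego 0 z"

lemma phi_hardy2: "n \<le> N \<Longrightarrow> phi n \<in> hardy2"
  unfolding phi_def[abs_def] by (intro hardy2_blaschke szego) auto

text \<open>The identity \<open>1 = (1 - \<bar>\<lambda>\<bar>\<^sup>2) / (1 - cnj \<lambda> z) - cnj \<lambda> (z - \<lambda>) / (1 - cnj \<lambda> z)\<close> multiplied by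
  \<open>phi n\<close>.\<close>

lemma phi_Suc: "n < N \<Longrightarrow> phi n z = s (Suc n) * e (Suc n) z - cnj (lam (Suc n)) * phi (Suc n) z"
proof (cases "z \<in> ball 0 1")
  case True
  assume n: "n < N"
  then have d: "1 - cnj (lam (Suc n)) * z \<noteq> 0" using zeros[of "Suc n"] True by (intro one_minus_nonzero) auto
  have ss: "s (Suc n) * s (Suc n) = 1 - lam (Suc n) * cnj (lam (Suc n))"
    using s_square[of "Suc n"] n by simp
  show ?thesis using True d
    by (simp add: phi_def mw_basis_Suc blaschke_Suc szego_def blaschke_factor_def mult.left_commute[of _ "blaschke lam n z"] divide_simps)
       (simp add: ss algebra_simps)
qed (simp add: phi_def mw_basis_def szego_def)

lemma times_z_mw_basis: "n < N \<Longrightarrow> z * e (Suc n) z = lam (Suc n) * e (Suc n) z + s (Suc n) * phi (Suc n) z"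
proof (cases "z \<in> ball 0 1")
  case True
  assume n: "n < N"
  then have d: "1 - cnj (lam (Suc n)) * z \<noteq> 0" using zeros[of "Suc n"] True by (intro one_minus_nonzero) auto
  then show ?thesis using True
    by (simp add: phi_def mw_basis_Suc blaschke_Suc szego_def blaschke_factor_def divide_simps) (simp add: algebra_simps)
qed (simp add: phi_def mw_basis_def szego_def)

lemma model_shifted_mw_basis:
  assumes n: "n < N"
  shows "shifted \<zeta> (e (Suc n)) =
    (\<lambda>z. (\<zeta> - lam (Suc n)) * e (Suc n) z - s (Suc n) * coord (phi (Suc n)) z)"
proof -
  have i: "Suc n \<in> {1..N}" using n by auto
  have "coord (\<lambda>z. z * e (Suc n) z) z = lam (Suc n) * e (Suc n) z + s (Suc n) * coord (phi (Suc n)) z" for z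
    unfolding times_z_mw_basis[OF n]
    using n i by (simp add: coord_add coord_scale hardy2_scale mw_basis_hardy2 phi_hardy2 coord_id mw_basis_model_space)
  then show ?thesis using mw_basis_model_space[OF i] by (simp add: model_shifted_eq algebra_simps)
qed

lemma coord_phi_Suc:
  assumes n: "n < N"
  shows "coord (phi n) z = s (Suc n) * e (Suc n) z - cnj (lam (Suc n)) * coord (phi (Suc n)) z"
proof -
  have i: "Suc n \<in> {1..N}" using n by auto
  have "phi n = (\<lambda>z. s (Suc n) * e (Suc n) z + (- cnj (lam (Suc n))) * phi (Suc n) z)"
    using phi_Suc[OF n] by (simp add: fun_eq_iff)
  then show ?thesis
    using n i coord_add[OF hardy2_scale(1)[OF mw_basis_hardy2[OF i]] hardy2_scale(1)[OF phi_hardy2], of "Suc n" "s (Suc n)" "- cnj (lam (Suc n))" z]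
      coord_scale[OF mw_basis_hardy2[OF i], of "s (Suc n)" z] coord_scale[OF phi_hardy2, of "Suc n" "- cnj (lam (Suc n))" z]
    by (simp add: coord_id mw_basis_model_space)
qed

lemma coord_phi_N: "coord (phi N) z = 0"
  unfolding coord_def phi_def[abs_def]
  by (rule sum.neutral) (auto simp: hardy_inner_blaschke_mw_basis szego)

text \<open>The preimage of \<open>coord (phi n)\<close> under \<open>shifted \<zeta>\<close>, as the recursion \<open>tail_resolvent_Suc\<close>
  produces it.\<close>

definition tail_resolvent :: "complex \<Rightarrow> nat \<Rightarrow> complex \<Rightarrow> complex" where
  "tail_resolvent \<zeta> n z = (\<Sum>i\<in>{Suc n..N}. s i / (\<zeta> - lam i) * (\<Prod>\<mu>=Suc n..i-1. (1 - cnj (lam \<mu>) * \<zeta>) / (\<zeta> - lam \<mu>)) * e i z)"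

lemma tail_resolvent_Suc:
  assumes n: "n < N"
  shows "tail_resolvent \<zeta> n z = s (Suc n) / (\<zeta> - lam (Suc n)) * e (Suc n) z +
     (1 - cnj (lam (Suc n)) * \<zeta>) / (\<zeta> - lam (Suc n)) * tail_resolvent \<zeta> (Suc n) z"
proof -
  have p: "(\<Prod>\<mu>=Suc n..i-1. f \<mu>) = f (Suc n) * (\<Prod>\<mu>=Suc (Suc n)..i-1. f \<mu>)" if "i \<in> {Suc (Suc n)..N}" for i and f :: "nat \<Rightarrow> complex"
    using that by (intro prod.atLeast_Suc_atMost) auto
  show ?thesis
    unfolding tail_resolvent_def sum.atLeast_Suc_atMost[of "Suc n" N, OF Suc_leI[OF n]] sum_distrib_left
    by (intro arg_cong2[where f = "(+)"] sum.cong refl) (simp_all add: p mult_ac del: One_nat_def)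
qed

lemma tail_resolvent_model_space: "tail_resolvent \<zeta> n \<in> K"
  unfolding tail_resolvent_def[abs_def] by (rule model_space_sum) auto

lemma model_shifted_tail_resolvent:
  assumes \<zeta>: "\<And>i. i \<in> {1..N} \<Longrightarrow> \<zeta> \<noteq> lam i" and n: "n \<le> N"
  shows "shifted \<zeta> (tail_resolvent \<zeta> n) = coord (phi n)"
  using n
proof (induction rule: inc_induct)
  case base
  have "tail_resolvent \<zeta> N = (\<lambda>z. 0)" by (simp add: tail_resolvent_def fun_eq_iff)
  then show ?case using model_shifted_scale[OF model_space_zero, of \<zeta> 0] by (simp add: coord_phi_N fun_eq_iff)
next
  case (step n)
  have i: "Suc n \<in> {1..N}" using step by auto
  have d: "\<zeta> - lam (Suc n) \<noteq> 0" using \<zeta>[OF i] by simp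
  have tr: "tail_resolvent \<zeta> n = (\<lambda>z. s (Suc n) / (\<zeta> - lam (Suc n)) * e (Suc n) z +
     (1 - cnj (lam (Suc n)) * \<zeta>) / (\<zeta> - lam (Suc n)) * tail_resolvent \<zeta> (Suc n) z)"
    using tail_resolvent_Suc step by auto
  have "shifted \<zeta> (tail_resolvent \<zeta> n) =
     (\<lambda>z. s (Suc n) / (\<zeta> - lam (Suc n)) * ((\<zeta> - lam (Suc n)) * e (Suc n) z - s (Suc n) * coord (phi (Suc n)) z) +
     (1 - cnj (lam (Suc n)) * \<zeta>) / (\<zeta> - lam (Suc n)) * coord (phi (Suc n)) z)"
    by (simp only: tr model_shifted_add model_shifted_scale model_space_scale tail_resolvent_model_space
        mw_basis_model_space[OF i] model_shifted_mw_basis[OF step(2)] step(3))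
  also have "\<dots> = coord (phi n)"
  proof
    fix z
    have ss: "s (Suc n) * (s (Suc n) * x) = (1 - lam (Suc n) * cnj (lam (Suc n))) * x" for x
      using s_square[OF i] by (simp flip: mult.assoc)
    show "s (Suc n) / (\<zeta> - lam (Suc n)) * ((\<zeta> - lam (Suc n)) * e (Suc n) z - s (Suc n) * coord (phi (Suc n)) z) +
     (1 - cnj (lam (Suc n)) * \<zeta>) / (\<zeta> - lam (Suc n)) * coord (phi (Suc n)) z = coord (phi n) z"
      using d unfolding coord_phi_Suc[OF step(2)] by (simp add: divide_simps) (simp add: ss algebra_simps)
  qed
  finally show ?case .
qed

definition resolvent_column :: "complex \<Rightarrow> nat \<Rightarrow> complex \<Rightarrow> complex" where
  "resolvent_column \<zeta> j z = 1 / (\<zeta> - lam j) * e j z + s j / (\<zeta> - lam j) * tail_resolvent \<zeta> j z"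

lemma resolvent_column_model_space: "j \<in> {1..N} \<Longrightarrow> resolvent_column \<zeta> j \<in> K"
  unfolding resolvent_column_def[abs_def]
  by (intro model_space_add model_space_scale mw_basis_model_space tail_resolvent_model_space)

lemma model_shifted_resolvent_column:
  assumes \<zeta>: "\<And>i. i \<in> {1..N} \<Longrightarrow> \<zeta> \<noteq> lam i" and j: "j \<in> {1..N}"
  shows "shifted \<zeta> (resolvent_column \<zeta> j) = e j"
proof -
  obtain n where n: "j = Suc n" "n < N" using j by (cases j) auto
  have d: "\<zeta> - lam j \<noteq> 0" using \<zeta>[OF j] by simp
  have jN: "j \<le> N" using j by simp
  have "shifted \<zeta> (resolvent_column \<zeta> j) =
     (\<lambda>z. 1 / (\<zeta> - lam j) * ((\<zeta> - lam j) * e j z - s j * coord (phi j) z) + s j / (\<zeta> - lam j) * coord (phi j) z)"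
    unfolding resolvent_column_def[abs_def]
    by (simp only: model_shifted_add model_shifted_scale model_space_scale tail_resolvent_model_space
        mw_basis_model_space[OF j] model_shifted_mw_basis[OF n(2), folded n(1)] model_shifted_tail_resolvent[OF \<zeta> jN])
  also have "\<dots> = e j" using d by (simp add: fun_eq_iff divide_simps)
  finally show ?thesis .
qed

lemma model_shifted_columns:
  assumes \<zeta>: "\<And>i. i \<in> {1..N} \<Longrightarrow> \<zeta> \<noteq> lam i"
  shows "(\<lambda>z. \<Sum>i\<in>{1..N}. c i * resolvent_column \<zeta> i z) \<in> K"
    and "shifted \<zeta> (\<lambda>z. \<Sum>i\<in>{1..N}. c i * resolvent_column \<zeta> i z) = (\<lambda>z. \<Sum>i\<in>{1..N}. c i * e i z)"
proof -
  have S: "(\<lambda>z. \<Sum>i\<in>{1..N}. c i * resolvent_column \<zeta> i z) \<in> K \<and>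
      shifted \<zeta> (\<lambda>z. \<Sum>i\<in>{1..N}. c i * resolvent_column \<zeta> i z) =
      (\<lambda>z. \<Sum>i\<in>{1..N}. c i * shifted \<zeta> (resolvent_column \<zeta> i) z)"
    by (intro model_shifted_sum resolvent_column_model_space) simp_all
  then show "(\<lambda>z. \<Sum>i\<in>{1..N}. c i * resolvent_column \<zeta> i z) \<in> K" by blast
  have "(\<lambda>z. \<Sum>i\<in>{1..N}. c i * shifted \<zeta> (resolvent_column \<zeta> i) z) = (\<lambda>z. \<Sum>i\<in>{1..N}. c i * e i z)"
    by (intro ext sum.cong refl) (simp only: model_shifted_resolvent_column[OF \<zeta>])
  with S show "shifted \<zeta> (\<lambda>z. \<Sum>i\<in>{1..N}. c i * resolvent_column \<zeta> i z) = (\<lambda>z. \<Sum>i\<in>{1..N}. c i * e i z)"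
    by simp
qed

text \<open>In the basis the operator is lower triangular with diagonal entries \<open>\<zeta> - lam i \<noteq> 0\<close>, so the
  coefficients of a null vector vanish one after another.\<close>

lemma model_shifted_inj_zero:
  assumes \<zeta>: "\<And>i. i \<in> {1..N} \<Longrightarrow> \<zeta> \<noteq> lam i" and f: "f \<in> K" and 0: "shifted \<zeta> f = (\<lambda>z. 0)"
  shows "f = (\<lambda>z. 0)"
proof (rule model_space_orthogonal_zero[OF f])
  define c where "c i = hardy_inner f (e i)" for i
  have fe: "f = (\<lambda>z. \<Sum>i\<in>{1..N}. c i * e i z)"
    using coord_id[OF f] by (simp add: coord_def[abs_def] c_def)
  have "shifted \<zeta> f = (\<lambda>z. \<Sum>i\<in>{1..N}. c i * shifted \<zeta> (e i) z)"
    unfolding fe using model_shifted_sum[of "{1..N}" e] mw_basis_model_space by simp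
  then have T: "(\<lambda>z. \<Sum>i\<in>{1..N}. c i * shifted \<zeta> (e i) z) = (\<lambda>z. 0)"
    using 0 by simp
  have ent: "hardy_inner (shifted \<zeta> (e i)) (e j) = (if i = j then \<zeta> - lam i else 0)"
    if ij: "i \<in> {1..N}" "j \<in> {1..N}" "j \<le> i" for i j
  proof -
    obtain n where n: "i = Suc n" "n < N" using ij by (cases i) auto
    have "hardy_inner (coord (phi i)) (e j) = 0"
      using hardy_inner_coord[OF ij(2), of "phi i"] hardy_inner_blaschke_mw_basis[of j i "szego 0"] ij
      by (simp add: phi_def[abs_def] szego)
    then show ?thesis
      unfolding n(1) model_shifted_mw_basis[OF n(2)] unfolding n(1)[symmetric]
      using ij by (simp add: hardy_inner_diff_left hardy_inner_scale_left hardy2_scale mw_basis_hardy2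
        model_space_hardy2[OF coord_model_space] mw_basis_orthonormal)
  qed
  have "j \<in> {1..N} \<Longrightarrow> c j = 0" for j
  proof (induction j rule: less_induct)
    case (less j)
    have "0 = hardy_inner (\<lambda>z. \<Sum>i\<in>{1..N}. c i * shifted \<zeta> (e i) z) (e j)"
      unfolding T using mw_basis_hardy2[OF less.prems] by (simp add: hardy_inner_zero_left)
    also have "\<dots> = (\<Sum>i\<in>{1..N}. c i * hardy_inner (shifted \<zeta> (e i)) (e j))"
      by (rule hardy_inner_sum_left) (use less.prems in \<open>simp_all add: model_space_hardy2 model_shifted_in mw_basis_model_space mw_basis_hardy2\<close>)
    also have "\<dots> = (\<Sum>i\<in>{1..N}. if i = j then c j * (\<zeta> - lam j) else 0)"
    proof (rule sum.cong[OF refl])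
      fix i assume i: "i \<in> {1..N}"
      show "c i * hardy_inner (shifted \<zeta> (e i)) (e j) = (if i = j then c j * (\<zeta> - lam j) else 0)"
        using less.IH[of i] i ent[OF i less.prems] by (cases "i < j") auto
    qed
    also have "\<dots> = c j * (\<zeta> - lam j)" using less.prems by simp
    finally show "c j = 0" using \<zeta>[OF less.prems] by simp
  qed
  then show "hardy_inner f (e i) = 0" if "i \<in> {1..N}" for i using that by (simp add: c_def)
qed

lemma model_shifted_bij:
  assumes \<zeta>: "\<And>i. i \<in> {1..N} \<Longrightarrow> \<zeta> \<noteq> lam i"
  shows "bij_betw (shifted \<zeta>) K K"
proof (rule bij_betwI')
  fix f g assume fg: "f \<in> K" "g \<in> K"
  show "(shifted \<zeta> f = shifted \<zeta> g) = (f = g)"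
  proof
    assume eq: "shifted \<zeta> f = shifted \<zeta> g"
    have "(\<lambda>z. f z + (-1) * g z) = (\<lambda>z. 0)"
    proof (rule model_shifted_inj_zero[OF \<zeta>])
      show "(\<lambda>z. f z + (-1) * g z) \<in> K" by (intro model_space_add model_space_scale fg)
      show "shifted \<zeta> (\<lambda>z. f z + (-1) * g z) = (\<lambda>z. 0)"
        unfolding model_shifted_add[OF fg(1) model_space_scale[OF fg(2)]] model_shifted_scale[OF fg(2)] eq by simp
    qed
    then show "f = g" by (auto simp: fun_eq_iff)
  qed simp
next
  fix f assume "f \<in> K" then show "shifted \<zeta> f \<in> K" by (rule model_shifted_in)
next
  fix g assume g: "g \<in> K"
  have "g = (\<lambda>z. \<Sum>i\<in>{1..N}. hardy_inner g (e i) * e i z)"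
    using coord_id[OF g] by (simp add: coord_def[abs_def])
  then show "\<exists>f\<in>K. g = shifted \<zeta> f"
    using model_shifted_columns[OF \<zeta>, of "\<lambda>i. hardy_inner g (e i)"]
    by (intro bexI[of _ "\<lambda>z. \<Sum>i\<in>{1..N}. hardy_inner g (e i) * resolvent_column \<zeta> i z"]) auto
qed

context
  fixes \<zeta> :: complex
  assumes \<zeta>: "\<And>i. i \<in> {1..N} \<Longrightarrow> \<zeta> \<noteq> lam i"
begin

lemma model_resolvent_unique:
  "f \<in> K \<Longrightarrow> shifted \<zeta> f = g \<Longrightarrow> resolvent \<zeta> g = f"
  unfolding model_resolvent_def
  using inv_into_f_f[OF bij_betw_imp_inj_on[OF model_shifted_bij[OF \<zeta>]]] by auto

lemma model_resolvent_right: "g \<in> K \<Longrightarrow> shifted \<zeta> (resolvent \<zeta> g) = g"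
  unfolding model_resolvent_def
  using bij_betw_inv_into_right[OF model_shifted_bij[OF \<zeta>]] by auto

lemma model_resolvent_in: "g \<in> K \<Longrightarrow> resolvent \<zeta> g \<in> K"
  unfolding model_resolvent_def
  using bij_betw_inv_into[OF model_shifted_bij[OF \<zeta>]] by (auto simp: bij_betw_def)

lemma model_resolvent_mw_basis: "j \<in> {1..N} \<Longrightarrow> resolvent \<zeta> (e j) = resolvent_column \<zeta> j"
  by (intro model_resolvent_unique resolvent_column_model_space model_shifted_resolvent_column \<zeta>)

lemma model_resolvent_scale:
  assumes f: "f \<in> K"
  shows "resolvent \<zeta> (\<lambda>z. c * f z) = (\<lambda>z. c * resolvent \<zeta> f z)"
  using f by (intro model_resolvent_unique model_space_scale model_resolvent_in)
    (simp_all add: model_shifted_scale model_resolvent_in model_resolvent_right)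

lemma model_resolvent_expand:
  assumes f: "f \<in> K"
  shows "resolvent \<zeta> f = (\<lambda>z. \<Sum>i\<in>{1..N}. hardy_inner f (e i) * resolvent_column \<zeta> i z)"
proof (rule model_resolvent_unique)
  show "(\<lambda>z. \<Sum>i\<in>{1..N}. hardy_inner f (e i) * resolvent_column \<zeta> i z) \<in> K"
    by (rule model_shifted_columns(1)[OF \<zeta>])
  show "shifted \<zeta> (\<lambda>z. \<Sum>i\<in>{1..N}. hardy_inner f (e i) * resolvent_column \<zeta> i z) = f"
    using coord_id[OF f] model_shifted_columns(2)[OF \<zeta>, of "\<lambda>i. hardy_inner f (e i)"] by (simp only: coord_def[abs_def])
qed

lemma model_resolvent_matrix:
  assumes i: "i \<in> {1..N}" and j: "j \<in> {1..N}"
  shows "hardy_inner (resolvent \<zeta> (e j)) (e i) =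
    (if i < j then 0 else if i = j then 1 / (\<zeta> - lam i)
     else s i / (\<zeta> - lam i) * (s j / (\<zeta> - lam j)) * (\<Prod>\<mu>=j+1..i-1. (1 - cnj (lam \<mu>) * \<zeta>) / (\<zeta> - lam \<mu>)))"
proof -
  define d where "d k = s k / (\<zeta> - lam k) * (\<Prod>\<mu>=Suc j..k-1. (1 - cnj (lam \<mu>) * \<zeta>) / (\<zeta> - lam \<mu>))" for k
  have "tail_resolvent \<zeta> j = (\<lambda>z. \<Sum>k\<in>{Suc j..N}. d k * e k z)"
    by (simp add: tail_resolvent_def d_def fun_eq_iff)
  then have "hardy_inner (tail_resolvent \<zeta> j) (e i) = (\<Sum>k\<in>{Suc j..N}. d k * hardy_inner (e k) (e i))"
    using i by (simp only:) (rule hardy_inner_sum_left, auto intro: mw_basis_hardy2)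
  also have "\<dots> = (\<Sum>k\<in>{Suc j..N}. if k = i then d i else 0)"
    using i by (intro sum.cong refl) (auto simp: mw_basis_orthonormal)
  also have "\<dots> = (if j < i then d i else 0)" using i by auto
  finally have t: "hardy_inner (tail_resolvent \<zeta> j) (e i) = (if j < i then d i else 0)" .
  have "hardy_inner (resolvent_column \<zeta> j) (e i) =
     1 / (\<zeta> - lam j) * hardy_inner (e j) (e i) + s j / (\<zeta> - lam j) * hardy_inner (tail_resolvent \<zeta> j) (e i)"
    unfolding resolvent_column_def[abs_def] using i j
    by (simp only: hardy_inner_add_left hardy_inner_scale_left hardy2_scale mw_basis_hardy2
        model_space_hardy2[OF tail_resolvent_model_space])
  then show ?thesis unfolding model_resolvent_mw_basis[OF j] t
    using i j by (auto simp: mw_basis_orthonormal d_def)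
qed

lemma model_resolvent_bdd: "bdd_above ((\<lambda>f. hardy_norm (resolvent \<zeta> f)) ` {f \<in> K. hardy_norm f \<le> 1})"
proof (rule bdd_aboveI2)
  fix g assume g: "g \<in> {f \<in> K. hardy_norm f \<le> 1}"
  then have gK: "g \<in> K" by simp
  have "hardy_norm (resolvent \<zeta> g) \<le> (\<Sum>i\<in>{1..N}. cmod (hardy_inner g (e i)) * hardy_norm (resolvent_column \<zeta> i))"
    unfolding model_resolvent_expand[OF gK]
    by (rule hardy_norm_sum) (simp_all add: model_space_hardy2 resolvent_column_model_space)
  also have "\<dots> \<le> (\<Sum>i\<in>{1..N}. 1 * hardy_norm (resolvent_column \<zeta> i))"
  proof (intro sum_mono mult_right_mono)
    fix i assume i: "i \<in> {1..N}"
    show "cmod (hardy_inner g (e i)) \<le> 1" using coefficient_le_norm[OF gK i] g by simp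
    show "0 \<le> hardy_norm (resolvent_column \<zeta> i)"
      using i by (intro hardy_norm_nonneg model_space_hardy2 resolvent_column_model_space)
  qed
  finally show "hardy_norm (resolvent \<zeta> g) \<le> (\<Sum>i\<in>{1..N}. 1 * hardy_norm (resolvent_column \<zeta> i))" .
qed

lemma model_resolvent_zero: "resolvent \<zeta> (\<lambda>z. 0) = (\<lambda>z. 0)"
  using model_resolvent_scale[OF model_space_zero, of 0] by simp

lemma hardy_norm_zero: "hardy_norm (\<lambda>z. 0) = 0"
  by (simp add: hardy_norm_def hardy_inner_zero_left hardy2_zero)

lemma model_resolvent_opnorm_nonneg: "0 \<le> hardy_opnorm K (resolvent \<zeta>)"
proof -
  have "hardy_norm (resolvent \<zeta> (\<lambda>z. 0)) \<le> hardy_opnorm K (resolvent \<zeta>)"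
    unfolding hardy_opnorm_def
    by (rule cSUP_upper[OF _ model_resolvent_bdd]) (simp add: model_space_zero hardy_norm_zero)
  then show ?thesis by (simp add: model_resolvent_zero hardy_norm_zero)
qed

lemma model_resolvent_norm_le:
  assumes f: "f \<in> K"
  shows "hardy_norm (resolvent \<zeta> f)
    \<le> hardy_opnorm K (resolvent \<zeta>) * hardy_norm f"
proof (cases "hardy_norm f = 0")
  case True
  then have "f = (\<lambda>z. 0)" using hardy_norm_eq_0 model_space_hardy2[OF f] by auto
  then have "resolvent \<zeta> f = (\<lambda>z. 0)"
    using model_resolvent_scale[OF model_space_zero, of 0] by simp
  then show ?thesis using True \<open>f = _\<close> by simp
next
  case False
  define R where "R = resolvent \<zeta>"
  define U where "U = {f \<in> K. hardy_norm f \<le> 1}"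
  have "bdd_above ((\<lambda>f. hardy_norm (R f)) ` U)" unfolding R_def U_def by (rule model_resolvent_bdd)
  define c where "c = hardy_norm f"
  have c: "0 < c" using False hardy_norm_nonneg[OF model_space_hardy2[OF f]] by (simp add: c_def)
  define g where "g z = of_real (1 / c) * f z" for z
  have g: "g \<in> K" unfolding g_def[abs_def] by (rule model_space_scale[OF f])
  have "hardy_norm g = 1" unfolding g_def[abs_def] hardy_norm_scale[OF model_space_hardy2[OF f]] using c by (simp add: c_def norm_divide)
  then have "hardy_norm (R g) \<le> hardy_opnorm K R"
    unfolding hardy_opnorm_def using g \<open>bdd_above _\<close> by (intro cSUP_upper) (auto simp: U_def)
  moreover have "hardy_norm (R g) = 1 / c * hardy_norm (R f)"
    unfolding g_def[abs_def] R_def model_resolvent_scale[OF f] hardy_norm_scale[OF model_space_hardy2[OF model_resolvent_in[OF f]]]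
    using c by (simp add: norm_divide)
  ultimately show ?thesis using c by (simp add: R_def c_def field_simps)
qed

text \<open>With \<open>u = resolvent \<zeta> g\<close>, moving the shifted operator to the other side gives \<open>\<parallel>g\<parallel>\<^sup>2 = \<langle>u,
  cnj \<zeta> g - bshift g\<rangle>\<close>; the projection disappears because \<open>g\<close> lies in the model space.\<close>

lemma adjoint_lower_bound:
  assumes g: "g \<in> K"
  shows "hardy_norm g \<le> hardy_opnorm K (resolvent \<zeta>) * hardy_norm (\<lambda>z. cnj \<zeta> * g z - bshift g z)"
proof (cases "hardy_norm g = 0")
  case True
  then have "g = (\<lambda>z. 0)" using hardy_norm_eq_0 model_space_hardy2[OF g] by auto
  moreover have "bshift (\<lambda>z. 0) = (\<lambda>z. 0)" by (simp add: bshift_def taylor_coeff_zero fun_eq_iff hfun_def psum_def)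
  ultimately show ?thesis using True by simp
next
  case False
  define R where "R = resolvent \<zeta>"
  define u where "u = R g"
  have u: "u \<in> K" using model_resolvent_in[OF g] by (simp add: u_def R_def)
  have h: "g \<in> hardy2" "u \<in> hardy2" "bshift g \<in> hardy2" "(\<lambda>z. cnj \<zeta> * g z) \<in> hardy2" "(\<lambda>z. cnj \<zeta> * g z - bshift g z) \<in> hardy2"
    using model_space_hardy2[OF u] model_space_hardy2[OF g] by (auto intro!: bshift hardy2_scale hardy2_diff)
  have "hardy_inner g g = hardy_inner (\<lambda>z. \<zeta> * u z - coord (\<lambda>z. z * u z) z) g"
    using model_resolvent_right[OF g] model_shifted_eq[OF u, of \<zeta>] by (simp add: u_def R_def)
  also have "\<dots> = \<zeta> * hardy_inner u g - hardy_inner (\<lambda>z. z * u z) g"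
    using g h by (simp add: hardy_inner_diff_left hardy_inner_scale_left hardy2_scale model_space_hardy2[OF coord_model_space]
      coord_orthogonal hardy2_times_z)
  also have "\<dots> = hardy_inner u (\<lambda>z. cnj \<zeta> * g z - bshift g z)"
    using h by (simp add: hardy_inner_diff_right hardy_inner_scale_right hardy_inner_times_z)
  finally have "(hardy_norm g)\<^sup>2 = cmod (hardy_inner u (\<lambda>z. cnj \<zeta> * g z - bshift g z))"
    using hardy_inner_self_norm[OF h(1)] by (metis abs_of_nonneg norm_of_real zero_le_power2)
  also have "\<dots> \<le> hardy_norm u * hardy_norm (\<lambda>z. cnj \<zeta> * g z - bshift g z)"
    by (rule hardy_cauchy_schwarz[OF h(2,5)])
  also have "\<dots> \<le> hardy_opnorm K R * hardy_norm g * hardy_norm (\<lambda>z. cnj \<zeta> * g z - bshift g z)"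
    unfolding u_def R_def by (intro mult_right_mono model_resolvent_norm_le[OF g] hardy_norm_nonneg h)
  finally show ?thesis
    using False hardy_norm_nonneg[OF h(1)] by (simp add: R_def power2_eq_square mult_ac) 
qed

end

end

section \<open>Hermitian inner product and adjoint matrix\<close>

definition cinner :: "complex^'n \<Rightarrow> complex^'n \<Rightarrow> complex" where
  "cinner x y = (\<Sum>i\<in>UNIV. x $ i * cnj (y $ i))"

definition adj :: "complex^'n^'n \<Rightarrow> complex^'n^'n" where
  "adj A = (\<chi> i j. cnj (A $ j $ i))"

lemma cinner_add_left: "cinner (x + y) z = cinner x z + cinner y z"
  by (simp add: cinner_def sum.distrib algebra_simps)

lemma cinner_diff_left: "cinner (x - y) z = cinner x z - cinner y z"
  by (simp add: cinner_def sum_subtractf algebra_simps)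

lemma cinner_diff_right: "cinner z (x - y) = cinner z x - cinner z y"
  by (simp add: cinner_def sum_subtractf algebra_simps)

lemma cinner_scale_left: "cinner (c *s x) z = c * cinner x z"
  by (simp add: cinner_def sum_distrib_left mult.assoc)

lemma cinner_scale_right: "cinner z (c *s x) = cnj c * cinner z x"
  by (simp add: cinner_def sum_distrib_left algebra_simps)

lemma cinner_commute: "cinner y x = cnj (cinner x y)"
  by (simp add: cinner_def mult.commute)

lemma Re_cinner: "Re (cinner x y) = x \<bullet> y"
  by (simp add: cinner_def inner_vec_def inner_complex_def)

lemma Re_cinner_self: "Re (cinner x x) = (norm x)\<^sup>2"
  by (simp add: Re_cinner power2_norm_eq_inner)

lemma cinner_adj: "cinner (A *v x) y = cinner x (adj A *v y)"
proof -
  have "cinner (A *v x) y = (\<Sum>i\<in>UNIV. \<Sum>j\<in>UNIV. A $ i $ j * x $ j * cnj (y $ i))"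
    by (simp add: cinner_def matrix_vector_mult_def sum_distrib_right)
  also have "\<dots> = (\<Sum>j\<in>UNIV. \<Sum>i\<in>UNIV. A $ i $ j * x $ j * cnj (y $ i))" by (rule sum.swap)
  also have "\<dots> = cinner x (adj A *v y)"
    by (simp add: cinner_def matrix_vector_mult_def adj_def sum_distrib_left mult_ac)
  finally show ?thesis .
qed

lemma cinner_eq_0: "(\<And>y. cinner y x = 0) \<Longrightarrow> x = 0"
  using Re_cinner_self[of x] by simp

lemma matrix_vector_scale: "A *v (c *s x) = c *s (A *v (x :: complex^'n))"
  by (simp add: vec_eq_iff matrix_vector_mult_def sum_distrib_left mult.left_commute)

lemma mat_vector_mult: "mat c *v x = c *s (x :: complex^'n)"
  by (simp add: vec_eq_iff matrix_vector_mult_def mat_def mult_delta_left)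

lemma adj_contraction:
  fixes A :: "complex^'n^'n"
  assumes A: "\<And>x. norm (A *v x) \<le> norm x"
  shows "norm (adj A *v x) \<le> norm x"
proof (cases "adj A *v x = 0")
  case False
  define y where "y = adj A *v x"
  have "(norm y)\<^sup>2 = Re (cinner (A *v y) x)"
    by (simp add: cinner_adj Re_cinner_self flip: y_def)
  also have "\<dots> \<le> norm (A *v y) * norm x" unfolding Re_cinner by (rule norm_cauchy_schwarz)
  also have "\<dots> \<le> norm y * norm x" by (intro mult_right_mono A) auto
  finally show ?thesis using False by (simp add: y_def power2_eq_square)
qed simp

section \<open>Positive semidefinite forms are sums of squares of functionals\<close>

definition clinear_fun :: "(complex^'n \<Rightarrow> complex) \<Rightarrow> bool" where
  "clinear_fun \<phi> \<longleftrightarrow> (\<forall>x y. \<phi> (x + y) = \<phi> x + \<phi> y) \<and> (\<forall>c x. \<phi> (c *s x) = c * \<phi> x)"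

definition psd_form :: "(complex^'n \<Rightarrow> complex^'n \<Rightarrow> complex) \<Rightarrow> bool" where
  "psd_form F \<longleftrightarrow> (\<forall>z. clinear_fun (\<lambda>x. F x z)) \<and> (\<forall>x y. F y x = cnj (F x y)) \<and> (\<forall>x. 0 \<le> Re (F x x))"

lemma clinear_fun_diff: "clinear_fun \<phi> \<Longrightarrow> \<phi> (x - y) = \<phi> x - \<phi> y"
proof -
  assume \<phi>: "clinear_fun \<phi>"
  have "\<phi> (x + (-1) *s y) = \<phi> x + \<phi> ((-1) *s y)" "\<phi> ((-1) *s y) = (-1) * \<phi> y"
    using \<phi> unfolding clinear_fun_def by blast+
  moreover have "x + (-1) *s y = x - y" by (simp add: vec_eq_iff)
  ultimately show ?thesis by simp
qed

lemma clinear_fun_zero_on_basis: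
  assumes \<phi>: "clinear_fun \<phi>" and 0: "\<And>i. \<phi> (axis i 1) = 0"
  shows "\<phi> x = 0"
proof -
  have "\<phi> (\<Sum>i\<in>I. (x $ i) *s axis i 1) = 0" if "finite I" for I
    using that
  proof induction
    case empty
    have "\<phi> (0 *s 0) = 0 * \<phi> 0" using \<phi> unfolding clinear_fun_def by blast
    then show ?case by simp
  qed (use \<phi> 0 in \<open>auto simp: clinear_fun_def\<close>)
  from this[of UNIV] show ?thesis by (simp add: basis_expansion)
qed

text \<open>Otherwise the form would become negative at \<open>y - k F(y, p) p\<close> for large \<open>k\<close>.\<close>

lemma psd_form_null:
  assumes F: "psd_form F" and p: "F p p = 0"
  shows "F y p = 0"
proof (rule ccontr)
  assume n: "F y p \<noteq> 0"
  define b where "b = F y p"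
  have b: "0 < (cmod b)\<^sup>2" using n by (simp add: b_def)
  have lin: "clinear_fun (\<lambda>x. F x z)" and herm: "F x y = cnj (F y x)" for x y z
    using F unfolding psd_form_def by blast+
  have eq: "Re (F (y - (of_real k * b) *s p) (y - (of_real k * b) *s p)) = Re (F y y) - 2 * k * (cmod b)\<^sup>2" for k :: real
  proof -
    define x where "x = y - (of_real k * b) *s p"
    have l: "F x z = F y z - of_real k * b * F p z" for z
      unfolding x_def using lin[of z] clinear_fun_diff[OF lin[of z]] by (simp add: clinear_fun_def)
    have "F x x = F y x - of_real k * b * F p x" by (rule l)
    also have "F y x = cnj (F x y)" by (rule herm)
    also have "F p x = cnj (F x p)" by (rule herm)
    also have "F x p = b" using l[of p] p by (simp add: b_def)
    also have "F x y = F y y - of_real k * b * F p y" by (rule l)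
    also have "F p y = cnj b" unfolding b_def by (rule herm)
    finally have "F x x = cnj (F y y - of_real k * b * cnj b) - of_real k * b * cnj b" .
    also have "of_real k * b * cnj b = of_real (k * (cmod b)\<^sup>2)"
      by (simp add: mult.assoc complex_norm_square[symmetric])
    finally show ?thesis by (simp add: x_def)
  qed
  \<comment> \<open>chosen so that the value of the form becomes \<open>-1\<close>\<close>
  define k where "k = (Re (F y y) + 1) / (2 * (cmod b)\<^sup>2)"
  have "Re (F y y) - 2 * k * (cmod b)\<^sup>2 = -1" using b by (simp add: k_def field_simps)
  moreover have "0 \<le> Re (F y y) - 2 * k * (cmod b)\<^sup>2" using F unfolding eq[of k, symmetric] psd_form_def by blast
  ultimately show False by simp
qed

text \<open>A Schur complement: the new form at \<open>x\<close> is the old one at the component of \<open>x\<close> that is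
  \<open>F\<close>-orthogonal to \<open>p\<close>.\<close>

lemma psd_form_deflate:
  assumes F: "psd_form F" and p: "F p p = of_real d" "0 < d"
  shows "psd_form (\<lambda>x y. F x y - F x p * F p y / of_real d)"
proof -
  have lin: "clinear_fun (\<lambda>x. F x z)" and herm: "F x y = cnj (F y x)" and pos: "0 \<le> Re (F x x)" for x y z
    using F unfolding psd_form_def by blast+
  have "0 \<le> Re (F x x - F x p * F p x / of_real d)" for x
  proof -
    define t where "t = F x p / of_real d"
    define u where "u = x - t *s p"
    have l: "F u z = F x z - t * F p z" for z
      unfolding u_def using lin[of z] clinear_fun_diff[OF lin[of z]] by (simp add: clinear_fun_def)
    have up: "F u p = 0" using l[of p] p by (simp add: t_def)
    have "F u u = F x u - t * F p u" by (rule l)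
    also have "F p u = cnj (F u p)" by (rule herm)
    also have "F x u = cnj (F u x)" by (rule herm)
    also have "F u x = F x x - t * F p x" by (rule l)
    finally have "F u u = cnj (F x x - t * F p x)" by (simp add: up)
    then have "Re (F u u) = Re (F x x - F x p * F p x / of_real d)" by (simp only: complex_cnj(1)) (simp add: t_def)
    then show ?thesis using pos[of u] by simp
  qed
  moreover have "F y x - F y p * F p x / of_real d = cnj (F x y - F x p * F p y / of_real d)" for x y
    by (subst herm[of y x], subst herm[of y p], subst herm[of p x]) (simp add: mult.commute)
  moreover have "clinear_fun (\<lambda>x. F x z - F x p * F p z / of_real d)" for z
    using lin[of z] lin[of p] by (auto simp: clinear_fun_def algebra_simps add_divide_distrib)
  ultimately show ?thesis unfolding psd_form_def by blast
qed

text \<open>A Cholesky decomposition. Each step makes one more basis vector a null vector of the form,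
  at the price of at most one square.\<close>

lemma psd_form_sum_of_squares:
  assumes "finite S" "psd_form F" "\<And>i y. i \<notin> S \<Longrightarrow> F (axis i 1) y = 0"
  shows "\<exists>(n::nat) \<phi>. (\<forall>l<n. clinear_fun (\<phi> l)) \<and> (\<forall>x. Re (F x x) = (\<Sum>l<n. (cmod (\<phi> l x))\<^sup>2))"
  using assms
proof (induction S arbitrary: F)
  case empty
  have "F x y = 0" for x y
  proof (rule clinear_fun_zero_on_basis[of "\<lambda>x. F x y"])
    show "clinear_fun (\<lambda>x. F x y)" using empty.prems(1) unfolding psd_form_def by blast
    show "F (axis i 1) y = 0" for i by (rule empty.prems(2)) simp
  qed
  then show ?case by (intro exI[of _ 0]) auto
next
  case (insert i S)
  note F = \<open>psd_form F\<close>
  have lin: "clinear_fun (\<lambda>x. F x z)" and herm: "F x y = cnj (F y x)" and pos: "0 \<le> Re (F x x)" for x y z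
    using F unfolding psd_form_def by blast+
  define p where "p = (axis i 1 :: complex^'a)"
  define d where "d = Re (F p p)"
  have "cnj (F p p) = F p p" using herm[of p p] by simp
  then have pd: "F p p = of_real d" unfolding d_def by (metis Reals_cnj_iff of_real_Re)
  show ?case
  proof (cases "d = 0")
    case True
    show ?thesis
    proof (rule insert.IH[OF F])
      fix j y assume "j \<notin> S"
      show "F (axis j 1) y = 0"
      proof (cases "j = i")
        case True
        then show ?thesis using psd_form_null[OF F, of p y] herm[of p y] pd \<open>d = 0\<close> by (simp add: p_def)
      qed (use insert.prems(2) \<open>j \<notin> S\<close> in auto)
    qed
  next
    case False
    then have d: "0 < d" using pos[of p] by (simp add: d_def)
    define G where "G x y = F x y - F x p * F p y / of_real d" for x y
    have G: "psd_form G" unfolding G_def[abs_def] by (rule psd_form_deflate[OF F pd d])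
    have "\<exists>(n::nat) \<phi>. (\<forall>l<n. clinear_fun (\<phi> l)) \<and> (\<forall>x. Re (G x x) = (\<Sum>l<n. (cmod (\<phi> l x))\<^sup>2))"
    proof (rule insert.IH[OF G])
      fix j y assume "j \<notin> S"
      show "G (axis j 1) y = 0"
      proof (cases "j = i")
        case True
        then show ?thesis using d by (simp add: G_def pd flip: p_def)
      qed (use insert.prems(2)[of j] \<open>j \<notin> S\<close> in \<open>auto simp: G_def\<close>)
    qed
    then obtain n \<phi> where \<phi>: "\<And>l. l < n \<Longrightarrow> clinear_fun (\<phi> l)" "\<And>x. Re (G x x) = (\<Sum>l<n::nat. (cmod (\<phi> l x))\<^sup>2)"
      by blast
    define \<psi> where "\<psi> = \<phi>(n := (\<lambda>x. F x p / of_real (sqrt d)))"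
    show ?thesis
    proof (intro exI[of _ "Suc n"] exI[of _ \<psi>] conjI allI impI)
      fix l assume "l < Suc n"
      then show "clinear_fun (\<psi> l)"
        using \<phi>(1)[of l] lin[of p] by (cases "l = n") (auto simp: \<psi>_def clinear_fun_def add_divide_distrib)
    next
      fix x
      have "F x p * F p x = of_real ((cmod (F x p))\<^sup>2)" by (simp only: herm[of p x] complex_norm_square)
      then have "Re (F x x) = Re (G x x) + (cmod (F x p))\<^sup>2 / d" by (simp add: G_def)
      also have "(cmod (F x p))\<^sup>2 / d = (cmod (\<psi> n x))\<^sup>2" using d by (simp add: \<psi>_def norm_divide power_divide)
      also have "Re (G x x) = (\<Sum>l<n. (cmod (\<psi> l x))\<^sup>2)" unfolding \<phi>(2) by (intro sum.cong) (auto simp: \<psi>_def)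
      finally show "Re (F x x) = (\<Sum>l<Suc n. (cmod (\<psi> l x))\<^sup>2)" by simp
    qed
  qed
qed

lemma contraction_defect:
  fixes A :: "complex^'n^'n"
  assumes A: "\<And>x. norm (A *v x) \<le> norm x"
  obtains n :: nat and \<phi> where "\<And>l. l < n \<Longrightarrow> clinear_fun (\<phi> l)"
    "\<And>x. (norm x)\<^sup>2 - (norm (A *v x))\<^sup>2 = (\<Sum>l<n. (cmod (\<phi> l x))\<^sup>2)"
proof -
  define F where "F x y = cinner x y - cinner (A *v x) (A *v y)" for x y
  have d: "Re (F x x) = (norm x)\<^sup>2 - (norm (A *v x))\<^sup>2" for x by (simp add: F_def Re_cinner_self)
  have "psd_form F" unfolding psd_form_def
  proof (intro conjI allI)
    show "clinear_fun (\<lambda>x. F x z)" for z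
      by (simp add: clinear_fun_def F_def cinner_add_left cinner_scale_left matrix_vector_right_distrib matrix_vector_scale algebra_simps)
    show "F y x = cnj (F x y)" for x y
      unfolding F_def by (simp add: cinner_commute[of y x] cinner_commute[of "A *v y" "A *v x"])
    show "0 \<le> Re (F x x)" for x unfolding d using A[of x] by (simp add: power_mono)
  qed
  then have "\<exists>(n::nat) \<phi>. (\<forall>l<n. clinear_fun (\<phi> l)) \<and> (\<forall>x. Re (F x x) = (\<Sum>l<n. (cmod (\<phi> l x))\<^sup>2))"
    by (rule psd_form_sum_of_squares[of UNIV, rotated]) auto
  then show thesis using that unfolding d by blast
qed

section \<open>Polynomials in a matrix\<close>

text \<open>The polynomial at a matrix, applied to a vector, with a summation range that may exceed the
  degree; polynomials of different degrees can then be compared termwise.\<close>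

definition mv_poly :: "nat \<Rightarrow> complex poly \<Rightarrow> complex^'n^'n \<Rightarrow> complex^'n \<Rightarrow> complex^'n" where
  "mv_poly n p A x = (\<Sum>k<n. coeff p k *s (mat_pow A k *v x))"

lemma poly_mat_vector: "degree p < n \<Longrightarrow> poly_mat p A *v x = mv_poly n p A x"
proof -
  assume n: "degree p < n"
  have "(\<Sum>k\<in>I. M k) *v x = (\<Sum>k\<in>I. M k *v x)" if "finite I" for I and M :: "nat \<Rightarrow> complex^'a^'a"
    using that by induction (auto simp: matrix_vector_mult_add_rdistrib)
  then have "poly_mat p A *v x = (\<Sum>k\<le>degree p. coeff p k *s (mat_pow A k *v x))"
    by (simp add: poly_mat_def mat_vector_mult flip: matrix_vector_mul_assoc)
  also have "\<dots> = (\<Sum>k<n. coeff p k *s (mat_pow A k *v x))"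
    by (rule sum.mono_neutral_left) (use n in \<open>auto simp: coeff_eq_0\<close>)
  finally show ?thesis by (simp add: mv_poly_def)
qed

lemma poly_mat_linear_factor:
  "poly_mat ([:-c, 1:] * p) A *v x = A *v (poly_mat p A *v x) - c *s (poly_mat p A *v x)"
proof -
  define n where "n = Suc (degree p)"
  have Av: "A *v (\<Sum>k\<in>I. v k) = (\<Sum>k\<in>I. A *v v k)" if "finite I" for I and v :: "nat \<Rightarrow> complex^'a"
    using that by induction (auto simp: matrix_vector_right_distrib)
  have "degree ([:-c, 1:] * p) < Suc n" unfolding n_def
    using degree_mult_le[of "[:-c, 1:]" p] by (simp add: degree_pCons_eq_if)
  then have "poly_mat ([:-c, 1:] * p) A *v x = mv_poly (Suc n) ([:-c, 1:] * p) A x" by (rule poly_mat_vector)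
  also have "\<dots> = mv_poly (Suc n) (pCons 0 p) A x - c *s mv_poly (Suc n) p A x"
  proof -
    have cs: "c *s (\<Sum>k\<in>I. v k) = (\<Sum>k\<in>I. c *s v k)" for I and v :: "nat \<Rightarrow> complex^'a"
      by (simp add: vec_eq_iff sum_distrib_left)
    have co: "coeff ([:-c, 1:] * p) k = coeff (pCons 0 p) k - c * coeff p k" for k by simp
    show ?thesis unfolding mv_poly_def cs sum_subtractf[symmetric] co
      by (intro sum.cong refl) (simp add: vec_eq_iff algebra_simps)
  qed
  also have "mv_poly (Suc n) (pCons 0 p) A x = A *v mv_poly n p A x"
    unfolding mv_poly_def sum.lessThan_Suc_shift
    by (simp add: Av matrix_vector_scale matrix_vector_mul_assoc)
  also have "mv_poly n p A x = poly_mat p A *v x" by (rule poly_mat_vector[symmetric]) (simp add: n_def)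
  also have "mv_poly (Suc n) p A x = poly_mat p A *v x" by (rule poly_mat_vector[symmetric]) (simp add: n_def)
  finally show ?thesis .
qed

lemma poly_mat_one: "poly_mat 1 A = mat 1"
  by (simp add: poly_mat_def)

text \<open>Otherwise \<open>A - c\<close> could be cancelled and the cofactor \<open>p\<close>, of smaller degree, would
  annihilate \<open>A\<close>.\<close>

lemma min_poly_root_in_spectrum:
  assumes m: "is_min_poly A m" and r: "m = [:-c, 1:] * p"
  shows "c \<in> mat_spectrum A"
proof (rule ccontr)
  assume "c \<notin> mat_spectrum A"
  then obtain B where B: "B ** (mat c - A) = mat 1" by (auto simp: mat_spectrum_def invertible_def)
  have p0: "p \<noteq> 0" using m r by (auto simp: is_min_poly_def)
  have "poly_mat p A *v x = 0" for x
  proof -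
    define y where "y = poly_mat p A *v x"
    have "A *v y - c *s y = 0"
      using poly_mat_linear_factor[of c p A x] m unfolding r is_min_poly_def by (simp add: y_def)
    then have "(mat c - A) *v y = 0" by (simp add: matrix_vector_mult_diff_rdistrib mat_vector_mult)
    moreover have "B *v ((mat c - A) *v y) = y" by (simp only: matrix_vector_mul_assoc B matrix_vector_mul_lid)
    ultimately show ?thesis by (simp add: y_def)
  qed
  then have "poly_mat p A = 0" by (simp add: matrix_eq)
  then have "degree m \<le> degree p" using m p0 by (auto simp: is_min_poly_def)
  moreover have "degree m = Suc (degree p)" unfolding r using p0 by (subst degree_mult_eq) auto
  ultimately show False by simp
qed

section \<open>The isometric embedding into copies of the model space\<close>

lemma contractive_recursion_tendsto_0:
  fixes a :: "nat \<Rightarrow> real"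
  assumes a: "\<And>k. 0 \<le> a k" and rec: "\<And>k. a (Suc k) \<le> t * a k + \<epsilon> k"
    and t: "0 \<le> t" "t < 1" and \<epsilon>: "\<epsilon> \<longlonglongrightarrow> 0"
  shows "a \<longlonglongrightarrow> 0"
proof (rule LIMSEQ_I)
  fix r :: real assume r: "0 < r"
  have "eventually (\<lambda>k. \<epsilon> k < r / 2 * (1 - t)) sequentially"
    using r t by (intro order_tendstoD(2)[OF \<epsilon>]) auto
  then obtain m where m: "\<And>k. m \<le> k \<Longrightarrow> \<epsilon> k < r / 2 * (1 - t)" by (auto simp: eventually_sequentially)
  have b: "a (m + n) \<le> t ^ n * a m + r / 2" for n
  proof (induction n)
    case 0 then show ?case using r by simp
  next
    case (Suc n)
    have "a (m + Suc n) \<le> t * a (m + n) + \<epsilon> (m + n)" using rec[of "m + n"] by simp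
    also have "\<dots> \<le> t * (t ^ n * a m + r / 2) + r / 2 * (1 - t)"
      by (intro add_mono mult_left_mono Suc) (use t m[of "m + n"] in auto)
    finally show ?case by (simp add: field_simps)
  qed
  have "(\<lambda>n. t ^ n * a m) \<longlonglongrightarrow> 0 * a m" using t by (intro tendsto_intros LIMSEQ_power_zero) auto
  then have "eventually (\<lambda>n. t ^ n * a m < r / 2) sequentially" using r by (intro order_tendstoD(2)) auto
  then obtain n0 where n0: "\<And>n. n0 \<le> n \<Longrightarrow> t ^ n * a m < r / 2" by (auto simp: eventually_sequentially)
  show "\<exists>no. \<forall>n\<ge>no. norm (a n - 0) < r"
  proof (intro exI allI impI)
    fix n assume n: "n \<ge> m + n0"
    then obtain k where k: "n = m + k" "n0 \<le> k" by (metis add_leD1 le_Suc_ex nat_add_left_cancel_le)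
    show "norm (a n - 0) < r" using b[of k] n0[OF k(2)] a[of n] k by simp
  qed
qed

lemma norm_vector_scale: "norm (c *s (x :: complex^'n)) = cmod c * norm x"
  by (simp add: norm_vec_def norm_mult L2_set_right_distrib)

text \<open>The product of the factors \<open>T - cnj (lam i)\<close>, \<open>i \<le> n\<close>, applied to a vector. For \<open>T = adj A\<close>
  it is the adjoint of the product of the factors \<open>A - lam i\<close>.\<close>

definition ann :: "complex^'n^'n \<Rightarrow> (nat \<Rightarrow> complex) \<Rightarrow> nat \<Rightarrow> complex^'n \<Rightarrow> complex^'n" where
  "ann T lam = rec_nat (\<lambda>x. x) (\<lambda>n f x. f (T *v x - cnj (lam (Suc n)) *s x))"

lemma ann_simps:
  "ann T lam 0 x = x" "ann T lam (Suc n) x = ann T lam n (T *v x - cnj (lam (Suc n)) *s x)"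
  by (simp_all add: ann_def)

definition orbit :: "complex^'n^'n \<Rightarrow> nat \<Rightarrow> complex^'n \<Rightarrow> complex^'n" where
  "orbit T k = ((*v) T ^^ k)"

lemma orbit_simps: "orbit T 0 x = x" "orbit T (Suc k) x = T *v orbit T k x" "orbit T k (T *v x) = orbit T (Suc k) x"
  by (simp_all add: orbit_def funpow_swap1)

lemma orbit_linear: "orbit T k (x - c *s y) = orbit T k x - c *s orbit T k y"
  by (induction k) (simp_all add: orbit_simps(1,2) matrix_vector_mult_diff_distrib matrix_vector_scale)

text \<open>One factor at a time: if the orbit of \<open>y = T x - \<mu> x\<close> tends to zero, the orbit of \<open>x\<close>
  satisfies a recursion with factor \<open>\<bar>\<mu>\<bar> < 1\<close> and vanishing perturbation. No spectral radius
  formula enters.\<close>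

lemma orbit_tendsto_0:
  assumes "ann T lam n x = 0" "\<And>i. i \<in> {1..n} \<Longrightarrow> cmod (lam i) < 1"
  shows "(\<lambda>k. norm (orbit T k x)) \<longlonglongrightarrow> 0"
  using assms
proof (induction n arbitrary: x)
  case 0
  have "orbit T k 0 = 0" for k by (induction k) (simp_all add: orbit_simps)
  then show ?case using 0 by (simp add: ann_simps)
next
  case (Suc n)
  define \<mu> where "\<mu> = cnj (lam (Suc n))"
  define y where "y = T *v x - \<mu> *s x"
  have y: "(\<lambda>k. norm (orbit T k y)) \<longlonglongrightarrow> 0"
    by (rule Suc.IH) (use Suc.prems in \<open>auto simp: ann_simps y_def \<mu>_def\<close>)
  show ?case
  proof (rule contractive_recursion_tendsto_0[OF _ _ _ _ y, where t = "cmod \<mu>"])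
    fix k
    have "orbit T (Suc k) x = orbit T k y + \<mu> *s orbit T k x" by (simp add: y_def orbit_linear orbit_simps(3))
    then have "norm (orbit T (Suc k) x) \<le> norm (orbit T k y) + norm (\<mu> *s orbit T k x)" by (metis norm_triangle_ineq)
    then show "norm (orbit T (Suc k) x) \<le> cmod \<mu> * norm (orbit T k x) + norm (orbit T k y)"
      by (simp add: norm_vector_scale)
  qed (use Suc.prems(2)[of "Suc n"] in \<open>auto simp: \<mu>_def\<close>)
qed

lemma ann_adj:
  "cinner (poly_mat (\<Prod>i=1..n. [:- lam i, 1:]) A *v y) x = cinner y (ann (adj A) lam n x)"
proof (induction n arbitrary: x)
  case 0
  then show ?case by (simp add: poly_mat_one ann_simps)
next
  case (Suc n)
  define v where "v = poly_mat (\<Prod>i=1..n. [:- lam i, 1:]) A *v y"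
  have "poly_mat (\<Prod>i=1..Suc n. [:- lam i, 1:]) A *v y = A *v v - lam (Suc n) *s v"
    using poly_mat_linear_factor[of "lam (Suc n)" "\<Prod>i=1..n. [:- lam i, 1:]" A y] by (simp add: v_def mult.commute)
  then have "cinner (poly_mat (\<Prod>i=1..Suc n. [:- lam i, 1:]) A *v y) x = cinner v (adj A *v x - cnj (lam (Suc n)) *s x)"
    by (simp add: cinner_diff_left cinner_diff_right cinner_scale_left cinner_scale_right cinner_adj)
  also have "\<dots> = cinner y (ann (adj A) lam (Suc n) x)" unfolding v_def Suc.IH by (simp add: ann_simps)
  finally show ?case .
qed

context blaschke_zeros
begin

text \<open>The denominators of the Blaschke factors are absorbed into \<open>F\<close>, leaving the polynomial with
  the given zeros.\<close>

lemma hardy2_divide_product: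
  assumes "n \<le> N" "f \<in> hardy2"
  shows "\<exists>F\<in>hardy2. (\<lambda>z. blaschke lam n z * f z) = (\<lambda>z. (\<Prod>i=1..n. z - lam i) * F z)"
  using assms
proof (induction n arbitrary: f)
  case 0
  then show ?case by (auto simp: blaschke_0)
next
  case (Suc n)
  have "(\<lambda>z. f z / (1 - cnj (lam (Suc n)) * z)) \<in> hardy2"
    by (rule hardy2_divide_kernel) (use Suc zeros in auto)
  then obtain F where F: "F \<in> hardy2"
    "\<And>z. blaschke lam n z * (f z / (1 - cnj (lam (Suc n)) * z)) = (\<Prod>i=1..n. z - lam i) * F z"
    using Suc.IH[of "\<lambda>z. f z / (1 - cnj (lam (Suc n)) * z)"] Suc.prems by (auto simp: fun_eq_iff)
  have "blaschke lam (Suc n) z * f z = (z - lam (Suc n)) * ((\<Prod>i=1..n. z - lam i) * F z)" for z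
    unfolding F(2)[symmetric] by (simp add: blaschke_Suc blaschke_factor_def)
  then have "(\<lambda>z. blaschke lam (Suc n) z * f z) = (\<lambda>z. (\<Prod>i=1..Suc n. z - lam i) * F z)"
    by (simp add: mult_ac)
  then show ?case using F(1) by blast
qed

end

lemma hardy2_product_linear: "F \<in> hardy2 \<Longrightarrow> (\<lambda>z. (\<Prod>i=1..n::nat. z - lam i) * F z) \<in> hardy2"
proof (induction n)
  case (Suc n)
  then show ?case using hardy2_linear_factor[of "\<lambda>z. (\<Prod>i=1..n. z - lam i) * F z" "lam (Suc n)"] by (simp add: mult_ac)
qed simp

text \<open>In the application \<open>T\<close> is the adjoint of \<open>A\<close>; the adjoint is used because it is the backward
  shift, not the shift, that leaves the model space invariant.\<close>

locale model_embedding = blaschke_zeros lam N for lam :: "nat \<Rightarrow> complex" and N :: nat +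
  fixes T :: "complex^'n^'n" and n :: nat and \<phi> :: "nat \<Rightarrow> complex^'n \<Rightarrow> complex"
  assumes lin: "\<And>l. l < n \<Longrightarrow> clinear_fun (\<phi> l)"
    and defect: "\<And>x. (norm x)\<^sup>2 - (norm (T *v x))\<^sup>2 = (\<Sum>l<n. (cmod (\<phi> l x))\<^sup>2)"
    and annihilated: "\<And>x. ann T lam N x = 0"
begin

definition W :: "nat \<Rightarrow> complex^'n \<Rightarrow> complex \<Rightarrow> complex" where
  "W l x = hfun (\<lambda>k. \<phi> l (orbit T k x))"

text \<open>A telescoping sum.\<close>

lemma partial_energy: "(\<Sum>k<m. \<Sum>l<n. (cmod (\<phi> l (orbit T k x)))\<^sup>2) = (norm x)\<^sup>2 - (norm (orbit T m x))\<^sup>2"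
  by (induction m) (simp_all add: orbit_simps(1,2) flip: defect)

lemma coeff_ell2: "l < n \<Longrightarrow> (\<lambda>k. \<phi> l (orbit T k x)) \<in> ell2"
proof (rule ell2I)
  fix m assume l: "l < n"
  have "(\<Sum>k<Suc m. (cmod (\<phi> l (orbit T k x)))\<^sup>2) \<le> (\<Sum>k<Suc m. \<Sum>l<n. (cmod (\<phi> l (orbit T k x)))\<^sup>2)"
    by (rule sum_mono, rule member_le_sum) (use l in auto)
  also have "\<dots> \<le> (norm x)\<^sup>2" unfolding partial_energy by simp
  finally show "(\<Sum>k<Suc m. (cmod (\<phi> l (orbit T k x)))\<^sup>2) \<le> (norm x)\<^sup>2" .
qed

lemma W_hardy2: "l < n \<Longrightarrow> W l x \<in> hardy2"
  unfolding W_def by (intro hfun_hardy2 coeff_ell2)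

lemma taylor_coeff_W: "l < n \<Longrightarrow> taylor_coeff (W l x) = (\<lambda>k. \<phi> l (orbit T k x))"
  unfolding W_def by (intro taylor_coeff_hfun coeff_ell2)

lemma W_isometric: "(\<Sum>l<n. (hardy_norm (W l x))\<^sup>2) = (norm x)\<^sup>2"
proof -
  have "(\<lambda>k. \<Sum>l<n. (cmod (\<phi> l (orbit T k x)))\<^sup>2) sums (\<Sum>l<n. (hardy_norm (W l x))\<^sup>2)"
  proof (rule sums_sum)
    fix l assume "l \<in> {..<n}"
    then have l: "l < n" by simp
    have "(hardy_norm (W l x))\<^sup>2 = ell2_sq (\<lambda>k. \<phi> l (orbit T k x))"
      using l by (simp add: hardy_norm_eq W_hardy2 taylor_coeff_W ell2_sq_nonneg coeff_ell2)
    then show "(\<lambda>k. (cmod (\<phi> l (orbit T k x)))\<^sup>2) sums (hardy_norm (W l x))\<^sup>2"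
      using coeff_ell2[OF l, of x] by (auto simp: ell2_def ell2_sq_def)
  qed
  moreover have "(\<lambda>m. (norm x)\<^sup>2 - (norm (orbit T m x))\<^sup>2) \<longlonglongrightarrow> (norm x)\<^sup>2 - 0\<^sup>2"
    by (intro tendsto_intros orbit_tendsto_0[OF annihilated] zeros)
  then have "(\<lambda>k. \<Sum>l<n. (cmod (\<phi> l (orbit T k x)))\<^sup>2) sums ((norm x)\<^sup>2)"
    unfolding sums_def partial_energy by simp
  ultimately show ?thesis by (rule sums_unique2)
qed

lemma bshift_W: "l < n \<Longrightarrow> bshift (W l x) = W l (T *v x)"
  unfolding bshift_def by (simp only: taylor_coeff_W) (simp only: W_def orbit_simps(3))

lemma W_linear:
  assumes l: "l < n"
  shows "W l (x - c *s y) = (\<lambda>z. W l x z - c * W l y z)"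
proof -
  have e: "(\<lambda>k. \<phi> l (orbit T k (x - c *s y))) = (\<lambda>k. \<phi> l (orbit T k x) + (- c) * \<phi> l (orbit T k y))"
    using lin[OF l] by (auto simp: orbit_linear clinear_fun_diff clinear_fun_def)
  have "W l (x - c *s y) z = W l x z + (- c) * W l y z" for z
    unfolding W_def e using l by (simp only: hfun_add hfun_scale ell2_scale coeff_ell2)
  then show ?thesis by (simp add: fun_eq_iff)
qed

text \<open>The adjoint of multiplication by \<open>z - lam i\<close> is \<open>bshift - cnj (lam i)\<close>, and \<open>W l\<close> turns it
  into \<open>T - cnj (lam i)\<close>.\<close>

lemma hardy_inner_product_W:
  assumes l: "l < n" and F: "F \<in> hardy2"
  shows "hardy_inner (\<lambda>z. (\<Prod>i=1..m. z - lam i) * F z) (W l x) = hardy_inner F (W l (ann T lam m x))"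
proof (induction m arbitrary: x)
  case 0
  then show ?case by (simp add: ann_simps)
next
  case (Suc m)
  define G where "G z = (\<Prod>i=1..m. z - lam i) * F z" for z
  have G: "G \<in> hardy2" unfolding G_def[abs_def] by (rule hardy2_product_linear[OF F])
  have "(\<lambda>z. (\<Prod>i=1..Suc m. z - lam i) * F z) = (\<lambda>z. z * G z - lam (Suc m) * G z)"
    by (simp add: G_def fun_eq_iff algebra_simps)
  then have "hardy_inner (\<lambda>z. (\<Prod>i=1..Suc m. z - lam i) * F z) (W l x) =
      hardy_inner G (W l (T *v x)) - lam (Suc m) * hardy_inner G (W l x)"
    using G W_hardy2[OF l, of x]
    by (simp only: hardy_inner_diff_left hardy2_times_z hardy2_scale hardy_inner_times_z hardy_inner_scale_left bshift_W[OF l])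
  also have "\<dots> = hardy_inner G (W l (T *v x - cnj (lam (Suc m)) *s x))"
    using G W_hardy2[OF l]
    by (simp add: W_linear[OF l] hardy_inner_diff_right hardy_inner_scale_right hardy2_scale)
  also have "\<dots> = hardy_inner F (W l (ann T lam (Suc m) x))"
    unfolding G_def[abs_def] Suc.IH by (simp add: ann_simps)
  finally show ?case .
qed

lemma W_zero: "l < n \<Longrightarrow> W l 0 = (\<lambda>z. 0)"
  using W_linear[of l 0 1 0] by (simp add: fun_eq_iff)

lemma W_model_space:
  assumes l: "l < n"
  shows "W l x \<in> K"
  unfolding model_space_def mem_Collect_eq
proof (intro conjI ballI)
  show "W l x \<in> hardy2" by (rule W_hardy2[OF l])
  fix g assume g: "g \<in> hardy2"
  obtain F where F: "F \<in> hardy2" "(\<lambda>z. blaschke lam N z * g z) = (\<lambda>z. (\<Prod>i=1..N. z - lam i) * F z)"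
    using hardy2_divide_product[OF order_refl g] by blast
  have "hardy_inner (\<lambda>z. blaschke lam N z * g z) (W l x) = hardy_inner F (\<lambda>z. 0)"
    unfolding F(2) hardy_inner_product_W[OF l F(1)] annihilated W_zero[OF l] ..
  also have "\<dots> = 0" using hardy_inner_commute[OF hardy2_zero F(1)] F(1) by (simp add: hardy_inner_zero_left)
  finally show "hardy_inner (W l x) (\<lambda>z. blaschke lam N z * g z) = 0"
    using hardy_inner_commute[OF hardy2_blaschke[OF order_refl g] W_hardy2[OF l, of x]] by simp
qed

lemma vector_lower_bound:
  assumes \<zeta>: "\<And>i. i \<in> {1..N} \<Longrightarrow> \<zeta> \<noteq> lam i"
  shows "norm x \<le> hardy_opnorm K (resolvent \<zeta>) * norm (cnj \<zeta> *s x - T *v x)"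
proof -
  define R where "R = hardy_opnorm K (resolvent \<zeta>)"
  define y where "y = cnj \<zeta> *s x - T *v x"
  have R: "0 \<le> R" unfolding R_def by (rule model_resolvent_opnorm_nonneg[OF \<zeta>])
  have "hardy_norm (W l x) \<le> R * hardy_norm (W l y)" if l: "l < n" for l
  proof -
    have "hardy_norm (W l x) \<le> R * hardy_norm (\<lambda>z. cnj \<zeta> * W l x z - bshift (W l x) z)"
      unfolding R_def by (rule adjoint_lower_bound[OF \<zeta> W_model_space[OF l]])
    also have "(\<lambda>z. cnj \<zeta> * W l x z - bshift (W l x) z) = (\<lambda>z. (-1) * W l (T *v x - cnj \<zeta> *s x) z)"
      by (simp add: bshift_W[OF l] W_linear[OF l] fun_eq_iff)
    also have "\<dots> = W l (0 - 1 *s (T *v x - cnj \<zeta> *s x))"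
      unfolding W_linear[OF l, of 0] W_zero[OF l] by simp
    also have "0 - 1 *s (T *v x - cnj \<zeta> *s x) = y" by (simp add: y_def)
    finally show ?thesis .
  qed
  then have "(\<Sum>l<n. (hardy_norm (W l x))\<^sup>2) \<le> (\<Sum>l<n. (R * hardy_norm (W l y))\<^sup>2)"
    by (intro sum_mono power_mono) (auto intro: hardy_norm_nonneg W_hardy2)
  also have "\<dots> = R\<^sup>2 * (\<Sum>l<n. (hardy_norm (W l y))\<^sup>2)" by (simp add: power_mult_distrib sum_distrib_left)
  finally have "(norm x)\<^sup>2 \<le> (R * norm y)\<^sup>2" by (simp add: W_isometric power_mult_distrib)
  then show ?thesis using R by (intro power2_le_imp_le[of "norm x"]) (simp_all add: R_def y_def)
qed

end

text \<open>The bound on \<open>cnj \<zeta> - adj A\<close> shows that it is injective, hence surjective. Writing \<open>v = (\<zeta> -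
  A)\<^sup>-\<^sup>1 y\<close> as \<open>(cnj \<zeta> - adj A) x\<close> gives \<open>\<parallel>v\<parallel>\<^sup>2 = Re \<langle>y, x\<rangle> \<le> \<parallel>y\<parallel> R \<parallel>v\<parallel>\<close>.\<close>

lemma resolvent_bound:
  fixes A :: "complex^'n^'n"
  assumes bound: "\<And>x. norm x \<le> R * norm (cnj \<zeta> *s x - adj A *v x)"
    and \<zeta>: "\<zeta> \<notin> mat_spectrum A"
  shows "norm (matrix_inv (mat \<zeta> - A) *v y) \<le> R * norm y"
proof (cases "matrix_inv (mat \<zeta> - A) *v y = 0")
  case False
  define v where "v = matrix_inv (mat \<zeta> - A) *v y"
  have "invertible (mat \<zeta> - A)" using \<zeta> by (simp add: mat_spectrum_def)
  then have "(mat \<zeta> - A) ** matrix_inv (mat \<zeta> - A) = mat 1"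
    unfolding invertible_def matrix_inv_def by (rule someI2_ex) simp
  then have "(mat \<zeta> - A) *v v = y" by (simp only: v_def matrix_vector_mul_assoc matrix_vector_mul_lid)
  then have v: "\<zeta> *s v - A *v v = y" by (simp add: matrix_vector_mult_diff_rdistrib mat_vector_mult)
  define L where "L x = cnj \<zeta> *s x - adj A *v x" for x
  have L: "L x = (mat (cnj \<zeta>) - adj A) *v x" for x
    by (simp add: L_def matrix_vector_mult_diff_rdistrib mat_vector_mult)
  have lin: "linear L" unfolding L[abs_def] by (rule matrix_vector_mul_linear)
  have "inj L" unfolding linear_injective_0[OF lin]
  proof (intro allI impI)
    fix x assume "L x = 0"
    then show "x = 0" using bound[of x] by (simp add: L_def)
  qed
  then have "surj L" by (rule linear_injective_imp_surjective[OF lin]) (rule refl)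
  then obtain x where x: "L x = v" by (metis surjD)
  have "(norm v)\<^sup>2 = Re (cinner v (cnj \<zeta> *s x - adj A *v x))" using x by (simp add: Re_cinner_self L_def)
  also have "\<dots> = Re (cinner (\<zeta> *s v - A *v v) x)"
    by (simp add: cinner_diff_left cinner_diff_right cinner_scale_left cinner_scale_right cinner_adj)
  also have "\<dots> \<le> norm y * norm x" unfolding v Re_cinner by (rule norm_cauchy_schwarz)
  also have "\<dots> \<le> norm y * (R * norm v)" using bound[of x] x by (intro mult_left_mono) (auto simp: L_def)
  finally have "norm v * norm v \<le> (R * norm y) * norm v" by (simp add: power2_eq_square mult_ac)
  then show ?thesis using False by (simp add: v_def)
next
  case True
  have "0 \<le> R * norm y"
  proof (cases "y = 0")
    case False
    have "0 < norm y" using False by simp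
    also have "norm y \<le> R * norm (cnj \<zeta> *s y - adj A *v y)" by (rule bound)
    finally have "0 \<le> R" by (simp add: zero_less_mult_iff not_less)
    then show ?thesis by simp
  qed simp
  then show ?thesis using True by simp
qed

theorem mainTheorem1:
  fixes A :: "complex^'n^'n" and m :: "complex poly" and lam :: "nat \<Rightarrow> complex"
    and B :: "complex \<Rightarrow> complex" and \<zeta> :: complex
  assumes contraction: "onorm (\<lambda>x. A *v x) \<le> 1"
    and min_poly: "is_min_poly A m"
    and zeros: "m = (\<Prod>i=1..degree m. [:- lam i, 1:])"
    and spec: "mat_spectrum A \<subseteq> ball 0 1"
    and B: "B = blaschke lam (degree m)"
    and zeta: "\<zeta> \<notin> mat_spectrum A"
  shows "bij_betw (model_shifted B \<zeta>) (model_space B) (model_space B)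
    \<and> onorm (\<lambda>x. matrix_inv (mat \<zeta> - A) *v x)
        \<le> hardy_opnorm (model_space B) (model_resolvent B \<zeta>)
    \<and> (\<forall>i\<in>{1..degree m}. \<forall>j\<in>{1..degree m}.
         hardy_inner (model_resolvent B \<zeta> (mw_basis lam j)) (mw_basis lam i) =
           (if i < j then 0
            else if i = j then 1 / (\<zeta> - lam i)
            else of_real (sqrt (1 - (cmod (lam i))\<^sup>2)) / (\<zeta> - lam i)
                 * (of_real (sqrt (1 - (cmod (lam j))\<^sup>2)) / (\<zeta> - lam j))
                 * (\<Prod>\<mu>=j+1..i-1. (1 - cnj (lam \<mu>) * \<zeta>) / (\<zeta> - lam \<mu>))))"
proof -
  define N where "N = degree m"
  have m_eq: "m = (\<Prod>i=1..N. [:- lam i, 1:])" using zeros by (simp add: N_def)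
  have root: "lam i \<in> mat_spectrum A" if i: "i \<in> {1..N}" for i
  proof (rule min_poly_root_in_spectrum[OF min_poly])
    show "m = [:- lam i, 1:] * (\<Prod>j\<in>{1..N} - {i}. [:- lam j, 1:])"
      unfolding m_eq by (rule prod.remove) (use i in auto)
  qed
  have disk: "cmod (lam i) < 1" if "i \<in> {1..N}" for i using root[OF that] spec by auto
  have ne: "\<zeta> \<noteq> lam i" if "i \<in> {1..N}" for i using root[OF that] zeta by auto
  interpret blaschke_zeros lam N by unfold_locales (rule disk)
  have "norm (A *v x) \<le> norm x" for x
  proof -
    have "norm (A *v x) \<le> onorm (\<lambda>x. A *v x) * norm x" by (rule onorm) simp
    also have "\<dots> \<le> 1 * norm x" by (intro mult_right_mono contraction) simp
    finally show ?thesis by simp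
  qed
  then have "norm (adj A *v x) \<le> norm x" for x by (rule adj_contraction)
  then obtain n \<phi> where \<phi>: "\<And>l. l < n \<Longrightarrow> clinear_fun (\<phi> l)"
    "\<And>x. (norm x)\<^sup>2 - (norm (adj A *v x))\<^sup>2 = (\<Sum>l<n::nat. (cmod (\<phi> l x))\<^sup>2)"
    using contraction_defect by blast
  have "ann (adj A) lam N x = 0" for x
  proof (rule cinner_eq_0)
    fix y
    have "poly_mat m A *v y = 0" using min_poly by (simp add: is_min_poly_def)
    then show "cinner y (ann (adj A) lam N x) = 0"
      unfolding ann_adj[symmetric] m_eq[symmetric] by (simp add: cinner_def)
  qed
  then interpret model_embedding lam N "adj A" n \<phi>
    by unfold_locales (use \<phi> in auto)
  have "norm (matrix_inv (mat \<zeta> - A) *v y) \<le> hardy_opnorm K (resolvent \<zeta>) * norm y" for y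
    by (rule resolvent_bound[OF vector_lower_bound zeta]) (rule ne)
  then have "onorm (\<lambda>x. matrix_inv (mat \<zeta> - A) *v x) \<le> hardy_opnorm K (resolvent \<zeta>)"
    by (rule onorm_le)
  then show ?thesis
    unfolding B N_def[symmetric]
  proof (intro conjI ballI)
    show "bij_betw (shifted \<zeta>) K K" by (rule model_shifted_bij[OF ne])
    fix i j assume "i \<in> {1..N}" "j \<in> {1..N}"
    from model_resolvent_matrix[OF ne this] show "hardy_inner (resolvent \<zeta> (mw_basis lam j)) (mw_basis lam i) =
           (if i < j then 0
            else if i = j then 1 / (\<zeta> - lam i)
            else of_real (sqrt (1 - (cmod (lam i))\<^sup>2)) / (\<zeta> - lam i)
                 * (of_real (sqrt (1 - (cmod (lam j))\<^sup>2)) / (\<zeta> - lam j))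
                 * (\<Prod>\<mu>=j+1..i-1. (1 - cnj (lam \<mu>) * \<zeta>) / (\<zeta> - lam \<mu>)))"
      unfolding s_def .
  qed
qed

end
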